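(* Consider the infinite-color urn model with parameters $\ell\ge1$, $s\ge1$ and initial cumulative counts $m_1,\dots,m_s$ (with $m_1\ge1$ and $m_{k+1}-m_k\ge1$ for $1\le k<s$). Fix $r>s$. Let $B_1,\dots,B_{r-1}$ and $Z_r$ be independent random variables with $B_k\sim\mathrm{Beta}(m_k,m_{k+1}-m_k)$ for $1\le k<s$, $B_k\sim\mathrm{Beta}(m_s+(\ell+1)(k-s)+\ell,1)$ for $s\le k<r$, and $Z_r\sim\mathrm{GGa}(m_s+(\ell+1)(r-s)+\ell,\ell+1)$. Define $Z_k=B_k\cdots B_{r-1}Z_r$ for $1\le k<r$, $Z=(Z_1,\dots,Z_r)$, and $$W(n)=\frac{\ell^{\ell/(\ell+1)}}{(\ell+1)n^{\ell/(\ell+1)}}\big(M_1(n),\dots,M_r(n)\big).$$ Then there is a constant $C>0$, independent of $n$, such that for all $n\ge1$, $$\sup_K\big|\mathbb{P}[W(n)\in K]-\mathbb{P}[Z\in K]\big|\le\frac{C}{n^{\ell/(\ell+1)}},$$ where the supremum is over all convex $K\subset\mathbb{R}^r$.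
   Context: Infinite-color urn model: at time $0$ the urn contains balls of colors $1,\dots,s$ (at least one of each). Fix an integer $\ell\ge1$. At the $n$th step ($n\ge1$) a ball is drawn uniformly at random and returned together with one additional ball of the same color; additionally, if $n$ is a multiple of $\ell$, one ball of the new color $s+n/\ell$ is added after the $n$th draw. $M_k(n)$ is the number of balls with colors in $\{1,\dots,k\}$ after the $n$th draw (and possible immigration) is completed, and $m_k=M_k(0)$. $\mathrm{GGa}(a,b)$ has density $\propto x^{a-1}e^{-x^b}$ on $(0,\infty)$; $\mathrm{Beta}(a,b)$ has density $\propto x^{a-1}(1-x)^{b-1}$ on $(0,1)$. *)

theory Defs
  imports "HOL-Probability.Probability"
begin

text \<open>An urn is a multiset of colors (positive naturals).  Initial urn: color k (1 \<le> k \<le> s)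
  has m_k - m_(k-1) balls, with the convention m_0 = 0, so that m_k = M_k(0).\<close>

definition urn0 :: "nat \<Rightarrow> (nat \<Rightarrow> nat) \<Rightarrow> nat multiset" where
  "urn0 s m = (\<Sum>k\<in>{1..s}. replicate_mset (m k - (if k = 1 then 0 else m (k - 1))) k)"

primrec urn :: "nat \<Rightarrow> nat \<Rightarrow> (nat \<Rightarrow> nat) \<Rightarrow> nat \<Rightarrow> nat multiset pmf" where
  "urn l s m 0 = return_pmf (urn0 s m)"
| "urn l s m (Suc n) =
     bind_pmf (urn l s m n) (\<lambda>U. map_pmf
        (\<lambda>c. add_mset c U + (if l dvd Suc n then {# s + Suc n div l #} else {#}))
        (pmf_of_multiset U))"

definition Mcount :: "nat \<Rightarrow> nat multiset \<Rightarrow> nat" where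
  "Mcount k U = size (filter_mset (\<lambda>c. 1 \<le> c \<and> c \<le> k) U)"

text \<open>Vectors of R^r are represented as extensional functions on {1..r}.\<close>
definition Wvec :: "nat \<Rightarrow> nat \<Rightarrow> nat \<Rightarrow> nat multiset \<Rightarrow> (nat \<Rightarrow> real)" where
  "Wvec l r n U = (\<lambda>k\<in>{1..r}.
      real l powr (real l / (real l + 1)) / ((real l + 1) * real n powr (real l / (real l + 1)))
      * real (Mcount k U))"

definition convex_fun :: "(nat \<Rightarrow> real) set \<Rightarrow> bool" where
  "convex_fun K \<longleftrightarrow> (\<forall>x\<in>K. \<forall>y\<in>K. \<forall>u::real. 0 \<le> u \<and> u \<le> 1 \<longrightarrow>
      (\<lambda>k. (1 - u) * x k + u * y k) \<in> K)"

definition prop_density :: "(real \<Rightarrow> real) \<Rightarrow> real measure" where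
  "prop_density f = density lborel (\<lambda>x. ennreal (f x / integral\<^sup>L lborel f))"

definition Beta_dist :: "real \<Rightarrow> real \<Rightarrow> real measure" where
  "Beta_dist a b = prop_density
     (\<lambda>x. indicator {0<..<1} x * x powr (a - 1) * (1 - x) powr (b - 1))"

definition GGa_dist :: "real \<Rightarrow> real \<Rightarrow> real measure" where
  "GGa_dist a b = prop_density (\<lambda>x. indicator {0<..} x * x powr (a - 1) * exp (- (x powr b)))"

text \<open>Laws of B_1,...,B_(r-1) (indices k < r) and Z_r (index r).\<close>
definition comp_law :: "nat \<Rightarrow> nat \<Rightarrow> (nat \<Rightarrow> nat) \<Rightarrow> nat \<Rightarrow> nat \<Rightarrow> real measure" where
  "comp_law l s m r k =
     (if k < s then Beta_dist (real (m k)) (real (m (k + 1)) - real (m k))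
      else if k < r then Beta_dist (real (m s) + (real l + 1) * (real k - real s) + real l) 1
      else GGa_dist (real (m s) + (real l + 1) * (real r - real s) + real l) (real l + 1))"

definition Zmap :: "nat \<Rightarrow> (nat \<Rightarrow> real) \<Rightarrow> (nat \<Rightarrow> real)" where
  "Zmap r \<omega> = (\<lambda>k\<in>{1..r}. (\<Prod>j\<in>{k..<r}. \<omega> j) * \<omega> r)"

definition Z_law :: "nat \<Rightarrow> nat \<Rightarrow> (nat \<Rightarrow> nat) \<Rightarrow> nat \<Rightarrow> (nat \<Rightarrow> real) measure" where
  "Z_law l s m r = distr (PiM {1..r} (comp_law l s m r)) (PiM {1..r} (\<lambda>_. lborel)) (Zmap r)"

end

theory Submission
  imports Defs
begin

text \<open>
  Given the cumulative counts up to color \<open>k + 1\<close>, the count up to color \<open>k\<close> evolves as in a classical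
  Polya urn, so \<open>M_1(n), ..., M_r(n)\<close> is a Markov chain run downwards from \<open>M_r(n)\<close>, whose steps are
  approximately multiplication by the independent beta variables \<open>B_k\<close>.  One step at a time, each Polya step is
  replaced by its beta limit.  Along each replacement a convex set is seen only through its sections by lines,
  which are intervals; hence a one-dimensional Kolmogorov bound suffices, namely \<open>O(1/M_{k+1}(n))\<close>, and the
  expectation of the latter is of the order \<open>n^{-l/(l+1)}\<close>.  The same section argument along the ray through
  the origin leaves a Kolmogorov bound for \<open>M_r(n)\<close> itself against the generalised gamma law.  That one comes from
  Stein's method: biasing \<open>M_r(n)\<close> by its rising factorial of order \<open>l + 1\<close> amounts to delaying the urn by one
  immigration period, which yields an exact discrete version of the Stein equation.
\<close>

subsection \<open>Pure birth chains with linear rates\<close>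

text \<open>A convex set need not be Borel, and once a coordinate has been averaged its indicator is
  no longer an indicator. Both obstacles are met by one notion, total variation at most 2 along
  every affine line: it makes sections Borel, as differences of monotone functions; averages over
  linear substitutions inherit it; and it turns a Kolmogorov bound into a bound for integrals with
  factor 2 * 2 + 1 = 5. Hence no constant depends on the set. Under the limit law the set is
  measured in the completion, after being squeezed between Borel sets. The error of one replacement
  survives the later ones because \<open>1 / (i - 1)\<close> is an eigenfunction of every birth
  step, so that its expectation is an explicit product. The Stein solution has a corner at the
  threshold \<open>t\<close>, which spoils a second-order expansion at one lattice point at most.
  The mass of that point is bounded by the same Stein identity, applied to the solution for a point
  indicator. The top count is followed from the time color \<open>r + 1\<close> enters, when exactly
  one ball lies outside colors \<open>1..r\<close>; small times are covered by the trivial bound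
  1.\<close>

definition step_op :: "real \<Rightarrow> (nat \<Rightarrow> real) \<Rightarrow> nat \<Rightarrow> real" where
  "step_op T G i = G i + real i / T * (G (Suc i) - G i)"

text \<open>\<open>bernoulli_pmf\<close> truncates its parameter to the unit interval. The side
  condition \<open>w + n \<le> T n\<close> of the lemmas below keeps \<open>i / T n\<close> in that
  interval on the support, so that the truncation never acts.\<close>

primrec chain :: "(nat \<Rightarrow> nat) \<Rightarrow> nat \<Rightarrow> nat \<Rightarrow> nat pmf" where
  "chain T w 0 = return_pmf w"
| "chain T w (Suc n) = bind_pmf (chain T w n)
     (\<lambda>i. map_pmf (\<lambda>b. if b then Suc i else i) (bernoulli_pmf (real i / real (T n))))"

lemma set_pmf_chain: "set_pmf (chain T w n) \<subseteq> {w..w+n}"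
proof (induction n)
  case (Suc n)
  then show ?case by (fastforce split: if_splits)
qed simp

lemma finite_set_pmf_chain [simp]: "finite (set_pmf (chain T w n))"
  by (rule finite_subset[OF set_pmf_chain]) simp

lemma integrable_chain [simp]: "integrable (measure_pmf (chain T w n)) (G :: nat \<Rightarrow> real)"
  by (rule integrable_measure_pmf_finite) simp

lemma expectation_bind_finite:
  fixes h :: "'b \<Rightarrow> real"
  assumes "finite (set_pmf p)" "\<And>x. x \<in> set_pmf p \<Longrightarrow> finite (set_pmf (f x))"
  shows "measure_pmf.expectation (bind_pmf p f) h =
    measure_pmf.expectation p (\<lambda>x. measure_pmf.expectation (f x) h)"
  by (subst pmf_expectation_bind[OF assms(1,2) order_refl])
     (auto simp: integral_measure_pmf[OF assms(1)])

lemma expectation_mono_on_support: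
  fixes f g :: "'a \<Rightarrow> real"
  assumes "finite (set_pmf p)" "\<And>x. x \<in> set_pmf p \<Longrightarrow> f x \<le> g x"
  shows "measure_pmf.expectation p f \<le> measure_pmf.expectation p g"
  using assms by (intro integral_mono_AE integrable_measure_pmf_finite) (auto simp: AE_measure_pmf_iff)

lemma expectation_cong_on_support:
  fixes f g :: "'a \<Rightarrow> real"
  assumes "\<And>x. x \<in> set_pmf p \<Longrightarrow> f x = g x"
  shows "measure_pmf.expectation p f = measure_pmf.expectation p g"
  using assms by (intro integral_cong_AE) (auto simp: AE_measure_pmf_iff)

lemma expectation_chain_Suc:
  assumes T: "w + n \<le> T n"
  shows "measure_pmf.expectation (chain T w (Suc n)) G
    = measure_pmf.expectation (chain T w n) (step_op (T n) G)"
proof -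
  have "measure_pmf.expectation (chain T w (Suc n)) G =
     measure_pmf.expectation (chain T w n) (\<lambda>i. measure_pmf.expectation
       (map_pmf (\<lambda>b. if b then Suc i else i) (bernoulli_pmf (real i / real (T n)))) G)"
    by (simp add: expectation_bind_finite del: integral_map_pmf)
  also have "\<dots> = measure_pmf.expectation (chain T w n) (step_op (T n) G)"
  proof (rule expectation_cong_on_support)
    fix i assume "i \<in> set_pmf (chain T w n)"
    with set_pmf_chain[of T w n] T have "i \<le> T n" by auto
    then have "0 \<le> real i / real (T n)" "real i / real (T n) \<le> 1"
      by (auto simp: divide_le_eq_1)
    then show "measure_pmf.expectation
       (map_pmf (\<lambda>b. if b then Suc i else i) (bernoulli_pmf (real i / real (T n)))) G
       = step_op (T n) G i"
      by (simp add: step_op_def algebra_simps add_divide_distrib diff_divide_distrib)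
  qed
  finally show ?thesis .
qed

text \<open>Rising factorials are eigenfunctions of every step:
  \<open>i * pochhammer (i + 1) k = (i + k) * pochhammer i k\<close>, so one draw multiplies the
  expectation by \<open>1 + k / T n\<close>.\<close>

lemma expectation_chain_pochhammer:
  assumes T: "\<And>n. w + n \<le> T n" and "\<And>n. 0 < T n"
  shows "measure_pmf.expectation (chain T w n) (\<lambda>i. pochhammer (real i) k)
    = pochhammer (real w) k * (\<Prod>i<n. 1 + real k / real (T i))"
proof (induction n)
  case (Suc n)
  have step: "step_op (T n) (\<lambda>i. pochhammer (real i) k) i = (1 + real k / T n) * pochhammer (real i) k" for i
  proof -
    have "real i * pochhammer (real (Suc i)) k = pochhammer (real i) k * (real i + real k)"
      by (metis pochhammer_rec pochhammer_rec' mult.commute of_nat_Suc add.commute)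
    then have "real i * (pochhammer (real (Suc i)) k - pochhammer (real i) k) = real k * pochhammer (real i) k"
      by (simp add: algebra_simps)
    then show ?thesis unfolding step_op_def by (simp add: algebra_simps add_divide_distrib)
  qed
  show ?case
    by (simp add: expectation_chain_Suc[OF T] Suc step[abs_def] del: chain.simps)
qed simp

section \<open>The discrete Stein operator and size biasing\<close>

definition stein_op :: "nat \<Rightarrow> (nat \<Rightarrow> real) \<Rightarrow> nat \<Rightarrow> real" where
  "stein_op w G i = real i * (G (Suc i) - G i) + real w * G i"

text \<open>With \<open>D G i = i * (G (i + 1) - G i)\<close> the two operators are
  \<open>D + w\<close> and \<open>1 + D / T\<close>; as polynomials in \<open>D\<close> they
  commute. This lets the Stein operator be carried back through all draws to the deterministic
  initial state.\<close>

lemma stein_op_step_op: "stein_op w (step_op T G) = step_op T (stein_op w G)"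
  by (rule ext) (simp add: stein_op_def step_op_def divide_simps algebra_simps)

text \<open>At the initial state \<open>w\<close> the operator collapses to
  \<open>w * G (w + 1)\<close>. Until the first immigration the total is \<open>w + 1 + i\<close>,
  so a count that starts at \<open>w + 1\<close> fills the whole urn and grows with probability one;
  hence the deterministic argument \<open>w + 1 + j\<close>.\<close>

lemma expectation_stein_initial:
  assumes T: "\<And>i. i < l \<Longrightarrow> T i = w + 1 + i" and "j \<le> l"
  shows "measure_pmf.expectation (chain T w j) (stein_op w G) = real w * G (w + 1 + j)"
  using \<open>j \<le> l\<close>
proof (induction j arbitrary: G)
  case (Suc j)
  then have Tj: "T j = w + 1 + j" using T by simp
  have "measure_pmf.expectation (chain T w (Suc j)) (stein_op w G)
    = measure_pmf.expectation (chain T w j) (stein_op w (step_op (T j) G))"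
    by (simp add: expectation_chain_Suc Tj stein_op_step_op del: chain.simps)
  also have "\<dots> = real w * step_op (T j) G (w + 1 + j)"
    using Suc by simp
  also have "step_op (T j) G (w + 1 + j) = G (w + 1 + Suc j)"
    by (simp add: step_op_def Tj del: of_nat_Suc of_nat_add)
  finally show ?case .
qed (simp add: stein_op_def algebra_simps)

text \<open>After the first period the count moved to \<open>w + 1\<close> has reached
  \<open>w + (l + 1)\<close>, while the totals have become \<open>T n + (l + 1)\<close>: from there
  on it is a chain of the same kind with start and totals raised by \<open>l + 1\<close>.\<close>

lemma expectation_stein_later:
  assumes T0: "\<And>i. i < l \<Longrightarrow> T i = w + 1 + i" and T: "\<And>n. w + 1 + n \<le> T n"
    and Tl: "\<And>i. T (i + l) = T i + (l + 1)"
  shows "measure_pmf.expectation (chain T w (n + l)) (stein_op w G)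
    = real w * measure_pmf.expectation (chain (\<lambda>i. T i + (l + 1)) (w + (l + 1)) n) G"
proof (induction n arbitrary: G)
  case 0
  then show ?case using expectation_stein_initial[OF T0 order_refl] by simp
next
  case (Suc n)
  have "w + (n + l) \<le> T (n + l)" using T[of "n + l"] by simp
  then have "measure_pmf.expectation (chain T w (Suc n + l)) (stein_op w G)
    = measure_pmf.expectation (chain T w (n + l)) (stein_op w (step_op (T (n + l)) G))"
    by (simp add: expectation_chain_Suc stein_op_step_op del: chain.simps)
  also have "\<dots> = real w * measure_pmf.expectation (chain (\<lambda>i. T i + (l + 1)) (w + (l + 1)) n)
      (step_op (T n + (l + 1)) G)"
    using Suc.IH Tl[of n] by simp
  also have "\<dots> = real w * measure_pmf.expectation (chain (\<lambda>i. T i + (l + 1)) (w + (l + 1)) (Suc n)) G"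
    using T[of n] by (subst expectation_chain_Suc) (auto simp: algebra_simps)
  finally show ?case .
qed

text \<open>A Doob transform: weighting by the eigenfunction \<open>pochhammer i b\<close> changes
  the success probability from \<open>i / T\<close> to \<open>(i + b) / (T + b)\<close>. The biased
  count plus \<open>b\<close> is therefore a chain with start and totals raised by \<open>b\<close>,
  and the product collects the eigenvalues.\<close>

lemma expectation_chain_size_bias:
  assumes T: "\<And>n. w + n \<le> T n" "\<And>n. 0 < T n"
  shows "measure_pmf.expectation (chain T w n) (\<lambda>i. pochhammer (real i) b * G (i + b))
   = pochhammer (real w) b * (\<Prod>i<n. real (T i + b) / real (T i)) *
     measure_pmf.expectation (chain (\<lambda>i. T i + b) (w + b) n) G"
proof (induction n arbitrary: G)
  case (Suc n)
  have step: "step_op (T n) (\<lambda>i. pochhammer (real i) b * G (i + b)) i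
     = (real (T n + b) / real (T n)) * (pochhammer (real i) b * step_op (T n + b) G (i + b))" for i
  proof -
    have *: "real i * pochhammer (real (Suc i)) b = pochhammer (real i) b * (real i + real b)"
      by (metis pochhammer_rec pochhammer_rec' mult.commute of_nat_Suc add.commute)
    have "real (T n) \<noteq> 0" "real (T n) + real b \<noteq> 0"
      using T(2)[of n] by linarith+
    have "step_op (T n) (\<lambda>i. pochhammer (real i) b * G (i + b)) i
      = pochhammer (real i) b * G (i + b) + (1 / T n) * ((real i * pochhammer (real (Suc i)) b) * G (Suc (i + b))
         - real i * pochhammer (real i) b * G (i + b))"
      by (simp add: step_op_def algebra_simps)
    also have "\<dots> = pochhammer (real i) b * (G (i + b) + (1 / T n) * ((real i + real b) * G (Suc (i + b))
         - real i * G (i + b)))"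
      unfolding * by (simp add: algebra_simps)
    also have "\<dots> = (real (T n + b) / real (T n)) * (pochhammer (real i) b * step_op (T n + b) G (i + b))"
      using \<open>real (T n) \<noteq> 0\<close> \<open>real (T n) + real b \<noteq> 0\<close>
      by (simp add: step_op_def divide_simps) (simp add: algebra_simps)
    finally show ?thesis .
  qed
  have "measure_pmf.expectation (chain T w (Suc n)) (\<lambda>i. pochhammer (real i) b * G (i + b))
    = (real (T n + b) / real (T n)) * measure_pmf.expectation (chain T w n)
       (\<lambda>i. pochhammer (real i) b * step_op (T n + b) G (i + b))"
    by (simp add: expectation_chain_Suc T step[abs_def] del: chain.simps of_nat_add)
  also have "\<dots> = pochhammer (real w) b * (\<Prod>i<Suc n. real (T i + b) / real (T i)) *
     measure_pmf.expectation (chain (\<lambda>i. T i + b) (w + b) n) (step_op (T n + b) G)"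
    unfolding Suc.IH by simp
  also have "measure_pmf.expectation (chain (\<lambda>i. T i + b) (w + b) n) (step_op (T n + b) G)
    = measure_pmf.expectation (chain (\<lambda>i. T i + b) (w + b) (Suc n)) G"
    using T(1)[of n] by (subst expectation_chain_Suc) auto
  finally show ?case .
qed simp

lemma prod_shift_telescope:
  fixes f :: "nat \<Rightarrow> real"
  assumes "\<And>i. f i \<noteq> 0"
  shows "(\<Prod>i<n. f (i + p) / f i) = (\<Prod>i<p. f (n + i)) / (\<Prod>i<p. f i)"
proof (induction n)
  case (Suc n)
  have "(\<Prod>i<p. f (n + i)) * f (n + p) = (\<Prod>i<Suc p. f (n + i))" by simp
  also have "\<dots> = f n * (\<Prod>i<p. f (Suc n + i))"
    by (subst prod.lessThan_Suc_shift) simp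
  finally show ?case using Suc assms[of n] by (simp add: field_simps)
qed (use assms in simp)

text \<open>The size-biased chain is the original one delayed by one immigration period; this
  gives a discrete counterpart of the Stein equation of the generalised gamma law.\<close>

lemma expectation_chain_stein:
  assumes T0: "\<And>i. i < l \<Longrightarrow> T i = w + 1 + i" and T: "\<And>n. w + 1 + n \<le> T n"
    and Tl: "\<And>i. T (i + l) = T i + (l + 1)" and w: "w > 0"
  shows "measure_pmf.expectation (chain T w (n + l)) (stein_op w G)
    = measure_pmf.expectation (chain T w n) (\<lambda>i. pochhammer (real i) (l + 1) * G (i + (l + 1)))
      / (\<Prod>i<l. real (T (n + i)))"
proof -
  have Tpos: "0 < T n" "w + n \<le> T n" for n using T[of n] by auto
  have Tne: "real (T n) \<noteq> 0" for n using Tpos(1)[of n] by simp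
  have "(\<Prod>i<n. real (T i + (l + 1)) / real (T i)) = (\<Prod>i<n. real (T (i + l)) / real (T i))"
    by (simp add: Tl)
  also have "\<dots> = (\<Prod>i<l. real (T (n + i))) / (\<Prod>i<l. real (T i))"
    by (rule prod_shift_telescope) (rule Tne)
  finally have bias: "(\<Prod>i<n. real (T i + (l + 1)) / real (T i)) = \<dots>" .
  \<comment> \<open>Apart from \<open>w\<close>, the factors \<open>w + 1, ..., w + l\<close> of the
    rising factorial are exactly the totals of the first period; they cancel the denominator left by
    the telescoped bias.\<close>
  have poch: "pochhammer (real w) (l + 1) = real w * (\<Prod>i<l. real (T i))"
  proof -
    have "pochhammer (real w) (l + 1) = real w * pochhammer (real w + 1) l"
      by (simp add: pochhammer_rec)
    also have "pochhammer (real w + 1) l = (\<Prod>i<l. real (T i))"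
      by (auto simp: pochhammer_prod T0 atLeast0LessThan intro!: prod.cong)
    finally show ?thesis .
  qed
  define A D where "A = (\<Prod>i<l. real (T i))" and "D = (\<Prod>i<l. real (T (n + i)))"
  have "A \<noteq> 0" "D \<noteq> 0" unfolding A_def D_def using Tne by simp_all
  moreover have "measure_pmf.expectation (chain T w (n + l)) (stein_op w G)
    = real w * measure_pmf.expectation (chain (\<lambda>i. T i + (l + 1)) (w + (l + 1)) n) G"
    by (rule expectation_stein_later) (use T0 T Tl in auto)
  ultimately show ?thesis
    unfolding expectation_chain_size_bias[OF Tpos(2,1)] bias poch
      A_def[symmetric] D_def[symmetric] by simp
qed

text \<open>The function \<open>1 / (i - 1)\<close> plays the part of a rising factorial of order
  -1: one draw multiplies it by \<open>1 - 1 / T\<close>. The start \<open>2 \<le> w\<close> keeps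
  it away from its pole.\<close>

lemma expectation_chain_inverse:
  assumes T: "\<And>n. w + n \<le> T n" and w: "2 \<le> w"
  shows "measure_pmf.expectation (chain T w n) (\<lambda>i. 1 / (real i - 1))
    = 1 / (real w - 1) * (\<Prod>i<n. 1 - 1 / real (T i))"
proof (induction n)
  case (Suc n)
  have "measure_pmf.expectation (chain T w (Suc n)) (\<lambda>i. 1 / (real i - 1))
     = measure_pmf.expectation (chain T w n) (\<lambda>i. (1 - 1 / T n) * (1 / (real i - 1)))"
    unfolding expectation_chain_Suc[OF T]
  proof (rule expectation_cong_on_support)
    fix i assume "i \<in> set_pmf (chain T w n)"
    with set_pmf_chain[of T w n] w have "i \<ge> 2" by auto
    moreover have "T n \<ge> 2" using T[of n] w by simp
    ultimately show "step_op (T n) (\<lambda>i. 1 / (real i - 1)) i = (1 - 1 / T n) * (1 / (real i - 1))"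
      by (simp add: step_op_def divide_simps)
  qed
  also have "\<dots> = (1 - 1 / T n) * (1 / (real w - 1) * (\<Prod>i<n. 1 - 1 / real (T i)))"
    unfolding Suc[symmetric] by (rule integral_mult_right_zero)
  finally show ?case by simp
qed simp

subsection \<open>Functions of bounded variation and the Kolmogorov distance\<close>

definition variation_le :: "(real \<Rightarrow> real) \<Rightarrow> real \<Rightarrow> bool" where
  "variation_le h V \<longleftrightarrow> (\<forall>t n. mono t \<longrightarrow> (\<Sum>i<n::nat. \<bar>h (t (Suc i)) - h (t i)\<bar>) \<le> V)"

lemma variation_leD: "variation_le h V \<Longrightarrow> mono t \<Longrightarrow> (\<Sum>i<n::nat. \<bar>h (t (Suc i)) - h (t i)\<bar>) \<le> V"
  by (auto simp: variation_le_def)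

text \<open>Jordan decomposition, with \<open>g x\<close> the total variation of \<open>h\<close> on
  the half-line up to \<open>x\<close>, written as a supremum over monotone sequences of points that
  do not exceed \<open>x\<close>.\<close>

lemma variation_le_mono_decomposition:
  assumes "variation_le h V"
  shows "\<exists>g. mono g \<and> mono (\<lambda>x. g x - h x) \<and> (\<forall>x. 0 \<le> g x \<and> g x \<le> V)"
proof -
  define S where "S x = {(\<Sum>i<n. \<bar>h (t (Suc i)) - h (t i)\<bar>) | t n. mono t \<and> t n \<le> x}" for x :: real
  define g where "g x = Sup (S x)" for x
  have zero: "0 \<in> S x" for x
    unfolding S_def by (rule CollectI, rule exI[of _ "\<lambda>_. x"], rule exI[of _ 0]) (auto simp: mono_def)
  have bdd: "bdd_above (S x)" for x
    using variation_leD[OF assms] by (auto simp: S_def bdd_above_def)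
  have S_mono: "S x \<subseteq> S y" if "x \<le> y" for x y
    using that unfolding S_def by (blast intro: order_trans)
  have g0: "0 \<le> g x" for x
    unfolding g_def by (rule cSup_upper[OF zero bdd])
  have gV: "g x \<le> V" for x
    unfolding g_def using zero variation_leD[OF assms] by (intro cSup_least) (auto simp: S_def)
  have mono: "mono g"
    unfolding g_def
  proof (rule monoI)
    fix x y :: real assume "x \<le> y"
    with zero[of x] S_mono show "Sup (S x) \<le> Sup (S y)"
      by (intro cSup_subset_mono bdd) auto
  qed
  have incr: "g x + \<bar>h y - h x\<bar> \<le> g y" if "x \<le> y" for x y
  proof -
    have "e \<le> g y - \<bar>h y - h x\<bar>" if "e \<in> S x" for e
    proof -
      from that obtain t n where t: "mono t" "t n \<le> x" "e = (\<Sum>i<n. \<bar>h (t (Suc i)) - h (t i)\<bar>)"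
        by (auto simp: S_def)
      \<comment> \<open>A competitor for \<open>x\<close> is prolonged by the points
        \<open>x\<close> and \<open>y\<close>; this is what makes \<open>g\<close> grow by at least
        \<open>\<bar>h y - h x\<bar>\<close>.\<close>
      define t' where "t' i = (if i \<le> n then t i else if i = Suc n then x else y)" for i
      have "t i \<le> x" if "i \<le> n" for i using monoD[OF t(1) that] t(2) by simp
      then have t': "mono t'"
        using \<open>x \<le> y\<close> t(1) unfolding mono_def t'_def
        by (auto simp: le_Suc_eq intro: order_trans)
      have "(\<Sum>i<Suc (Suc n). \<bar>h (t' (Suc i)) - h (t' i)\<bar>) \<in> S y"
        unfolding S_def by (rule CollectI, rule exI[of _ t'], rule exI[of _ "Suc (Suc n)"])
          (simp add: t' t'_def)
      moreover have "(\<Sum>i<n. \<bar>h (t' (Suc i)) - h (t' i)\<bar>) = e"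
        unfolding t(3) by (rule sum.cong) (auto simp: t'_def)
      ultimately have "e + \<bar>h x - h (t n)\<bar> + \<bar>h y - h x\<bar> \<in> S y"
        by (simp add: t'_def)
      then have "e + \<bar>h x - h (t n)\<bar> + \<bar>h y - h x\<bar> \<le> g y"
        unfolding g_def by (rule cSup_upper[OF _ bdd])
      then show ?thesis by linarith
    qed
    then have "g x \<le> g y - \<bar>h y - h x\<bar>"
      unfolding g_def[of x] using zero by (intro cSup_least) auto
    then show ?thesis by simp
  qed
  have "mono (\<lambda>x. g x - h x)"
  proof (rule monoI)
    fix x y :: real assume "x \<le> y"
    from incr[OF this] show "g x - h x \<le> g y - h y" by linarith
  qed
  then show ?thesis using g0 gV mono by blast
qed

text \<open>Sections of convex sets, and of their averages, get their measurability from here;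
  nothing is assumed about the set itself.\<close>

lemma variation_le_borel_measurable:
  assumes "variation_le h V"
  shows "h \<in> borel_measurable borel"
proof -
  obtain g where g: "mono g" "mono (\<lambda>x. g x - h x)" "\<And>x. 0 \<le> g x" "\<And>x. g x \<le> V"
    using variation_le_mono_decomposition[OF assms] by blast
  have "(\<lambda>x. g x - (g x - h x)) \<in> borel_measurable borel"
    by (intro borel_measurable_diff borel_measurable_mono g)
  then show ?thesis by simp
qed

lemma up_set_real_cases:
  fixes U :: "real set"
  assumes up: "\<And>x y. x \<in> U \<Longrightarrow> x \<le> y \<Longrightarrow> y \<in> U"
  obtains "U = {}" | "U = UNIV" | a where "U = {a..}" | a where "U = {a<..}"
proof (cases "U = {} \<or> U = UNIV")
  case False
  then obtain z where z: "z \<notin> U" by auto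
  have bdd: "bdd_below U"
    using up z by (intro bdd_belowI[of _ z]) (metis linear)
  have ge: "Inf U \<le> x" if "x \<in> U" for x using bdd that by (rule cInf_lower[rotated])
  have gt: "x \<in> U" if x: "Inf U < x" for x
  proof -
    from False x obtain y where "y \<in> U" "y < x" by (auto simp: cInf_less_iff[OF _ bdd])
    then show ?thesis using up by auto
  qed
  show ?thesis
  proof (cases "Inf U \<in> U")
    case True
    then have "U = {Inf U..}" using ge up by auto
    then show ?thesis using that by blast
  next
    case False
    then have "U = {Inf U<..}" using ge gt by (force simp: less_le)
    then show ?thesis using that by blast
  qed
qed (use that in blast)

section \<open>Integrals under two laws with close distribution functions\<close>

locale kolmogorov_close = M: prob_space M + N: prob_space N for M N :: "real measure" +
  fixes e :: real
  assumes sets_M [measurable_cong, simp]: "sets M = sets borel"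
    and sets_N [measurable_cong, simp]: "sets N = sets borel"
    and close: "\<bar>measure M {..x} - measure N {..x}\<bar> \<le> e"
begin

lemma space_MN [simp]: "space M = UNIV" "space N = UNIV"
  using sets_eq_imp_space_eq[OF sets_M] sets_eq_imp_space_eq[OF sets_N] by auto

lemma e_nonneg: "0 \<le> e"
  using close[of 0] by linarith

lemma measure_lessThan_lim:
  assumes "prob_space L" "sets L = sets borel"
  shows "(\<lambda>n. measure L {..x - 1 / real (Suc n)}) \<longlonglongrightarrow> measure L {..<x :: real}"
proof -
  interpret prob_space L by fact
  have "(\<Union>n. {..x - 1 / real (Suc n)}) = {..<x}"
  proof (intro equalityI subsetI)
    fix y assume "y \<in> {..<x}"
    then obtain n where "1 / real (Suc n) < x - y" using nat_approx_posE[of "x - y"] by auto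
    then show "y \<in> (\<Union>n. {..x - 1 / real (Suc n)})" by (auto intro!: exI[of _ n])
  next
    fix y assume "y \<in> (\<Union>n. {..x - 1 / real (Suc n)})"
    then obtain n where "y \<le> x - 1 / real (Suc n)" by auto
    moreover have "0 < 1 / real (Suc n)" by simp
    ultimately show "y \<in> {..<x}" unfolding lessThan_iff by linarith
  qed
  moreover have "(\<lambda>n. measure L {..x - 1 / real (Suc n)}) \<longlonglongrightarrow> measure L (\<Union>n. {..x - 1 / real (Suc n)})"
    by (intro finite_Lim_measure_incseq) (auto simp: assms(2) incseq_def frac_le intro: order_trans)
  ultimately show ?thesis by simp
qed

lemma close_lessThan: "\<bar>measure M {..<x} - measure N {..<x}\<bar> \<le> e"
proof (rule LIMSEQ_le_const2)
  show "(\<lambda>n. \<bar>measure M {..x - 1 / real (Suc n)} - measure N {..x - 1 / real (Suc n)}\<bar>)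
    \<longlonglongrightarrow> \<bar>measure M {..<x} - measure N {..<x}\<bar>"
    by (intro tendsto_intros measure_lessThan_lim M.prob_space_axioms N.prob_space_axioms) auto
qed (use close in auto)

text \<open>Superlevel sets of monotone functions are of this kind. A closed half-line is the
  complement of an open one, which is why the bound is first carried to left limits of the
  distribution functions.\<close>

lemma close_up_set:
  assumes "\<And>x y. x \<in> U \<Longrightarrow> x \<le> y \<Longrightarrow> y \<in> U"
  shows "\<bar>measure M U - measure N U\<bar> \<le> e" "U \<in> sets borel"
proof -
  have "\<bar>measure M U - measure N U\<bar> \<le> e \<and> U \<in> sets borel"
  proof -
    consider "U = {}" | "U = UNIV" | a where "U = {a..}" | a where "U = {a<..}"
      using up_set_real_cases[of U] assms by metis
    then show ?thesis
    proof cases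
      case 1 then show ?thesis using e_nonneg by simp
    next
      case 2 then show ?thesis using e_nonneg M.prob_space N.prob_space by simp
    next
      case (3 a)
      have "measure M {a..} = 1 - measure M {..<a}" "measure N {a..} = 1 - measure N {..<a}"
        using M.prob_compl[of "{..<a}"] N.prob_compl[of "{..<a}"] by (simp_all add: Compl_eq_Diff_UNIV[symmetric])
      then show ?thesis using close_lessThan[of a] 3 by simp
    next
      case (4 a)
      have "measure M {a<..} = 1 - measure M {..a}" "measure N {a<..} = 1 - measure N {..a}"
        using M.prob_compl[of "{..a}"] N.prob_compl[of "{..a}"] by (simp_all add: Compl_eq_Diff_UNIV[symmetric])
      then show ?thesis using close[of a] 4 by simp
    qed
  qed
  then show "\<bar>measure M U - measure N U\<bar> \<le> e" "U \<in> sets borel" by auto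
qed

text \<open>The sum counts the integers of \<open>{1..n}\<close> up to \<open>z\<close>, hence
  equals the floor of \<open>z\<close>. Applied to rescaled values of a monotone function it gives a
  finite layer-cake decomposition.\<close>

lemma staircase_bounds:
  fixes z :: real
  assumes "0 \<le> z" "z \<le> real n"
  shows "(\<Sum>i=1..n. if real i \<le> z then 1 else 0 :: real) \<le> z"
    "z \<le> (\<Sum>i=1..n. if real i \<le> z then 1 else 0 :: real) + 1"
proof -
  have "{i\<in>{1..n}. real i \<le> z} = {1..nat \<lfloor>z\<rfloor>}"
    using assms by (auto simp: le_nat_iff le_floor_iff nat_le_iff floor_le_iff intro: order_trans)
  moreover have "(\<Sum>i=1..n. if real i \<le> z then 1 else 0 :: real) = real (card {i\<in>{1..n}. real i \<le> z})"
    by (subst sum.If_cases) (auto simp: Int_def)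
  ultimately have *: "(\<Sum>i=1..n. if real i \<le> z then 1 else 0 :: real) = of_int \<lfloor>z\<rfloor>"
    using assms by simp
  show "(\<Sum>i=1..n. if real i \<le> z then 1 else 0 :: real) \<le> z"
    "z \<le> (\<Sum>i=1..n. if real i \<le> z then 1 else 0 :: real) + 1"
    unfolding * by linarith+
qed

text \<open>Layer cake: up to an error \<open>V / Suc n\<close> the function is a constant plus
  \<open>Suc n\<close> indicators of upper sets, each with weight \<open>V / Suc n\<close>. The
  indicators contribute at most \<open>e\<close> each, so the sum is at most \<open>V * e\<close>
  however fine the staircase is.\<close>

lemma integral_mono_close:
  assumes g: "mono g" and V: "V > 0" and bounds: "\<And>x. a \<le> g x" "\<And>x. g x \<le> a + V"
  shows "\<bar>(\<integral>x. g x \<partial>M) - (\<integral>x. g x \<partial>N)\<bar> \<le> V * e"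
proof -
  have [measurable]: "g \<in> borel_measurable borel" by (rule borel_measurable_mono[OF g])
  have norm_g: "norm (g x) \<le> \<bar>a\<bar> + V" for x using bounds[of x] by (auto simp: abs_if)
  have intM: "integrable M g" and intN: "integrable N g"
    by (auto intro!: M.integrable_const_bound[of _ "\<bar>a\<bar> + V"] N.integrable_const_bound[of _ "\<bar>a\<bar> + V"]
        simp: norm_g[simplified])
  have approx: "\<bar>(\<integral>x. g x \<partial>M) - (\<integral>x. g x \<partial>N)\<bar> \<le> V * e + V / real (Suc n)" for n
  proof -
    let ?n = "Suc n"
    define U where "U i = {x. a + V * real i / ?n \<le> g x}" for i :: nat
    define \<phi> where "\<phi> x = a + V / ?n * (\<Sum>i=1..?n. indicator (U i) x)" for x
    have U: "\<bar>measure M (U i) - measure N (U i)\<bar> \<le> e" "U i \<in> sets borel" for i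
      by (rule close_up_set; force simp: U_def dest: monoD[OF g])+
    note [measurable] = U(2)
    have phi: "\<phi> x \<le> g x" "g x \<le> \<phi> x + V / ?n" for x
    proof -
      define z where "z = (g x - a) * ?n / V"
      have z: "0 \<le> z" "z \<le> real ?n"
        using bounds[of x] V by (auto simp: z_def pos_divide_le_eq mult.commute simp del: of_nat_Suc)
      have "indicator (U i) x = (if real i \<le> z then 1 else 0 :: real)" for i
        using V by (auto simp: U_def z_def field_simps simp del: of_nat_Suc split: split_indicator)
      then have *: "\<phi> x = a + V / ?n * (\<Sum>i=1..?n. if real i \<le> z then 1 else 0)"
        unfolding \<phi>_def by simp
      have gx: "g x = a + V / ?n * z" using V by (simp add: z_def del: of_nat_Suc)
      have "V / ?n * (\<Sum>i=1..?n. if real i \<le> z then 1 else 0) \<le> V / ?n * z"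
        using staircase_bounds(1)[OF z] V by (intro mult_left_mono) auto
      then show "\<phi> x \<le> g x" unfolding * gx by simp
      have "V / ?n * z \<le> V / ?n * ((\<Sum>i=1..?n. if real i \<le> z then 1 else 0) + 1)"
        using staircase_bounds(2)[OF z] V by (intro mult_left_mono) auto
      then show "g x \<le> \<phi> x + V / ?n" unfolding * gx by (simp add: ring_distribs)
    qed
    have iM: "integrable M \<phi>" and iN: "integrable N \<phi>"
      unfolding \<phi>_def
      by (auto intro!: integrable_sum integrable_real_indicator simp: less_top[symmetric] U(2)
          M.emeasure_eq_measure N.emeasure_eq_measure)
    have ind: "integrable M (indicator (U i) :: real \<Rightarrow> real)" "integrable N (indicator (U i) :: real \<Rightarrow> real)" for i
      by (rule integrable_real_indicator;
          simp add: U(2) less_top[symmetric] M.emeasure_eq_measure N.emeasure_eq_measure)+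
    have IM: "(\<integral>x. \<phi> x \<partial>M) = a + V / ?n * (\<Sum>i=1..?n. measure M (U i))"
      unfolding \<phi>_def using M.prob_space
      by (simp add: ind integrable_sum Bochner_Integration.integral_sum del: sum.cl_ivl_Suc of_nat_Suc)
    have IN: "(\<integral>x. \<phi> x \<partial>N) = a + V / ?n * (\<Sum>i=1..?n. measure N (U i))"
      unfolding \<phi>_def using N.prob_space
      by (simp add: ind integrable_sum Bochner_Integration.integral_sum del: sum.cl_ivl_Suc of_nat_Suc)
    have "\<bar>(\<integral>x. \<phi> x \<partial>M) - (\<integral>x. \<phi> x \<partial>N)\<bar>
       = V / ?n * \<bar>\<Sum>i=1..?n. measure M (U i) - measure N (U i)\<bar>"
    proof -
      have *: "\<bar>a + c * p - (a + c * q)\<bar> = c * \<bar>p - q\<bar>" if "0 \<le> c" for c p q :: real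
        using that by (simp add: abs_mult right_diff_distrib[symmetric])
      show ?thesis unfolding IM IN sum_subtractf by (rule *) (use V in simp)
    qed
    also have "\<dots> \<le> V / ?n * (\<Sum>i=1..?n. e)"
      using V by (intro mult_left_mono order_trans[OF sum_abs] sum_mono U(1)) auto
    also have "\<dots> = V * e" by simp
    finally have "\<bar>(\<integral>x. \<phi> x \<partial>M) - (\<integral>x. \<phi> x \<partial>N)\<bar> \<le> V * e" .
    moreover have "(\<integral>x. \<phi> x \<partial>M) \<le> (\<integral>x. g x \<partial>M)" "(\<integral>x. \<phi> x \<partial>N) \<le> (\<integral>x. g x \<partial>N)"
      by (intro integral_mono iM iN intM intN phi)+
    moreover have "(\<integral>x. g x \<partial>M) \<le> (\<integral>x. \<phi> x + V / ?n \<partial>M)" "(\<integral>x. g x \<partial>N) \<le> (\<integral>x. \<phi> x + V / ?n \<partial>N)"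
      by (intro integral_mono Bochner_Integration.integrable_add iM iN intM intN phi; simp)+
    moreover have "(\<integral>x. \<phi> x + V / ?n \<partial>M) = (\<integral>x. \<phi> x \<partial>M) + V / ?n"
      "(\<integral>x. \<phi> x + V / ?n \<partial>N) = (\<integral>x. \<phi> x \<partial>N) + V / ?n"
      using iM iN M.prob_space N.prob_space by simp_all
    ultimately show ?thesis by linarith
  qed
  have "(\<lambda>n. V * e + V / real (Suc n)) \<longlonglongrightarrow> V * e + 0"
    by (intro tendsto_add tendsto_const) (rule LIMSEQ_Suc, rule lim_const_over_n)
  from LIMSEQ_le_const[OF this, of "\<bar>(\<integral>x. g x \<partial>M) - (\<integral>x. g x \<partial>N)\<bar>"] approx
  show ?thesis by auto
qed

lemma integral_variation_close:
  assumes h: "variation_le h V" "\<And>x. 0 \<le> h x" "\<And>x. h x \<le> 1" and V: "V > 0"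
  shows "\<bar>(\<integral>x. h x \<partial>M) - (\<integral>x. h x \<partial>N)\<bar> \<le> (2 * V + 1) * e"
proof -
  obtain g where g: "mono g" "mono (\<lambda>x. g x - h x)" "\<And>x. 0 \<le> g x" "\<And>x. g x \<le> V"
    using variation_le_mono_decomposition[OF h(1)] by blast
  have [measurable]: "g \<in> borel_measurable borel" "h \<in> borel_measurable borel"
    using borel_measurable_mono[OF g(1)] variation_le_borel_measurable[OF h(1)] .
  have "\<bar>(\<integral>x. g x \<partial>M) - (\<integral>x. g x \<partial>N)\<bar> \<le> V * e"
    using g V by (intro integral_mono_close[where a=0]) auto
  \<comment> \<open>The second Jordan component lies between -1 and \<open>V\<close>, a range of
    length \<open>V + 1\<close>; with the length \<open>V\<close> for the first component this gives
    the factor \<open>2 * V + 1\<close>.\<close>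
  moreover have "\<bar>(\<integral>x. g x - h x \<partial>M) - (\<integral>x. g x - h x \<partial>N)\<bar> \<le> (V + 1) * e"
  proof (rule integral_mono_close[where a="-1"])
    fix x show "- 1 \<le> g x - h x" "g x - h x \<le> - 1 + (V + 1)"
      using g(3,4)[of x] h(2,3)[of x] by linarith+
  qed (use g V in auto)
  moreover have "integrable M g" "integrable N g" "integrable M h" "integrable N h"
    using g(3,4) h(2,3)
    by (auto intro!: M.integrable_const_bound[where f=g and B=V] N.integrable_const_bound[where f=g and B=V]
        M.integrable_const_bound[where f=h and B=1] N.integrable_const_bound[where f=h and B=1])
  ultimately show ?thesis by (simp add: algebra_simps abs_le_iff)
qed

end

subsection \<open>Polya urns and the beta distribution\<close>

locale proportional_density =
  fixes f :: "real \<Rightarrow> real"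
  assumes integrable_f: "integrable lborel f" and f_nonneg: "\<And>x. 0 \<le> f x"
    and integral_f_pos: "0 < integral\<^sup>L lborel f"
begin

lemma sets_prop_density [simp]: "sets (prop_density f) = sets borel"
  by (simp add: prop_density_def)

lemma space_prop_density [simp]: "space (prop_density f) = UNIV"
  by (simp add: prop_density_def)

lemma emeasure_prop_density:
  assumes A: "A \<in> sets borel"
  shows "emeasure (prop_density f) A = ennreal ((\<integral>x. indicator A x * f x \<partial>lborel) / integral\<^sup>L lborel f)"
proof -
  have [measurable]: "f \<in> borel_measurable borel" using integrable_f by auto
  note A[measurable]
  have int: "integrable lborel (\<lambda>x. indicator A x * f x)"
    using integrable_real_mult_indicator[of A lborel f] integrable_f by (simp add: mult.commute)
  have "emeasure (prop_density f) A = (\<integral>\<^sup>+x. ennreal (f x / integral\<^sup>L lborel f) * indicator A x \<partial>lborel)"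
    unfolding prop_density_def by (subst emeasure_density) auto
  also have "\<dots> = (\<integral>\<^sup>+x. ennreal (indicator A x * f x / integral\<^sup>L lborel f) \<partial>lborel)"
    by (intro nn_integral_cong) (auto split: split_indicator)
  also have "\<dots> = ennreal (\<integral>x. indicator A x * f x / integral\<^sup>L lborel f \<partial>lborel)"
    using int f_nonneg integral_f_pos by (intro nn_integral_eq_integral) (auto intro!: AE_I2 divide_nonneg_pos)
  finally show ?thesis by simp
qed

lemma prob_space_prop_density: "prob_space (prop_density f)"
  by (rule prob_spaceI) (use integral_f_pos in \<open>simp add: emeasure_prop_density[of UNIV]\<close>)

sublocale prob_space "prop_density f"
  by (rule prob_space_prop_density)

lemma measure_prop_density:
  assumes "A \<in> sets borel"
  shows "measure (prop_density f) A = (\<integral>x. indicator A x * f x \<partial>lborel) / integral\<^sup>L lborel f"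
  using f_nonneg integral_f_pos
  by (simp add: measure_def emeasure_prop_density[OF assms] divide_nonneg_pos Bochner_Integration.integral_nonneg)

lemma null_sets_prop_density:
  assumes "A \<in> null_sets lborel"
  shows "A \<in> null_sets (prop_density f)"
proof -
  have [measurable]: "f \<in> borel_measurable borel" using integrable_f by auto
  have "AE x in lborel. x \<notin> A" using assms by (rule AE_not_in)
  then show ?thesis
    using assms unfolding prop_density_def by (subst null_sets_density_iff) (auto elim!: eventually_mono)
qed

end

definition beta_weight :: "nat \<Rightarrow> nat \<Rightarrow> real \<Rightarrow> real" where
  "beta_weight a b x = indicator {0<..<1} x * x ^ (a - 1) * (1 - x) ^ (b - 1)"

lemma Beta_dist_eq_weight:
  assumes "a \<ge> 1" "b \<ge> 1"
  shows "Beta_dist (real a) (real b) = prop_density (beta_weight a b)"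
proof -
  have "(indicator {0<..<1} x * x powr (real a - 1) * (1 - x) powr (real b - 1) :: real) = beta_weight a b x" for x
  proof (cases "0 < x \<and> x < 1")
    case True
    then show ?thesis
      using assms powr_realpow[of x "a - 1"] powr_realpow[of "1 - x" "b - 1"]
      by (simp add: beta_weight_def of_nat_diff)
  qed (auto simp: beta_weight_def)
  then show ?thesis by (simp add: Beta_dist_def)
qed

lemma beta_weight_bounds: "0 \<le> beta_weight a b x" "beta_weight a b x \<le> indicator {0..1} x"
  by (auto simp: beta_weight_def power_le_one mult_le_one split: split_indicator)

lemma integral_pos_of_pos_on:
  fixes f :: "real \<Rightarrow> real"
  assumes int: "integrable lborel f" and nonneg: "\<And>x. 0 \<le> f x"
    and pos: "\<And>x. x \<in> A \<Longrightarrow> 0 < f x" and A: "A \<in> sets borel" "emeasure lborel A \<noteq> 0"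
  shows "0 < integral\<^sup>L lborel f"
proof -
  have "integral\<^sup>L lborel f \<noteq> 0"
  proof
    assume "integral\<^sup>L lborel f = 0"
    then have "AE x in lborel. f x = 0"
      using integral_nonneg_eq_0_iff_AE[OF int] nonneg by simp
    then have "AE x in lborel. x \<notin> A" by (rule eventually_mono) (use pos in force)
    then have "A \<in> null_sets lborel" using A by (subst (asm) AE_iff_null_sets[symmetric]) auto
    then show False using A by auto
  qed
  moreover have "0 \<le> integral\<^sup>L lborel f" using nonneg by simp
  ultimately show ?thesis by simp
qed

lemma integrable_beta_weight: "integrable lborel (beta_weight a b)"
proof (rule Bochner_Integration.integrable_bound)
  show "integrable lborel (indicator {0..1} :: real \<Rightarrow> real)"
    by (rule integrable_real_indicator) auto
  show "AE x in lborel. norm (beta_weight a b x) \<le> norm (indicator {0..1} x :: real)"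
    using beta_weight_bounds[of a b] by auto
qed (auto simp: beta_weight_def[abs_def])

lemma proportional_density_beta: "proportional_density (beta_weight a b)"
proof
  show "0 < integral\<^sup>L lborel (beta_weight a b)"
  proof (rule integral_pos_of_pos_on[where A="{0<..<1}"])
    show "0 < beta_weight a b x" if "x \<in> {0<..<1}" for x
      using that by (simp add: beta_weight_def)
  qed (auto simp: integrable_beta_weight beta_weight_bounds)
qed (auto simp: integrable_beta_weight beta_weight_bounds)

section \<open>Point probabilities of the Polya urn\<close>

lemma binomial_absorb_real:
  "(real (Suc n) - real k) * real (Suc n choose k) = real (Suc n) * real (n choose k)"
proof (cases "k \<le> Suc n")
  case True
  then have "(Suc n - k) * (Suc n choose k) = Suc n * (n choose k)"
    using binomial_absorb_comp[of "Suc n" k] by simp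
  then show ?thesis using True by (metis of_nat_diff of_nat_mult)
qed (simp add: binomial_eq_0)

interpretation beta: proportional_density "beta_weight a b" for a b
  by (rule proportional_density_beta)

definition polya :: "nat \<Rightarrow> nat \<Rightarrow> nat \<Rightarrow> nat pmf" where
  "polya a b = chain (\<lambda>i. a + b + i) a"

lemma pmf_chain_Suc:
  assumes "w + n \<le> T n"
  shows "pmf (chain T w (Suc n)) (Suc i)
    = (1 - real (Suc i) / real (T n)) * pmf (chain T w n) (Suc i) + real i / real (T n) * pmf (chain T w n) i"
proof -
  have pmf_E: "pmf p x = measure_pmf.expectation p (indicator {x})" for p and x :: nat
    by (simp add: pmf.rep_eq)
  have eq: "step_op (real (T n)) (indicator {Suc i}) = (\<lambda>k. (1 - real (Suc i) / real (T n)) * indicator {Suc i} k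
      + real i / real (T n) * indicator {i} k)"
    by (rule ext) (auto simp: step_op_def simp del: of_nat_Suc split: split_indicator)
  show ?thesis
    unfolding pmf_E expectation_chain_Suc[of w n T, OF assms] eq
    by (subst Bochner_Integration.integral_add) (simp_all del: of_nat_Suc)
qed

text \<open>The beta-binomial law. Parameters and state are shifted by \<open>Suc\<close>, so that
  no truncated \<open>a - 1\<close> enters the binomial coefficients. In the induction both terms of
  the forward equation become, by absorption, multiples of one and the same product of
  binomials.\<close>

lemma pmf_polya:
  assumes "i \<le> a + b + t"
  shows "pmf (polya (Suc a) (Suc b) t) (Suc i)
    = real (i choose a) * real (a + b + t - i choose b) / real (a + b + t + 1 choose (a + b + 1))"
  using assms
proof (induction t arbitrary: i)
  case 0
  then show ?case
    by (cases i a rule: linorder_cases) (auto simp: polya_def binomial_eq_0 pmf_return)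
next
  case (Suc t)
  let ?p = "pmf (polya (Suc a) (Suc b) t)"
  define S where "S = a + b + t"
  define N where "N = real (S + 1 choose (a + b + 1))"
  define N' where "N' = real (S + 2 choose (a + b + 1))"
  have "0 < (S + 1 choose (a + b + 1))" "0 < (S + 2 choose (a + b + 1))"
    by (auto intro!: zero_less_binomial simp: S_def simp del: binomial_Suc_Suc)
  then have "N \<noteq> 0" "N' \<noteq> 0" unfolding N_def N'_def by (simp_all del: binomial_Suc_Suc)
  have NN: "(real t + 1) * N' = (real S + 2) * N"
    using binomial_absorb_real[of "S + 1" "a + b + 1"] unfolding N_def N'_def S_def
    by (simp add: algebra_simps del: binomial_Suc_Suc)
  have IH: "?p (Suc i) = real (i choose a) * real (S - i choose b) / N" if "i \<le> S" for i
    using Suc.IH[of i] that by (simp add: N_def S_def)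
  have "pmf (polya (Suc a) (Suc b) (Suc t)) (Suc i)
    = (1 - real (Suc i) / real (S + 2)) * ?p (Suc i) + real i / real (S + 2) * ?p i"
    unfolding polya_def by (subst pmf_chain_Suc) (auto simp: S_def)
  also have "\<dots> = ((real S + 1 - real i) * ?p (Suc i) + real i * ?p i) / (real S + 2)"
  proof -
    have "(1 - (1 + x) / (2 + s)) * p + x / (2 + s) * q = ((s + 1 - x) * p + x * q) / (s + 2)"
      if "s \<ge> 0" for x s p q :: real
    proof -
      have "1 - (1 + x) / (2 + s) = (s + 1 - x) / (s + 2)" using that by (simp add: field_simps)
      then show ?thesis by (simp add: add_divide_distrib add.commute)
    qed
    then show ?thesis by simp
  qed
  also have "(real S + 1 - real i) * ?p (Suc i) = (real S + 1 - real i - real b) * (real (i choose a) * real (S + 1 - i choose b) / N)"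
  proof (cases "i \<le> S")
    case True
    then have "(real S + 1 - real i - real b) * real (S + 1 - i choose b) = (real S + 1 - real i) * real (S - i choose b)"
      using binomial_absorb_real[of "S - i" b] by (simp add: Suc_diff_le of_nat_diff algebra_simps)
    then have "(real S + 1 - real i) * (real (i choose a) * real (S - i choose b) / N)
      = real (i choose a) * ((real S + 1 - real i - real b) * real (S + 1 - i choose b)) / N"
      by simp
    then show ?thesis unfolding IH[OF True] by (simp add: mult_ac)
  next
    case False
    \<comment> \<open>In the new extreme state both sides are zero: for \<open>b = 0\<close> the
      coefficient \<open>S + 1 - i - b\<close> vanishes, otherwise \<open>0 choose b\<close>
      does.\<close>
    then have "i = S + 1" using Suc.prems by (simp add: S_def)
    then show ?thesis by (cases "b = 0") (auto simp: binomial_eq_0)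
  qed
  also have "real i * ?p i = (real i - real a) * (real (i choose a) * real (S + 1 - i choose b) / N)"
  proof (cases i)
    case 0
    then show ?thesis by (cases "a = 0") (auto simp: binomial_eq_0)
  next
    case (Suc k)
    then have "k \<le> S" using Suc.prems by (simp add: S_def)
    have eq: "(real i - real a) * real (i choose a) = real i * real (k choose a)"
      using binomial_absorb_real[of k a] Suc by simp
    have "real i * ?p i = real i * real (k choose a) * real (S + 1 - i choose b) / N"
      using IH[OF \<open>k \<le> S\<close>] Suc by simp
    then show ?thesis unfolding eq[symmetric] by simp
  qed
  \<comment> \<open>The two coefficients add up to \<open>S + 1 - a - b = t + 1\<close>, and the
    quotient of \<open>t + 1\<close> and \<open>S + 2\<close> is what turns \<open>N\<close> into
    \<open>N'\<close>.\<close>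
  also have "((real S + 1 - real i - real b) * (real (i choose a) * real (S + 1 - i choose b) / N)
     + (real i - real a) * (real (i choose a) * real (S + 1 - i choose b) / N)) / (real S + 2)
     = (real (i choose a) * real (S + 1 - i choose b)) * ((real t + 1) / ((real S + 2) * N))"
    using \<open>N \<noteq> 0\<close> by (simp add: divide_simps S_def) (simp add: algebra_simps)
  also have "(real t + 1) / ((real S + 2) * N) = 1 / N'"
    using NN \<open>N \<noteq> 0\<close> \<open>N' \<noteq> 0\<close> by (simp add: divide_simps)
  finally show ?case by (simp add: N'_def S_def)
qed

section \<open>The Polya urn law as a Riemann sum of the beta density\<close>

lemma prod_diff_bound:
  fixes x y :: "nat \<Rightarrow> real"
  assumes "\<And>h. h < n \<Longrightarrow> \<bar>x h\<bar> \<le> 1" "\<And>h. h < n \<Longrightarrow> \<bar>y h\<bar> \<le> 1" "\<And>h. h < n \<Longrightarrow> \<bar>x h - y h\<bar> \<le> d"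
  shows "\<bar>(\<Prod>h<n. x h) - (\<Prod>h<n. y h)\<bar> \<le> real n * d"
proof -
  have "norm ((\<Prod>h<n. x h) - (\<Prod>h<n. y h)) \<le> (\<Sum>h<n. norm (x h - y h))"
    by (rule norm_prod_diff) (use assms in auto)
  also have "\<dots> \<le> (\<Sum>h<n. d)" by (rule sum_mono) (use assms in auto)
  finally show ?thesis by simp
qed

lemma binomial_fact_prod: "real (i choose a) = (\<Prod>h<a. real i - real h) / fact a"
  by (simp add: binomial_gbinomial gbinomial_prod_rev atLeast0LessThan)

text \<open>The unnormalised urn probability is a product of factors \<open>(i - h) / j\<close> and
  \<open>(S - i - h) / j\<close>, the weight a product of factors \<open>u\<close> and
  \<open>1 - u\<close>. On the cell, corresponding factors differ by at most \<open>a / j\<close>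
  and \<open>(b + 1) / j\<close>; the extra 1 comes from the urn total \<open>j\<close> exceeding
  \<open>S\<close> by two.\<close>

lemma beta_weight_on_cell:
  fixes a b t i :: nat
  defines "S \<equiv> a + b + t"
  defines "j \<equiv> real S + 2"
  assumes i: "i \<le> S" and u: "real i / j < u" "u \<le> real (Suc i) / j"
  shows "\<bar>(\<Prod>h<a. (real i - real h) / j) * (\<Prod>h<b. (real S - real i - real h) / j) - beta_weight (Suc a) (Suc b) u\<bar>
    \<le> (real a * real a + real b * (real b + 1)) / j"
proof -
  have j: "j > 0" by (simp add: j_def)
  have aS: "a \<le> S" "b \<le> S" by (simp_all add: S_def)
  have "0 \<le> real i / j" using j by simp
  then have u0: "0 < u" using u by linarith
  have "real (Suc i) / j < 1" using i by (simp add: j_def)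
  then have u1: "u < 1" using u by linarith
  have uj: "real i < u * j" "u * j \<le> real i + 1"
    using u j by (simp_all add: pos_divide_less_eq pos_le_divide_eq)
  have bw: "beta_weight (Suc a) (Suc b) u = (\<Prod>h<a. u) * (\<Prod>h<b. 1 - u)"
    using u0 u1 by (simp add: beta_weight_def)
  define P where "P = (\<Prod>h<a. (real i - real h) / j)"
  define Q where "Q = (\<Prod>h<b. (real S - real i - real h) / j)"
  have P1: "\<bar>(real i - real h) / j\<bar> \<le> 1" if "h < a" for h
    using that i aS j by (auto simp: abs_le_iff pos_divide_le_eq j_def)
  have Q1: "\<bar>(real S - real i - real h) / j\<bar> \<le> 1" if "h < b" for h
    using that i aS j by (auto simp: abs_le_iff pos_divide_le_eq j_def)
  have P: "\<bar>P - (\<Prod>h<a. u)\<bar> \<le> real a * (real a / j)"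
    unfolding P_def
  proof (rule prod_diff_bound)
    fix h assume h: "h < a"
    have "(real i - real h) / j - u = (real i - real h - u * j) / j" using j by (simp add: field_simps)
    also have "\<bar>\<dots>\<bar> \<le> real a / j" unfolding abs_divide using j uj h by (auto intro!: divide_right_mono)
    finally show "\<bar>(real i - real h) / j - u\<bar> \<le> real a / j" .
  qed (use P1 u0 u1 in auto)
  have Q: "\<bar>Q - (\<Prod>h<b. 1 - u)\<bar> \<le> real b * ((real b + 1) / j)"
    unfolding Q_def
  proof (rule prod_diff_bound)
    fix h assume h: "h < b"
    have "(real S - real i - real h) / j - (1 - u) = (real S - real i - real h - j + u * j) / j"
      using j by (simp add: field_simps)
    also have "\<bar>\<dots>\<bar> \<le> (real b + 1) / j"
      unfolding abs_divide using j uj h by (auto intro!: divide_right_mono simp: j_def)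
    finally show "\<bar>(real S - real i - real h) / j - (1 - u)\<bar> \<le> (real b + 1) / j" .
  qed (use Q1 u0 u1 in auto)
  have "\<bar>Q\<bar> \<le> 1" unfolding Q_def abs_prod using Q1 by (intro prod_le_1) auto
  have "\<bar>\<Prod>h<a. u\<bar> \<le> 1" unfolding abs_prod using u0 u1 by (intro prod_le_1) auto
  have "P * Q - (\<Prod>h<a. u) * (\<Prod>h<b. 1 - u) = (P - (\<Prod>h<a. u)) * Q + (\<Prod>h<a. u) * (Q - (\<Prod>h<b. 1 - u))"
    by (simp add: algebra_simps)
  also have "\<bar>\<dots>\<bar> \<le> \<bar>P - (\<Prod>h<a. u)\<bar> * \<bar>Q\<bar> + \<bar>\<Prod>h<a. u\<bar> * \<bar>Q - (\<Prod>h<b. 1 - u)\<bar>"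
    using abs_triangle_ineq by (simp only: abs_mult[symmetric])
  also have "\<dots> \<le> \<bar>P - (\<Prod>h<a. u)\<bar> * 1 + 1 * \<bar>Q - (\<Prod>h<b. 1 - u)\<bar>"
    by (intro add_mono mult_left_mono mult_right_mono) (use \<open>\<bar>Q\<bar> \<le> 1\<close> \<open>\<bar>\<Prod>h<a. u\<bar> \<le> 1\<close> in auto)
  also have "\<dots> \<le> real a * (real a / j) + real b * ((real b + 1) / j)" using P Q by simp
  also have "\<dots> = (real a * real a + real b * (real b + 1)) / j" using j by (simp add: field_simps)
  finally show ?thesis unfolding bw P_def Q_def .
qed

text \<open>The point probabilities are, up to a common factor, a Riemann sum of the beta weight
  with mesh \<open>1 / j\<close>. The factor is not estimated by asymptotics of binomials: both laws
  have mass one, and this fixes it through the full sum.\<close>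

lemma polya_beta_kolmogorov_Suc:
  "\<exists>C\<ge>0. \<forall>t y. \<bar>measure_pmf.prob (polya (Suc a) (Suc b) t) {i. real i \<le> y * (real (a + b + t) + 2)}
     - measure (prop_density (beta_weight (Suc a) (Suc b))) {..y}\<bar> \<le> C / (real (a + b + t) + 2)"
proof -
  let ?f = "beta_weight (Suc a) (Suc b)"
  define D where "D = real a * real a + real b * (real b + 1)"
  define I where "I y = (\<integral>x. indicator {..y} x * ?f x \<partial>lborel)" for y
  define I0 where "I0 = integral\<^sup>L lborel ?f"
  have I0: "I0 > 0" unfolding I0_def by (rule beta.integral_f_pos)
  have D: "D \<ge> 0" by (simp add: D_def)
  have int_ind: "integrable lborel (\<lambda>x. indicator A x * ?f x)" if "A \<in> sets borel" for A
    using integrable_real_mult_indicator[of A lborel ?f] integrable_beta_weight[of "Suc a" "Suc b"] that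
    by (simp add: mult.commute)
  have I_diff: "I y' - I y = (\<integral>x. indicator {y<..y'} x * ?f x \<partial>lborel)" if "y \<le> y'" for y y'
    unfolding I_def
    by (subst Bochner_Integration.integral_diff[symmetric])
       (use that in \<open>auto intro!: int_ind Bochner_Integration.integral_cong split: split_indicator\<close>)
  have I_lip: "0 \<le> I y' - I y" "I y' - I y \<le> y' - y" if "y \<le> y'" for y y'
  proof -
    show "0 \<le> I y' - I y" unfolding I_diff[OF that]
      by (intro Bochner_Integration.integral_nonneg) (simp add: beta_weight_bounds)
    have "I y' - I y \<le> (\<integral>x. indicator {y<..y'} x \<partial>lborel)"
      unfolding I_diff[OF that]
    proof (intro integral_mono int_ind)
      show "indicator {y<..y'} x * ?f x \<le> indicator {y<..y'} x" for x
        using beta_weight_bounds(2)[of "Suc a" "Suc b" x] by (auto split: split_indicator_asm split_indicator)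
    qed (use that in \<open>auto intro!: integrable_real_indicator\<close>)
    then show "I y' - I y \<le> y' - y" using that by simp
  qed
  have I_neg: "I y = 0" if "y \<le> 0" for y
  proof -
    have "indicator {..y} x * ?f x = 0" for x using that by (auto simp: beta_weight_def split: split_indicator)
    then show ?thesis unfolding I_def by (simp only: Bochner_Integration.integral_zero)
  qed
  have I_one: "I y = I0" if "1 \<le> y" for y
  proof -
    have "indicator {..y} x * ?f x = ?f x" for x using that by (auto simp: beta_weight_def split: split_indicator)
    then show ?thesis unfolding I_def I0_def by (simp only:)
  qed
  have meas: "measure (prop_density ?f) {..y} = I y / I0" for y
    unfolding I_def I0_def by (rule beta.measure_prop_density) simp
  have main: "\<bar>measure_pmf.prob (polya (Suc a) (Suc b) t) {i. real i \<le> y * (real (a + b + t) + 2)}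
     - I y / I0\<bar> \<le> (2 * D + 2) / I0 / (real (a + b + t) + 2)" for t y
  proof -
    define S where "S = a + b + t"
    define j where "j = real S + 2"
    let ?p = "polya (Suc a) (Suc b) t"
    define q where "q i = (\<Prod>h<a. (real i - real h) / j) * (\<Prod>h<b. (real S - real i - real h) / j)" for i
    define A where "A k = (\<Sum>i<k. q i / j)" for k
    have j: "j > 0" by (simp add: j_def)
    have cell: "\<bar>q i / j - (I (real (Suc i) / j) - I (real i / j))\<bar> \<le> D / j / j" if i: "i \<le> S" for i
    proof -
      have le: "real i / j \<le> real (Suc i) / j" using j by (simp add: divide_right_mono)
      let ?J = "{real i / j<..real (Suc i) / j}"
      have ind: "integrable lborel (indicator ?J :: real \<Rightarrow> real)"
        by (rule integrable_real_indicator) (use le in auto)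
      have len: "(\<integral>x. indicator ?J x * c \<partial>lborel) = c / j" for c :: real
      proof -
        have "(\<integral>x. indicator ?J x * c \<partial>lborel) = measure lborel ?J * c"
          using ind by (simp add: Bochner_Integration.integral_mult_left del: of_nat_Suc)
        also have "measure lborel ?J = 1 / j" using le by (simp add: add_divide_distrib)
        finally show ?thesis by simp
      qed
      have iJ: "integrable lborel (\<lambda>x. indicator ?J x * c :: real)" for c :: real
        by (rule integrable_mult_left[OF ind])
      have diff: "q i / j - (I (real (Suc i) / j) - I (real i / j)) = (\<integral>x. indicator ?J x * (q i - ?f x) \<partial>lborel)"
        unfolding I_diff[OF le] len[of "q i", symmetric] right_diff_distrib
        by (rule Bochner_Integration.integral_diff[symmetric]) (rule iJ, rule int_ind, simp)
      have iD: "integrable lborel (\<lambda>x. indicator ?J x * (q i - ?f x))"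
        unfolding right_diff_distrib by (intro iJ int_ind Bochner_Integration.integrable_diff) simp
      have "\<bar>\<integral>x. indicator ?J x * (q i - ?f x) \<partial>lborel\<bar> \<le> (\<integral>x. \<bar>indicator ?J x * (q i - ?f x)\<bar> \<partial>lborel)"
        by (rule integral_abs_bound)
      also have "\<dots> \<le> (\<integral>x. indicator ?J x * (D / j) \<partial>lborel)"
      proof (rule integral_mono)
        fix x
        show "\<bar>indicator ?J x * (q i - ?f x)\<bar> \<le> indicator ?J x * (D / j)"
          using beta_weight_on_cell[OF i[unfolded S_def], of x] unfolding q_def D_def j_def S_def
          by (auto split: split_indicator)
      qed (rule integrable_abs[OF iD], rule iJ)
      also have "\<dots> = D / j / j" by (rule len)
      finally show ?thesis unfolding diff .
    qed
    have A_close: "\<bar>A k - I (real k / j)\<bar> \<le> D / j" if k: "k \<le> S + 1" for k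
    proof -
      have "I (real k / j) = (\<Sum>i<k. I (real (Suc i) / j) - I (real i / j))"
        by (subst sum_lessThan_telescope) (simp add: I_neg)
      then have "\<bar>A k - I (real k / j)\<bar> = \<bar>\<Sum>i<k. q i / j - (I (real (Suc i) / j) - I (real i / j))\<bar>"
        by (simp add: A_def sum_subtractf)
      also have "\<dots> \<le> (\<Sum>i<k. D / j / j)"
        by (rule order_trans[OF sum_abs], rule sum_mono, rule cell) (use k in auto)
      also have "\<dots> = (real k / j) * (D / j)" by simp
      also have "\<dots> \<le> 1 * (D / j)" using k j D by (intro mult_right_mono) (auto simp: j_def)
      finally show ?thesis by simp
    qed
    \<comment> \<open>The factor common to all point probabilities; its size enters only through
      \<open>\<kappa> * A (S + 1) = 1\<close>.\<close>
    define \<kappa> where "\<kappa> = j * (j ^ a * j ^ b) / (fact a * fact b * real (a + b + t + 1 choose (a + b + 1)))"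
    have pmf_eq: "pmf ?p (Suc i) = \<kappa> * (q i / j)" if i: "i \<le> S" for i
    proof -
      have "real (a + b + t - i) = real S - real i" using i by (simp add: S_def of_nat_diff)
      moreover have "(\<Prod>h<a. (real i - real h)) = j ^ a * (\<Prod>h<a. (real i - real h) / j)"
        "(\<Prod>h<b. (real S - real i - real h)) = j ^ b * (\<Prod>h<b. (real S - real i - real h) / j)"
        using j by (simp_all add: prod_dividef)
      ultimately show ?thesis
        unfolding pmf_polya[OF i[unfolded S_def]] binomial_fact_prod[of i] binomial_fact_prod[of "a + b + t - i"] \<kappa>_def q_def
        using j by (simp add: mult_ac)
    qed
    have supp: "i \<in> set_pmf ?p \<Longrightarrow> Suc a \<le> i \<and> i \<le> S + 1" for i
      unfolding polya_def by (drule subsetD[OF set_pmf_chain]) (auto simp: S_def)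
    have p0: "pmf ?p 0 = 0" unfolding pmf_eq_0_set_pmf by (rule notI, drule supp, simp)
    have prob_le: "measure_pmf.prob ?p {..k} = \<kappa> * A k" if k: "k \<le> S + 1" for k
    proof -
      have "measure_pmf.prob ?p {..k} = (\<Sum>i<Suc k. pmf ?p i)"
        by (simp add: measure_measure_pmf_finite lessThan_Suc_atMost)
      also have "\<dots> = (\<Sum>i<k. pmf ?p (Suc i))" by (subst sum.lessThan_Suc_shift) (simp add: p0)
      also have "\<dots> = (\<Sum>i<k. \<kappa> * (q i / j))" using k by (intro sum.cong pmf_eq) auto
      finally show ?thesis by (simp add: A_def sum_distrib_left)
    qed
    have full: "measure_pmf.prob ?p B = 1" if "{..S+1} \<subseteq> B" for B
    proof (subst measure_pmf.prob_eq_1)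
      show "AE i in measure_pmf ?p. i \<in> B"
        unfolding AE_measure_pmf_iff using that supp by blast
    qed simp
    have \<kappa>A: "\<kappa> * A (S + 1) = 1" using prob_le[of "S + 1"] full[of "{..S+1}"] by simp
    \<comment> \<open>The cells end at \<open>(S + 1) / j\<close>, one mesh width short of 1; the
      missing piece has weight at most \<open>1 / j\<close>.\<close>
    have IS: "\<bar>I (real (S + 1) / j) - I0\<bar> \<le> 1 / j"
    proof -
      have "real (S + 1) / j \<le> 1" using j by (simp add: j_def)
      from I_lip[OF this] I_one[of 1] have "0 \<le> I0 - I (real (S + 1) / j)" "I0 - I (real (S + 1) / j) \<le> 1 - real (S + 1) / j"
        by simp_all
      moreover have "1 - real (S + 1) / j = 1 / j" using j by (simp add: field_simps) (simp add: j_def)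
      ultimately show ?thesis by linarith
    qed
    have A_I0: "\<bar>A (S + 1) - I0\<bar> \<le> (D + 1) / j"
      using A_close[of "S + 1"] IS by (simp add: add_divide_distrib)
    have core: "\<bar>\<kappa> * A k - I y / I0\<bar> \<le> (2 * D + 2) / I0 / j"
      if k: "k \<le> S + 1" and y: "\<bar>I (real k / j) - I y\<bar> \<le> 1 / j" for k
    proof -
      have "0 \<le> \<kappa> * A k" "\<kappa> * A k \<le> 1" using prob_le[OF k] measure_pmf.prob_le_1[of ?p "{..k}"]
          measure_nonneg[of "measure_pmf ?p" "{..k}"] by linarith+
      have "\<bar>A k - I y\<bar> \<le> (D + 1) / j" using A_close[OF k] y by (simp add: add_divide_distrib)
      \<comment> \<open>Using \<open>\<kappa> * A (S + 1) = 1\<close>, the difference of normalised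
        quantities is expressed by differences of unnormalised ones, with a prefactor
        \<open>\<kappa> * A k\<close> that is a probability.\<close>
      have "\<kappa> * A k - I y / I0 = ((\<kappa> * A k) * (I0 - A (S + 1)) + (A k - I y)) / I0"
        using I0 \<kappa>A by (simp add: field_simps)
      also have "\<bar>\<dots>\<bar> \<le> ((D + 1) / j + (D + 1) / j) / I0"
      proof -
        have "\<bar>(\<kappa> * A k) * (I0 - A (S + 1))\<bar> \<le> 1 * ((D + 1) / j)"
          unfolding abs_mult using A_I0 \<open>0 \<le> \<kappa> * A k\<close> \<open>\<kappa> * A k \<le> 1\<close>
          by (intro mult_mono) auto
        with \<open>\<bar>A k - I y\<bar> \<le> (D + 1) / j\<close>
        have "\<bar>(\<kappa> * A k) * (I0 - A (S + 1)) + (A k - I y)\<bar> \<le> (D + 1) / j + (D + 1) / j"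
          by linarith
        then have "\<bar>(\<kappa> * A k) * (I0 - A (S + 1)) + (A k - I y)\<bar> / I0 \<le> ((D + 1) / j + (D + 1) / j) / I0"
          by (rule divide_right_mono) (use I0 in simp)
        then show ?thesis unfolding abs_divide using I0 by (simp only: abs_of_pos)
      qed
      also have "\<dots> = (2 * D + 2) / I0 / j" by (simp add: add_divide_distrib[symmetric] mult.commute)
      finally show ?thesis .
    qed
    have "\<bar>measure_pmf.prob ?p {i. real i \<le> y * j} - I y / I0\<bar> \<le> (2 * D + 2) / I0 / j"
    proof (cases "y < 0")
      case True
      have "y * j < 0" using True j by (simp add: mult_neg_pos)
      have "\<not> real i \<le> y * j" for i
        using \<open>y * j < 0\<close> of_nat_0_le_iff[of i, where 'a=real] by linarith
      then have "{i. real i \<le> y * j} = {}" by simp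
      then show ?thesis using I_neg[of y] True D I0 j by simp
    next
      case y0: False
      then have yj: "0 \<le> y * j" using j by simp
      define k where "k = nat \<lfloor>y * j\<rfloor>"
      have k_iff: "real i \<le> y * j \<longleftrightarrow> i \<le> k" for i
        using yj by (simp add: k_def le_nat_iff le_floor_iff)
      have rk: "real k = of_int \<lfloor>y * j\<rfloor>" using yj by (simp add: k_def)
      have k: "real k \<le> y * j" "y * j < real k + 1" unfolding rk by linarith+
      have set_eq: "{i. real i \<le> y * j} = {..k}" using k_iff by auto
      show ?thesis
      proof (cases "k \<le> S + 1")
        case True
        have "real k / j \<le> y" "y \<le> (real k + 1) / j" using k j by (simp_all add: field_simps)
        then have "\<bar>I (real k / j) - I y\<bar> \<le> 1 / j"
          using I_lip[of "real k / j" y] by (simp add: add_divide_distrib)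
        then show ?thesis unfolding set_eq prob_le[OF True] by (intro core True)
      next
        case False
        then have "j \<le> real k" by (simp add: j_def)
        then have "1 \<le> y" using k j by (metis mult.left_neutral mult_le_cancel_right_pos order_trans)
        then have "\<bar>\<kappa> * A (S + 1) - I y / I0\<bar> \<le> (2 * D + 2) / I0 / j"
          using IS by (intro core) (auto simp: I_one)
        moreover have "measure_pmf.prob ?p {i. real i \<le> y * j} = 1"
          unfolding set_eq using False by (intro full) auto
        ultimately show ?thesis unfolding \<kappa>A by simp
      qed
    qed
    then show ?thesis by (simp add: j_def S_def)
  qed
  show ?thesis
    unfolding meas using main D I0 by (intro exI[of _ "(2 * D + 2) / I0"]) auto
qed

subsection \<open>The Stein equation of the generalised gamma distribution\<close>

definition gga_weight :: "nat \<Rightarrow> nat \<Rightarrow> real \<Rightarrow> real" where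
  "gga_weight w b x = indicator {0<..} x * x ^ (w - 1) * exp (- (x ^ b))"

lemma GGa_dist_eq_weight:
  assumes "w \<ge> 1"
  shows "GGa_dist (real w) (real b) = prop_density (gga_weight w b)"
proof -
  have "(indicator {0<..} x * x powr (real w - 1) * exp (- (x powr real b)) :: real) = gga_weight w b x" for x
  proof (cases "0 < x")
    case True
    then show ?thesis
      using assms powr_realpow[of x "w - 1"] powr_realpow[of x b]
      by (simp add: gga_weight_def of_nat_diff)
  qed (auto simp: gga_weight_def)
  then show ?thesis by (simp add: GGa_dist_def)
qed

lemma gga_weight_nonneg: "0 \<le> gga_weight w b x"
  by (auto simp: gga_weight_def split: split_indicator)

lemma gga_weight_measurable [measurable]: "gga_weight w b \<in> borel_measurable borel"
  unfolding gga_weight_def[abs_def] by measurable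

text \<open>From \<open>x \<le> 1 + x ^ b\<close> the weight is dominated by \<open>exp 1\<close>
  times the integrand of the Gamma function.\<close>

lemma integrable_gga_weight:
  assumes "w \<ge> 1" "b \<ge> 1"
  shows "integrable lborel (gga_weight w b)"
proof (rule Bochner_Integration.integrable_bound)
  let ?g = "\<lambda>t::real. indicator {0..} t * t powr (real w - 1) / exp t"
  have "integrable lborel ?g"
  proof (rule integrableI_nonneg)
    have "(\<integral>\<^sup>+t. ennreal (?g t) \<partial>lborel) = ennreal (Gamma (real w))"
      using Gamma_conv_nn_integral_real[of "real w"] assms by simp
    then show "(\<integral>\<^sup>+t. ennreal (?g t) \<partial>lborel) < \<infinity>" by simp
  qed (auto simp: indicator_def)
  then show "integrable lborel (\<lambda>t. exp 1 * ?g t)" by (rule integrable_mult_right)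
  show "AE x in lborel. norm (gga_weight w b x) \<le> norm (exp 1 * ?g x)"
  proof (rule AE_I2)
    fix x :: real
    show "norm (gga_weight w b x) \<le> norm (exp 1 * ?g x)"
    proof (cases "x > 0")
      case True
      have "x \<le> 1 + x ^ b"
      proof (cases "x \<ge> 1")
        case True
        then show ?thesis using self_le_power[of x b] assms by simp
      qed (use True in \<open>simp add: add_increasing2\<close>)
      then have "exp (- (x ^ b)) \<le> exp (1 - x)" by simp
      then have "x ^ (w - 1) * exp (- (x ^ b)) \<le> x ^ (w - 1) * exp (1 - x)"
        using True by (intro mult_left_mono) auto
      moreover have "x powr (real w - 1) = x ^ (w - 1)"
        using powr_realpow[of x "w - 1"] True assms by (simp add: of_nat_diff)
      ultimately show ?thesis using True
        by (simp add: gga_weight_def exp_diff abs_mult mult_ac)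
    qed (simp add: gga_weight_def)
  qed
qed simp

lemma proportional_density_gga:
  assumes "w \<ge> 1" "b \<ge> 1"
  shows "proportional_density (gga_weight w b)"
proof
  show "0 < integral\<^sup>L lborel (gga_weight w b)"
  proof (rule integral_pos_of_pos_on[where A="{0<..}"])
    show "0 < gga_weight w b x" if "x \<in> {0<..}" for x
      using that by (simp add: gga_weight_def)
    have "(1 :: ennreal) = emeasure lborel {0<..<1::real}" by simp
    also have "\<dots> \<le> emeasure lborel {0::real<..}" by (rule emeasure_mono) auto
    finally show "emeasure lborel {0::real<..} \<noteq> 0" by (metis not_one_le_zero)
  qed (use assms in \<open>auto simp: integrable_gga_weight gga_weight_nonneg\<close>)
qed (use assms in \<open>auto simp: integrable_gga_weight gga_weight_nonneg\<close>)

locale gga =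
  fixes w b :: nat
  assumes w1: "w \<ge> 1" and b1: "b \<ge> 1"
begin

sublocale proportional_density "gga_weight w b"
  by (rule proportional_density_gga[OF w1 b1])

definition F :: "real \<Rightarrow> real" where "F x = x ^ (w - 1) * exp (- (x ^ b))"
definition lower :: "real \<Rightarrow> real" where "lower x = (\<integral>y. indicator {..x} y * gga_weight w b y \<partial>lborel)"
definition total :: real where "total = integral\<^sup>L lborel (gga_weight w b)"
definition upper :: "real \<Rightarrow> real" where "upper x = total - lower x"

lemma cdf: "measure (prop_density (gga_weight w b)) {..x} = lower x / total"
  unfolding lower_def total_def by (rule measure_prop_density) simp

lemma total_pos: "total > 0" unfolding total_def by (rule integral_f_pos)

lemma int_ind: "A \<in> sets borel \<Longrightarrow> integrable lborel (\<lambda>x. indicator A x * gga_weight w b x)"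
  using integrable_real_mult_indicator[of A lborel "gga_weight w b"] integrable_f
  by (simp add: mult.commute)

lemma lower_nonneg: "0 \<le> lower x"
  unfolding lower_def by (intro Bochner_Integration.integral_nonneg) (simp add: gga_weight_nonneg)

lemma upper_nonneg: "0 \<le> upper x"
proof -
  have "lower x \<le> total" unfolding lower_def total_def
    by (intro integral_mono int_ind integrable_f) (auto simp: gga_weight_nonneg split: split_indicator)
  then show ?thesis by (simp add: upper_def)
qed

lemma lower_le_total: "lower x \<le> total" using upper_nonneg[of x] by (simp add: upper_def)
lemma upper_le_total: "upper x \<le> total" using lower_nonneg[of x] by (simp add: upper_def)

lemma lower_mono: "x \<le> y \<Longrightarrow> lower x \<le> lower y"
  unfolding lower_def
  by (intro integral_mono int_ind) (auto simp: gga_weight_nonneg split: split_indicator)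

lemma upper_antimono: "x \<le> y \<Longrightarrow> upper y \<le> upper x"
  using lower_mono[of x y] by (simp add: upper_def)

lemma lower_nonpos: assumes "x \<le> 0" shows "lower x = 0"
proof -
  have "indicator {..x} y * gga_weight w b y = 0" for y
    using assms by (auto simp: gga_weight_def split: split_indicator)
  then show ?thesis unfolding lower_def by (simp only: Bochner_Integration.integral_zero)
qed

section \<open>Derivatives and size of the two incomplete integrals\<close>

lemma lower_eq_integral:
  assumes "x \<ge> 0"
  shows "lower x = integral {0..x} F"
proof -
  have cont: "continuous_on {0..x} F" unfolding F_def by (intro continuous_intros)
  have "lower x = (\<integral>y. indicator {0..x} y *\<^sub>R F y \<partial>lborel)"
    unfolding lower_def
  proof (rule integral_cong_AE)
    \<comment> \<open>The integrands may differ at 0, since for \<open>w = 1\<close> the function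
      \<open>F\<close> takes the value 1 there while the weight is 0.\<close>
    have "AE y in lborel. y \<noteq> (0::real)" by (rule AE_lborel_singleton)
    then show "AE y in lborel. indicator {..x} y * gga_weight w b y = indicator {0..x} y *\<^sub>R F y"
      by eventually_elim (auto simp: gga_weight_def F_def split: split_indicator)
  qed (auto simp: F_def[abs_def])
  also have "\<dots> = integral {0..x} F"
    using borel_integrable_atLeastAtMost'[OF cont]
    by (subst set_borel_integral_eq_integral(2)[symmetric]) (auto simp: set_lebesgue_integral_def)
  finally show ?thesis .
qed

lemma lower_deriv: assumes "x > 0" shows "(lower has_real_derivative F x) (at x)"
proof -
  have cont: "continuous_on {0..x+1} F" unfolding F_def by (intro continuous_intros)
  have "((\<lambda>y. integral {0..y} F) has_real_derivative F x) (at x within {0..x+1})"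
    using integral_has_real_derivative[OF cont, of x] assms by simp
  then have "((\<lambda>y. integral {0..y} F) has_real_derivative F x) (at x within {0<..<x+1})"
    by (rule DERIV_subset) auto
  then have "((\<lambda>y. integral {0..y} F) has_real_derivative F x) (at x)"
    using assms by (subst (asm) at_within_open) auto
  then show ?thesis
  proof (rule has_field_derivative_transform_within_open[where S="{0<..}"])
    show "integral {0..y} F = lower y" if "y \<in> {0<..}" for y
      using that lower_eq_integral[of y] by simp
  qed (use assms in auto)
qed

lemma upper_deriv: "x > 0 \<Longrightarrow> (upper has_real_derivative - F x) (at x)"
  unfolding upper_def[abs_def] by (auto intro!: derivative_eq_intros lower_deriv)

text \<open>The exponential is bounded by 1. The exponent \<open>w\<close> is what cancels the
  singularity \<open>1 / x ^ w\<close> that the homogeneous solution of the Stein equation has at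
  the origin.\<close>

lemma lower_le_power: assumes "x > 0" shows "lower x \<le> x ^ w"
proof -
  have "lower x \<le> (\<integral>y. indicator {0..x} y * x ^ (w - 1) \<partial>lborel)"
    unfolding lower_def
  proof (intro integral_mono int_ind)
    fix y :: real
    have "y ^ (w - 1) * exp (- (y ^ b)) \<le> x ^ (w - 1) * 1" if "0 < y" "y \<le> x"
      using that by (intro mult_mono power_mono) auto
    then show "indicator {..x} y * gga_weight w b y \<le> indicator {0..x} y * x ^ (w - 1)"
      by (auto simp: gga_weight_def split: split_indicator)
  qed (use assms in \<open>auto intro!: integrable_mult_left integrable_real_indicator\<close>)
  also have "\<dots> = x * x ^ (w - 1)" using assms by simp
  also have "\<dots> = x ^ w" using w1 by (metis Suc_pred' less_eq_Suc_le power_Suc One_nat_def)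
  finally show ?thesis .
qed

text \<open>The difference \<open>D\<close> of right and left side has derivative
  \<open>y ^ (w - 1) * exp (- (y ^ b)) * (w + 1 - b * y ^ b)\<close>, which is nonpositive from
  \<open>w + 1\<close> on, and \<open>D\<close> tends to 0 at infinity; so \<open>D\<close> is
  nonnegative there.\<close>

lemma upper_le_tail:
  assumes x: "x \<ge> real w + 1"
  shows "upper x \<le> x ^ w * exp (- (x ^ b))"
proof -
  define D where "D y = y ^ w * exp (- (y ^ b)) - upper y" for y
  have D_deriv: "\<exists>d. (D has_real_derivative d) (at y) \<and> d \<le> 0" if y: "y \<ge> real w + 1" for y
  proof -
    have y0: "y > 0" "y \<ge> 1" using y by linarith+
    have yb: "real b * y ^ b \<ge> real w + 1"
    proof -
      have "real w + 1 \<le> y" by fact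
      also have "\<dots> \<le> y ^ b" using self_le_power[of y b] y0 b1 by simp
      also have "\<dots> \<le> real b * y ^ b" using b1 y0 by (simp add: mult_le_cancel_right1)
      finally show ?thesis .
    qed
    let ?d = "(real w * y ^ (w - 1)) * exp (- (y ^ b)) + y ^ w * (exp (- (y ^ b)) * - (real b * y ^ (b - 1))) - - F y"
    have "(D has_real_derivative ?d) (at y)"
      unfolding D_def[abs_def] using y0
      by (auto intro!: derivative_eq_intros upper_deriv)
    moreover have "?d = y ^ (w - 1) * exp (- (y ^ b)) * (real w - real b * y ^ b + 1)"
    proof -
      have "y ^ w * y ^ (b - 1) = y ^ (w - 1) * y ^ b"
        using w1 b1 by (simp add: power_add[symmetric])
      then have "y ^ w * (exp (- (y ^ b)) * - (real b * y ^ (b - 1))) = - (exp (- (y ^ b)) * real b * (y ^ (w - 1) * y ^ b))"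
        by (metis (no_types, opaque_lifting) mult.assoc mult.commute mult_minus_right)
      then show ?thesis by (simp add: F_def ring_distribs mult_ac)
    qed
    moreover have "\<dots> \<le> 0" using yb y0 by (intro mult_nonneg_nonpos) auto
    ultimately show ?thesis by auto
  qed
  have dec: "D y \<le> D x" if "x \<le> y" for y
    using that by (rule DERIV_nonpos_imp_nonincreasing) (use x D_deriv in auto)
  have upper_lim: "(upper \<longlongrightarrow> 0) at_top"
  proof -
    have "((\<lambda>y. \<integral>z. indicator {..y} z *\<^sub>R gga_weight w b z \<partial>lborel) \<longlongrightarrow> total) at_top"
      unfolding total_def by (rule tendsto_integral_at_top) (auto simp: integrable_f)
    then have "((\<lambda>y. total - lower y) \<longlongrightarrow> total - total) at_top"
      unfolding lower_def by (intro tendsto_intros) simp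
    then show ?thesis by (simp add: upper_def[abs_def])
  qed
  have pow_lim: "((\<lambda>y::real. y ^ w * exp (- (y ^ b))) \<longlongrightarrow> 0) at_top"
  proof (rule tendsto_sandwich[OF _ _ tendsto_const])
    show "((\<lambda>y::real. y ^ w / exp y) \<longlongrightarrow> 0) at_top" by (rule tendsto_power_div_exp_0)
    show "\<forall>\<^sub>F y::real in at_top. 0 \<le> y ^ w * exp (- (y ^ b))"
      using eventually_ge_at_top[of 0] by eventually_elim simp
    show "\<forall>\<^sub>F y::real in at_top. y ^ w * exp (- (y ^ b)) \<le> y ^ w / exp y"
      using eventually_ge_at_top[of 1]
    proof eventually_elim
      fix y :: real assume y: "1 \<le> y"
      then have "y \<le> y ^ b" using self_le_power[of y b] b1 by simp
      then have "exp (- (y ^ b)) \<le> exp (- y)" by simp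
      then show "y ^ w * exp (- (y ^ b)) \<le> y ^ w / exp y"
        using y by (simp add: exp_minus divide_inverse mult_left_mono)
    qed
  qed
  have "(D \<longlongrightarrow> 0 - 0) at_top"
    unfolding D_def[abs_def] by (intro tendsto_diff pow_lim upper_lim)
  moreover have "\<forall>\<^sub>F y in at_top. D y \<le> D x"
    using eventually_ge_at_top[of x] by eventually_elim (rule dec)
  ultimately have "0 - 0 \<le> D x" by (rule tendsto_upperbound) simp
  then show ?thesis by (simp add: D_def)
qed

text \<open>Beyond \<open>w + 1\<close> this is the tail estimate; on the remaining bounded interval
  the exponential is at most \<open>exp ((w + 1) ^ b)\<close>, which goes into the constant.\<close>

lemma upper_exp_bound: "\<exists>C\<ge>0. \<forall>x>0. exp (x ^ b) * upper x \<le> C * (2 + x) ^ w"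
proof -
  define C where "C = 1 + exp ((real w + 1) ^ b) * total"
  have C: "C \<ge> 1" using total_pos by (simp add: C_def)
  have "exp (x ^ b) * upper x \<le> C * (2 + x) ^ w" if x: "x > 0" for x
  proof (cases "x \<ge> real w + 1")
    case True
    have "exp (x ^ b) * upper x \<le> exp (x ^ b) * (x ^ w * exp (- (x ^ b)))"
      by (intro mult_left_mono upper_le_tail True) simp
    also have "\<dots> = x ^ w" by (simp add: exp_minus)
    also have "\<dots> \<le> (2 + x) ^ w" using x by (intro power_mono) auto
    also have "\<dots> \<le> C * (2 + x) ^ w" using C x by (simp add: mult_le_cancel_right1)
    finally show ?thesis .
  next
    case False
    have "exp (x ^ b) * upper x \<le> exp ((real w + 1) ^ b) * total"
      using False x upper_le_total[of x] upper_nonneg[of x] by (intro mult_mono) (auto intro!: power_mono)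
    also have "\<dots> \<le> C * 1" by (simp add: C_def)
    also have "\<dots> \<le> C * (2 + x) ^ w" using C x by (intro mult_left_mono one_le_power) auto
    finally show ?thesis .
  qed
  then show ?thesis using C by (intro exI[of _ C]) auto
qed

text \<open>All smoothness is extracted from the differential equation: with
  \<open>k z = \<eta> - (w - b * z ^ b) * u z\<close> one has \<open>u' = k / z\<close>, and
  differentiating once more expresses \<open>u''\<close> by \<open>u\<close> alone. A polynomial
  bound for \<open>u\<close> thus yields polynomial bounds for both derivatives; the mean value
  theorem, used once and twice, gives the two claims.\<close>

lemma stein_piece_bounds:
  fixes u :: "real \<Rightarrow> real"
  assumes x: "x > 0" and c: "0 < c" "c \<le> 1" and y: "x \<le> y" "y \<le> x + c" and \<eta>: "\<bar>\<eta>\<bar> \<le> 1" and C: "C \<ge> 1"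
    and u_deriv: "\<And>z. z > 0 \<Longrightarrow> (u has_real_derivative (\<eta> - (real w - real b * z ^ b) * u z) / z) (at z)"
    and u_bound: "\<And>z. x \<le> z \<Longrightarrow> z \<le> y \<Longrightarrow> \<bar>u z\<bar> \<le> C * (2 + z) ^ w"
  shows "\<bar>u y - u x\<bar> \<le> (y - x) * ((real w + real b + 1) * C * (3 + x) ^ (w + b) / x)"
    "\<bar>u y - u x - (y - x) * ((\<eta> - (real w - real b * x ^ b) * u x) / x)\<bar>
       \<le> (y - x) * (c * ((real w + real b + 1) ^ 2 * 2 * C * (3 + x) ^ (w + 2 * b) / x\<^sup>2))"
proof -
  define v where "v z = real w - real b * z ^ b" for z :: real
  define k where "k z = \<eta> - v z * u z" for z
  define L where "L = real w + real b + 1"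
  have L: "L \<ge> 1" by (simp add: L_def)
  have zpos: "z > 0" "z \<le> x + 1" "2 + z \<le> 3 + x" if "x \<le> z" "z \<le> y" for z using that x y c by linarith+
  have pow: "(2 + z) ^ n \<le> (3 + x) ^ n" "z ^ n \<le> (3 + x) ^ n" "1 \<le> (3 + x) ^ n" if "x \<le> z" "z \<le> y" for z n
    using zpos[OF that] x by (auto intro!: power_mono one_le_power)
  have u_b: "\<bar>u z\<bar> \<le> C * (3 + x) ^ w" if z: "x \<le> z" "z \<le> y" for z
    using u_bound[OF z] pow(1)[OF z, of w] C
    by (meson mult_left_mono order_trans zero_le_one)
  have v_b: "\<bar>v z\<bar> \<le> (real w + real b) * (3 + x) ^ b" if z: "x \<le> z" "z \<le> y" for z
  proof -
    have "\<bar>v z\<bar> \<le> real w + real b * z ^ b"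
      unfolding v_def using zpos[OF z] by (auto simp: abs_le_iff)
    also have "\<dots> \<le> real w * (3 + x) ^ b + real b * (3 + x) ^ b"
      using pow(2,3)[OF z, of b] by (intro add_mono mult_left_mono) (auto simp: mult_le_cancel_left1)
    finally show ?thesis by (simp add: ring_distribs)
  qed
  have vu_b: "\<bar>v z * u z\<bar> \<le> (real w + real b) * C * (3 + x) ^ (w + b)" if z: "x \<le> z" "z \<le> y" for z
  proof -
    have "\<bar>v z * u z\<bar> \<le> ((real w + real b) * (3 + x) ^ b) * (C * (3 + x) ^ w)"
      unfolding abs_mult using v_b[OF z] u_b[OF z] x by (intro mult_mono) auto
    then show ?thesis by (simp add: power_add mult_ac)
  qed
  have k_b: "\<bar>k z\<bar> \<le> L * C * (3 + x) ^ (w + b)" if z: "x \<le> z" "z \<le> y" for z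
  proof -
    have "1 \<le> C * (3 + x) ^ (w + b)"
      using mult_mono[OF C pow(3)[OF z, of "w + b"]] C by simp
    moreover have "\<bar>k z\<bar> \<le> 1 + \<bar>v z * u z\<bar>" unfolding k_def using \<eta> by linarith
    ultimately show ?thesis using vu_b[OF z] by (simp add: L_def ring_distribs)
  qed
  have u': "(u has_real_derivative k z / z) (at z)" if "z > 0" for z
    using u_deriv[OF that] by (simp add: k_def v_def)
  have u'_b: "\<bar>k z / z\<bar> \<le> L * C * (3 + x) ^ (w + b) / x" if z: "x \<le> z" "z \<le> y" for z
    unfolding abs_divide using k_b[OF z] zpos[OF z] z x C L by (intro frac_le) auto
  have mvt: "\<exists>z. x < z \<and> z < e \<and> f e - f x = (e - x) * f' z"
    if e: "x < e" and d: "\<And>z. x \<le> z \<Longrightarrow> z \<le> e \<Longrightarrow> (f has_real_derivative f' z) (at z)"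
    for f f' :: "real \<Rightarrow> real" and e
    using MVT2[OF e d] .
  show "\<bar>u y - u x\<bar> \<le> (y - x) * ((real w + real b + 1) * C * (3 + x) ^ (w + b) / x)"
  proof (cases "x < y")
    case True
    obtain z where z: "x < z" "z < y" "u y - u x = (y - x) * (k z / z)"
      using mvt[OF True, of u "\<lambda>z. k z / z"] u' x by auto
    show ?thesis unfolding z(3) abs_mult L_def[symmetric]
      using u'_b[of z] z True by (intro mult_mono) auto
  qed (use y in simp)
  define u'' where "u'' z = ((real b * (real b * z ^ (b - 1)) * u z - v z * (k z / z)) * z - k z) / (z * z)" for z
  have k': "((\<lambda>z. k z / z) has_real_derivative u'' z) (at z)" if "z > 0" for z
    unfolding k_def[abs_def] v_def u''_def using that
    by (auto intro!: derivative_eq_intros u'[unfolded k_def v_def] simp: k_def v_def power2_eq_square divide_simps)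
  have u''_b: "\<bar>u'' z\<bar> \<le> L ^ 2 * 2 * C * (3 + x) ^ (w + 2 * b) / x\<^sup>2" if z: "x \<le> z" "z \<le> y" for z
  proof -
    have zz: "z > 0" using zpos[OF z] by simp
    have zb: "z ^ b = z ^ (b - 1) * z" using b1 by (metis power_minus_mult less_eq_Suc_le One_nat_def)
    then have u''_eq: "u'' z = (real b * real b * z ^ b * u z - v z * k z - k z) / (z * z)"
      unfolding u''_def zb using zz by (simp add: field_simps)
    let ?P = "(3 + x) ^ (w + 2 * b)"
    have "\<bar>real b * real b * z ^ b * u z\<bar> \<le> real b * real b * (3 + x) ^ b * (C * (3 + x) ^ w)"
      unfolding abs_mult using pow(2)[OF z, of b] u_b[OF z] zz x by (intro mult_mono) auto
    also have "\<dots> = real b * real b * C * (3 + x) ^ (w + b)" by (simp add: power_add mult_ac)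
    also have "\<dots> \<le> real b * real b * C * ?P"
      using C x by (intro mult_left_mono power_increasing) auto
    finally have t1: "\<bar>real b * real b * z ^ b * u z\<bar> \<le> real b * real b * C * ?P" .
    have "\<bar>v z * k z\<bar> \<le> ((real w + real b) * (3 + x) ^ b) * (L * C * (3 + x) ^ (w + b))"
      unfolding abs_mult using v_b[OF z] k_b[OF z] x by (intro mult_mono) auto
    also have "\<dots> = (real w + real b) * L * C * ?P"
    proof -
      have "?P = (3 + x) ^ b * (3 + x) ^ (w + b)" by (simp add: power_add[symmetric] add_ac mult_2)
      then show ?thesis by (simp only: mult_ac)
    qed
    finally have t2: "\<bar>v z * k z\<bar> \<le> (real w + real b) * L * C * ?P" .
    have "\<bar>k z\<bar> \<le> L * C * (3 + x) ^ (w + b)" by (rule k_b[OF z])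
    also have "\<dots> \<le> L * C * ?P" using C L x by (intro mult_left_mono power_increasing) auto
    finally have t3: "\<bar>k z\<bar> \<le> L * C * ?P" .
    \<comment> \<open>The identity \<open>(w + b) * L + L = L * L\<close> collects the last two
      contributions; with \<open>b * b \<le> L * L\<close> this is the origin of the factor
      \<open>2 * L ^ 2\<close>.\<close>
    have "real b * real b * C * ?P + (real w + real b) * L * C * ?P + L * C * ?P = (real b * real b + L * L) * C * ?P"
      by (simp add: L_def algebra_simps)
    also have "\<dots> \<le> (L * L + L * L) * C * ?P"
      using C x by (intro mult_right_mono add_right_mono mult_mono) (auto simp: L_def)
    finally have "\<bar>real b * real b * z ^ b * u z - v z * k z - k z\<bar> \<le> L ^ 2 * 2 * C * ?P"
      using t1 t2 t3 by (simp add: power2_eq_square)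
    moreover have "x\<^sup>2 \<le> z * z" using z x by (simp add: power2_eq_square mult_mono)
    ultimately show ?thesis
      unfolding u''_eq abs_divide using x zz C L by (intro frac_le) (auto simp: abs_mult)
  qed
  show "\<bar>u y - u x - (y - x) * ((\<eta> - (real w - real b * x ^ b) * u x) / x)\<bar>
       \<le> (y - x) * (c * ((real w + real b + 1) ^ 2 * 2 * C * (3 + x) ^ (w + 2 * b) / x\<^sup>2))"
  proof (cases "x < y")
    case True
    obtain z where z: "x < z" "z < y" "u y - u x = (y - x) * (k z / z)"
      using mvt[OF True, of u "\<lambda>z. k z / z"] u' x by auto
    obtain z' where z': "x < z'" "z' < z" "k z / z - k x / x = (z - x) * u'' z'"
      using mvt[OF z(1), of "\<lambda>z. k z / z" u''] k' x by auto
    have "u y - u x - (y - x) * (k x / x) = (y - x) * ((z - x) * u'' z')"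
      unfolding z(3) z'(3)[symmetric] by (simp add: right_diff_distrib)
    also have "\<bar>\<dots>\<bar> \<le> (y - x) * (c * (L ^ 2 * 2 * C * (3 + x) ^ (w + 2 * b) / x\<^sup>2))"
      unfolding abs_mult using u''_b[of z'] z z' y c by (intro mult_mono) (auto intro!: mult_nonneg_nonneg)
    finally show ?thesis by (simp add: L_def k_def v_def)
  qed (use y in simp)
qed

text \<open>The solution of the Stein equation \<open>x g'(x) + (w - b x^b) g(x) = 1[x \<le> t] - P(Z \<le> t)\<close>
  consists of two smooth branches joined at \<open>t\<close>.\<close>

lemma stein_solution:
  "\<exists>C\<ge>1. \<forall>t>0. \<exists>g.
     (\<forall>x>0. \<bar>g x\<bar> \<le> C * (4 + x) ^ (w + 2 * b)) \<and>
     (\<forall>x>0. \<forall>c. 0 < c \<and> c \<le> 1 \<longrightarrow> \<bar>g (x + c) - g x\<bar> \<le> c * (C * (4 + x) ^ (w + 2 * b) / x)) \<and>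
     (\<forall>x>0. \<forall>c. 0 < c \<and> c \<le> 1 \<and> \<not> (x \<le> t \<and> t < x + c) \<longrightarrow>
        \<bar>g (x + c) - g x - c * (((if x \<le> t then 1 else 0) - lower t / total - (real w - real b * x ^ b) * g x) / x)\<bar>
        \<le> c * (c * (C * (4 + x) ^ (w + 2 * b) / x\<^sup>2)))"
proof -
  obtain C0 where C0: "C0 \<ge> 0" "\<And>x. x > 0 \<Longrightarrow> exp (x ^ b) * upper x \<le> C0 * (2 + x) ^ w"
    using upper_exp_bound by blast
  define C1 where "C1 = C0 / total + 1"
  define L where "L = real w + real b + 1"
  have C1: "C1 \<ge> 1" using C0 total_pos by (simp add: C1_def)
  have L: "L \<ge> 1" by (simp add: L_def)
  define C where "C = L ^ 2 * 2 * C1"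
  have LL: "L \<le> L ^ 2" using L by (simp add: power2_eq_square)
  have C_ge: "C \<ge> C1" "L * C1 \<le> C"
  proof -
    have "1 * C1 \<le> (L ^ 2 * 2) * C1" using L LL C1 by (intro mult_right_mono) linarith+
    then show "C \<ge> C1" by (simp add: C_def)
    have "L * C1 \<le> (L ^ 2 * 2) * C1" using L LL C1 by (intro mult_right_mono) linarith+
    then show "L * C1 \<le> C" by (simp add: C_def)
  qed
  \<comment> \<open>\<open>E\<close> is the reciprocal of the integrating factor: it solves the
    homogeneous equation, with \<open>x * E' + (w - b * x ^ b) * E = 0\<close>, and it satisfies
    \<open>E * F = 1 / x\<close>.\<close>
  define E where "E x = exp (x ^ b) / x ^ w" for x :: real
  have E': "(E has_real_derivative - (real w - real b * x ^ b) * E x / x) (at x)" if "x > 0" for x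
  proof -
    have xw: "x ^ w = x * x ^ (w - 1)" "x ^ b = x * x ^ (b - 1)"
      using w1 b1 by (metis Suc_pred' less_eq_Suc_le power_Suc One_nat_def)+
    have "(E has_real_derivative (exp (x ^ b) * (real b * x ^ (b - 1)) * x ^ w - exp (x ^ b) * (real w * x ^ (w - 1))) / (x ^ w * x ^ w)) (at x)"
      unfolding E_def[abs_def] using that by (auto intro!: derivative_eq_intros simp: power2_eq_square)
    also have "(exp (x ^ b) * (real b * x ^ (b - 1)) * x ^ w - exp (x ^ b) * (real w * x ^ (w - 1))) / (x ^ w * x ^ w)
       = - (real w - real b * x ^ b) * E x / x"
      using that unfolding E_def xw by (simp add: divide_simps) (simp add: algebra_simps)
    finally show ?thesis .
  qed
  have EF: "E x * F x = 1 / x" if "x > 0" for x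
  proof -
    have "x ^ w = x * x ^ (w - 1)" using w1 by (metis Suc_pred' less_eq_Suc_le power_Suc One_nat_def)
    then show ?thesis using that by (simp add: E_def F_def exp_minus divide_simps)
  qed
  have E_bound: "E x * lower x * upper x / total \<le> C1 * (2 + x) ^ w" if x: "x > 0" for x
  proof -
    have "lower x / x ^ w \<le> 1" using lower_le_power[OF x] x by simp
    then have "(lower x / x ^ w) * (exp (x ^ b) * upper x) \<le> 1 * (C0 * (2 + x) ^ w)"
      by (rule mult_mono) (use C0(2)[OF x] x lower_nonneg upper_nonneg in auto)
    then have "E x * lower x * upper x \<le> C0 * (2 + x) ^ w" by (simp add: E_def mult_ac)
    then have "E x * lower x * upper x / total \<le> C0 / total * (2 + x) ^ w"
      using total_pos by (simp add: divide_right_mono)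
    also have "\<dots> \<le> C1 * (2 + x) ^ w" using x by (intro mult_right_mono) (auto simp: C1_def)
    finally show ?thesis .
  qed
  have main: "\<exists>g.
     (\<forall>x>0. \<bar>g x\<bar> \<le> C * (4 + x) ^ (w + 2 * b)) \<and>
     (\<forall>x>0. \<forall>c. 0 < c \<and> c \<le> 1 \<longrightarrow> \<bar>g (x + c) - g x\<bar> \<le> c * (C * (4 + x) ^ (w + 2 * b) / x)) \<and>
     (\<forall>x>0. \<forall>c. 0 < c \<and> c \<le> 1 \<and> \<not> (x \<le> t \<and> t < x + c) \<longrightarrow>
        \<bar>g (x + c) - g x - c * (((if x \<le> t then 1 else 0) - lower t / total - (real w - real b * x ^ b) * g x) / x)\<bar>
        \<le> c * (c * (C * (4 + x) ^ (w + 2 * b) / x\<^sup>2)))" if t: "t > 0" for t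
  proof -
    define q where "q = lower t / total"
    have q: "0 \<le> q" "q \<le> 1" "upper t / total = 1 - q"
      unfolding q_def using lower_nonneg lower_le_total[of t] total_pos
      by (auto simp: upper_def diff_divide_distrib)
    \<comment> \<open>Variation of constants, integrating from 0 for \<open>u1\<close> and from
      infinity for \<open>u2\<close>; either choice suppresses the unbounded homogeneous part on its
      own side of \<open>t\<close>. The values agree at \<open>t\<close> because \<open>q\<close> is
      the value of the distribution function there.\<close>
    define u1 where "u1 x = (1 - q) * (E x * lower x)" for x
    define u2 where "u2 x = q * (E x * upper x)" for x
    define g where "g x = (if x \<le> t then u1 x else u2 x)" for x
    have "u1 t = upper t / total * (E t * lower t)" "u2 t = lower t / total * (E t * upper t)"
      by (simp_all only: u1_def u2_def q(3)) (simp add: q_def)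
    then have u_t: "u1 t = u2 t" by simp
    have u1': "(u1 has_real_derivative ((1 - q) - (real w - real b * z ^ b) * u1 z) / z) (at z)" if "z > 0" for z
    proof -
      have "(u1 has_real_derivative (1 - q) * ((- (real w - real b * z ^ b) * E z / z) * lower z + E z * F z)) (at z)"
        unfolding u1_def[abs_def] using that by (auto intro!: derivative_eq_intros E' lower_deriv)
      also have "(1 - q) * ((- (real w - real b * z ^ b) * E z / z) * lower z + E z * F z)
         = ((1 - q) - (real w - real b * z ^ b) * u1 z) / z"
        unfolding EF[OF that] u1_def using that by (simp add: field_simps)
      finally show ?thesis .
    qed
    have u2': "(u2 has_real_derivative (- q - (real w - real b * z ^ b) * u2 z) / z) (at z)" if "z > 0" for z
    proof -
      have "(u2 has_real_derivative q * ((- (real w - real b * z ^ b) * E z / z) * upper z - E z * F z)) (at z)"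
        unfolding u2_def[abs_def] using that by (auto intro!: derivative_eq_intros E' upper_deriv)
      also have "q * ((- (real w - real b * z ^ b) * E z / z) * upper z - E z * F z)
         = (- q - (real w - real b * z ^ b) * u2 z) / z"
        unfolding EF[OF that] u2_def using that by (simp add: field_simps)
      finally show ?thesis .
    qed
    have E0: "E z \<ge> 0" if "z > 0" for z using that by (simp add: E_def)
    have u1_b: "\<bar>u1 z\<bar> \<le> C1 * (2 + z) ^ w" if z: "0 < z" "z \<le> t" for z
    proof -
      have "\<bar>u1 z\<bar> = (E z * lower z) * (upper t / total)"
        unfolding u1_def q(3)[symmetric] using E0 z lower_nonneg upper_nonneg total_pos by (simp add: abs_mult)
      \<comment> \<open>The tail at \<open>t\<close> is replaced by the larger tail at
        \<open>z\<close>, so that the bound no longer depends on \<open>t\<close>.\<close>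
      also have "\<dots> \<le> (E z * lower z) * (upper z / total)"
        using E0 z lower_nonneg upper_antimono[OF z(2)] total_pos
        by (intro mult_left_mono divide_right_mono) auto
      finally show ?thesis using E_bound[OF z(1)] by simp
    qed
    have u2_b: "\<bar>u2 z\<bar> \<le> C1 * (2 + z) ^ w" if z: "0 < z" "t \<le> z" for z
    proof -
      have "\<bar>u2 z\<bar> = (E z * upper z) * (lower t / total)"
        unfolding u2_def q_def using E0 z lower_nonneg upper_nonneg total_pos by (simp add: abs_mult)
      also have "\<dots> \<le> (E z * upper z) * (lower z / total)"
        using E0 z upper_nonneg lower_mono[OF z(2)] total_pos
        by (intro mult_left_mono divide_right_mono) auto
      finally show ?thesis using E_bound[OF z(1)] by (simp add: mult_ac)
    qed
    have abs_q: "\<bar>1 - q\<bar> \<le> 1" "\<bar>- q\<bar> \<le> 1" using q by auto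
    have weaken: "L * C1 * (3 + x) ^ (w + b) / x \<le> C * (3 + x) ^ (w + 2 * b) / x"
      "L ^ 2 * 2 * C1 * (3 + x) ^ (w + 2 * b) / x\<^sup>2 \<le> C * (4 + x) ^ (w + 2 * b) / x\<^sup>2" if "x > 0" for x
    proof -
      show "L * C1 * (3 + x) ^ (w + b) / x \<le> C * (3 + x) ^ (w + 2 * b) / x"
        using that C_ge C1 L by (intro divide_right_mono mult_mono power_increasing) auto
      show "L ^ 2 * 2 * C1 * (3 + x) ^ (w + 2 * b) / x\<^sup>2 \<le> C * (4 + x) ^ (w + 2 * b) / x\<^sup>2"
        unfolding C_def using that C1 by (intro divide_right_mono mult_left_mono power_mono) auto
    qed
    note b1 = stein_piece_bounds[where u=u1 and \<eta>="1 - q", OF _ _ _ _ _ abs_q(1) C1 u1', folded L_def]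
    note b2 = stein_piece_bounds[where u=u2 and \<eta>="- q", OF _ _ _ _ _ abs_q(2) C1 u2', folded L_def]
    have step1: "\<bar>u1 y - u1 x\<bar> \<le> (y - x) * (C * (3 + x) ^ (w + 2 * b) / x)"
      if "0 < x" "x \<le> y" "y \<le> x + 1" "y \<le> t" for x y
    proof (rule order_trans[OF b1(1)[of x 1 y]])
      show "(y - x) * (L * C1 * (3 + x) ^ (w + b) / x) \<le> (y - x) * (C * (3 + x) ^ (w + 2 * b) / x)"
        using that weaken(1)[of x] by (intro mult_left_mono) auto
    qed (use that u1_b in auto)
    have step2: "\<bar>u2 y - u2 x\<bar> \<le> (y - x) * (C * (3 + x) ^ (w + 2 * b) / x)"
      if "0 < x" "x \<le> y" "y \<le> x + 1" "t \<le> x" for x y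
    proof (rule order_trans[OF b2(1)[of x 1 y]])
      show "(y - x) * (L * C1 * (3 + x) ^ (w + b) / x) \<le> (y - x) * (C * (3 + x) ^ (w + 2 * b) / x)"
        using that weaken(1)[of x] by (intro mult_left_mono) auto
    qed (use that u2_b in auto)
    \<comment> \<open>If \<open>t\<close> lies between \<open>x\<close> and \<open>x + c\<close>,
      the increment is split at \<open>t\<close>, and the second piece starts up to 1 to the right
      of \<open>x\<close>; the base \<open>4 + x\<close> instead of \<open>3 + x\<close> makes room
      for that.\<close>
    have shift: "C * (3 + x') ^ (w + 2 * b) / x' \<le> C * (4 + x) ^ (w + 2 * b) / x"
      if "0 < x" "x \<le> x'" "x' \<le> x + 1" for x x'
      using that C_ge C1 by (intro frac_le mult_left_mono power_mono) auto
    have "\<bar>g x\<bar> \<le> C * (4 + x) ^ (w + 2 * b)" if x: "x > 0" for x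
    proof -
      have "\<bar>g x\<bar> \<le> C1 * (2 + x) ^ w" using u1_b u2_b x by (auto simp: g_def)
      also have "\<dots> \<le> C1 * (4 + x) ^ w" using C1 x by (intro mult_left_mono power_mono) auto
      also have "\<dots> \<le> C * (4 + x) ^ (w + 2 * b)"
        using C_ge C1 x by (intro mult_mono power_increasing) auto
      finally show ?thesis .
    qed
    moreover have "\<bar>g (x + c) - g x\<bar> \<le> c * (C * (4 + x) ^ (w + 2 * b) / x)"
      if x: "x > 0" and c: "0 < c" "c \<le> 1" for x c
    proof -
      consider "x + c \<le> t" | "t < x" | "x \<le> t" "t < x + c" by linarith
      then show ?thesis
      proof cases
        case 1
        then have "\<bar>g (x + c) - g x\<bar> \<le> c * (C * (3 + x) ^ (w + 2 * b) / x)"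
          using step1[of x "x + c"] x c by (simp add: g_def)
        also have "\<dots> \<le> c * (C * (4 + x) ^ (w + 2 * b) / x)"
          using shift[of x x] x c by (intro mult_left_mono) auto
        finally show ?thesis .
      next
        case 2
        then have "\<bar>g (x + c) - g x\<bar> \<le> c * (C * (3 + x) ^ (w + 2 * b) / x)"
          using step2[of x "x + c"] x c by (simp add: g_def)
        also have "\<dots> \<le> c * (C * (4 + x) ^ (w + 2 * b) / x)"
          using shift[of x x] x c by (intro mult_left_mono) auto
        finally show ?thesis .
      next
        case 3
        let ?B = "C * (4 + x) ^ (w + 2 * b) / x"
        have "\<bar>u1 t - u1 x\<bar> \<le> (t - x) * ?B"
          using 3 x c by (intro order_trans[OF step1] mult_left_mono shift) auto
        moreover have "\<bar>u2 (x + c) - u2 t\<bar> \<le> (x + c - t) * ?B"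
          using 3 x c by (intro order_trans[OF step2] mult_left_mono shift) auto
        moreover have "g (x + c) = u2 (x + c)" "g x = u1 x" using 3 by (auto simp: g_def)
        moreover have "(t - x) * ?B + (x + c - t) * ?B = c * ?B"
          unfolding distrib_right[symmetric] by simp
        ultimately show ?thesis using u_t by linarith
      qed
    qed
    moreover have "\<bar>g (x + c) - g x - c * (((if x \<le> t then 1 else 0) - q - (real w - real b * x ^ b) * g x) / x)\<bar>
        \<le> c * (c * (C * (4 + x) ^ (w + 2 * b) / x\<^sup>2))"
      if x: "x > 0" and c: "0 < c" "c \<le> 1" and good: "\<not> (x \<le> t \<and> t < x + c)" for x c
    proof -
      have weak: "c * (c * (L ^ 2 * 2 * C1 * (3 + x) ^ (w + 2 * b) / x\<^sup>2)) \<le> c * (c * (C * (4 + x) ^ (w + 2 * b) / x\<^sup>2))"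
        using weaken(2)[OF x] c by (intro mult_left_mono) auto
      show ?thesis
      proof (cases "x \<le> t")
        case True
        then have "x + c \<le> t" using good by linarith
        then show ?thesis
          using b1(2)[of x c "x + c"] x c u1_b True weak by (simp add: g_def)
      next
        case False
        then show ?thesis
          using b2(2)[of x c "x + c"] x c u2_b weak by (simp add: g_def)
      qed
    qed
    ultimately show ?thesis unfolding q_def by (intro exI[of _ g]) auto
  qed
  show ?thesis using main C_ge(1) C1 by (intro exI[of _ C]) auto
qed

end

subsection \<open>Moments and point probabilities of the urn with immigration\<close>

locale immigration =
  fixes l w :: nat
  assumes l1: "l \<ge> 1" and w2: "w \<ge> 2"
begin

text \<open>Totals of an urn in which initially \<open>w\<close> balls are counted and one is not,
  with an uncounted ball added after every \<open>l\<close> draws. In the application, time 0 is the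
  moment at which color \<open>r + 1\<close> enters.\<close>

definition T :: "nat \<Rightarrow> nat" where "T i = w + 1 + i + i div l"

lemma T_ge: "w + 1 + i \<le> T i" by (simp add: T_def)
lemma T_init: "i < l \<Longrightarrow> T i = w + 1 + i" by (simp add: T_def)
lemma T_shift: "T (i + l) = T i + (l + 1)" using l1 by (simp add: T_def)
lemma T_shift_mult: "T (i + p * l) = T i + p * (l + 1)"
  using l1 by (simp add: T_def algebra_simps)
lemma T_pos: "0 < T i" using T_ge[of i] by simp
lemma T_ge1: "w + i \<le> T i" using T_ge[of i] by simp
lemma T_add_le: "T (n + j) \<le> (1 + 2 * j) * T n"
proof -
  have "(n + j) div l \<le> n div l + j"
  proof -
    have "(n + j) div l \<le> (n + j * l) div l" using l1 by (intro div_le_mono) simp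
    also have "\<dots> = n div l + j" using l1 by simp
    finally show ?thesis .
  qed
  then have "T (n + j) \<le> T n + 2 * j" by (simp add: T_def)
  also have "\<dots> \<le> T n + 2 * j * T n" using T_pos[of n] by simp
  finally show ?thesis by simp
qed
lemma T_mono: "i \<le> j \<Longrightarrow> T i \<le> T j"
  unfolding T_def by (intro add_mono div_le_mono) auto

abbreviation X :: "nat \<Rightarrow> nat pmf" where "X \<equiv> chain T w"
abbreviation Ex :: "nat \<Rightarrow> (nat \<Rightarrow> real) \<Rightarrow> real" where "Ex n \<equiv> measure_pmf.expectation (X n)"

text \<open>The denominator of the discrete Stein identity. It is of order \<open>T n ^ l\<close>,
  the order of the \<open>(l + 1)\<close>-st moment of the count, which is how the exponent
  \<open>l / (l + 1)\<close> arises.\<close>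

definition R :: "nat \<Rightarrow> real" where "R n = (\<Prod>i<l. real (T (n + i)))"

lemma R_ge: "real (T n) ^ l \<le> R n"
proof -
  have "(\<Prod>i<l. real (T n)) \<le> R n"
    unfolding R_def by (rule prod_mono) (auto intro!: T_mono)
  then show ?thesis by simp
qed

lemma R_pos: "0 < R n"
  unfolding R_def using T_pos by (intro prod_pos) auto

lemma supp_ge: "i \<in> set_pmf (X n) \<Longrightarrow> w \<le> i"
  using set_pmf_chain[of T w n] by auto

lemma supp_le: "i \<in> set_pmf (X n) \<Longrightarrow> i \<le> T n"
  using set_pmf_chain[of T w n] T_ge[of n] by auto

lemma Ex_mono: "(\<And>i. w \<le> i \<Longrightarrow> f i \<le> g i) \<Longrightarrow> Ex n f \<le> Ex n g"
  using supp_ge by (intro expectation_mono_on_support) auto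

lemma Ex_abs_le: "(\<And>i. w \<le> i \<Longrightarrow> \<bar>f i\<bar> \<le> g i) \<Longrightarrow> \<bar>Ex n f\<bar> \<le> Ex n g"
  by (rule order_trans[OF integral_abs_bound]) (rule Ex_mono)

lemma Ex_stein: "Ex (n + l) (stein_op w G) = Ex n (\<lambda>i. pochhammer (real i) (l + 1) * G (i + (l + 1))) / R n"
  unfolding R_def using w2 by (intro expectation_chain_stein T_init T_ge T_shift) auto

text \<open>For orders divisible by \<open>l + 1\<close> the product of eigenvalues telescopes,
  since raising \<open>T i\<close> by \<open>p * (l + 1)\<close> is the same as advancing time by
  \<open>p * l\<close>.\<close>

lemma moment_bound: "\<exists>C\<ge>0. \<forall>n. Ex n (\<lambda>i. real i ^ (p * (l + 1))) \<le> C * real (T n) ^ (p * l)"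
proof -
  define C where "C = pochhammer (real w) (p * (l + 1)) * (\<Prod>i<p*l. real (1 + 2 * i))"
  have C: "C \<ge> 0" unfolding C_def by (intro mult_nonneg_nonneg pochhammer_nonneg prod_nonneg) (use w2 in auto)
  have "Ex n (\<lambda>i. real i ^ (p * (l + 1))) \<le> C * real (T n) ^ (p * l)" for n
  proof -
    have "Ex n (\<lambda>i. real i ^ (p * (l + 1))) \<le> Ex n (\<lambda>i. pochhammer (real i) (p * (l + 1)))"
    proof (rule Ex_mono)
      fix i assume "w \<le> i"
      have "(\<Prod>j<p*(l+1). real i) \<le> (\<Prod>j<p*(l+1). real i + real j)" by (rule prod_mono) auto
      then show "real i ^ (p * (l + 1)) \<le> pochhammer (real i) (p * (l + 1))"
        by (simp add: pochhammer_prod atLeast0LessThan)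
    qed
    also have "\<dots> = pochhammer (real w) (p * (l + 1)) * (\<Prod>i<n. 1 + real (p * (l + 1)) / real (T i))"
      by (rule expectation_chain_pochhammer) (auto intro: T_ge1 T_pos)
    also have "(\<Prod>i<n. 1 + real (p * (l + 1)) / real (T i)) = (\<Prod>i<n. real (T (i + p * l)) / real (T i))"
      using T_pos by (intro prod.cong) (auto simp: T_shift_mult add_divide_distrib less_imp_neq[OF T_pos, symmetric])
    also have "\<dots> = (\<Prod>i<p*l. real (T (n + i))) / (\<Prod>i<p*l. real (T i))"
      using T_pos by (intro prod_shift_telescope) (simp add: less_imp_neq[OF T_pos, symmetric])
    also have "\<dots> \<le> (\<Prod>i<p*l. real (T (n + i))) / 1"
    proof (rule divide_left_mono)
      show "1 \<le> (\<Prod>i<p*l. real (T i))" using T_pos by (intro prod_ge_1) (auto simp: Suc_le_eq)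
      then show "0 < (\<Prod>i<p*l. real (T i)) * 1" by simp
    qed (auto intro: prod_nonneg)
    also have "(\<Prod>i<p*l. real (T (n + i))) \<le> (\<Prod>i<p*l. real (1 + 2 * i) * real (T n))"
    proof (rule prod_mono, rule conjI)
      show "real (T (n + i)) \<le> real (1 + 2 * i) * real (T n)" for i
        using T_add_le[of n i] by (metis of_nat_le_iff of_nat_mult)
    qed simp
    also have "\<dots> = (\<Prod>i<p*l. real (1 + 2 * i)) * real (T n) ^ (p * l)"
      by (simp add: prod.distrib)
    finally show ?thesis unfolding C_def using w2
      by (simp add: mult_left_mono pochhammer_nonneg mult.assoc)
  qed
  then show ?thesis using C by blast
qed

text \<open>The expectation is a product of factors \<open>1 - 1 / T i\<close>. Its
  \<open>(l + 1)\<close>-st power is compared, factor by factor, with the telescoping product of the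
  quotients \<open>T i / T (i + l)\<close>.\<close>

lemma inverse_moment_bound:
  "\<exists>C\<ge>0. \<forall>n. Ex n (\<lambda>i. 1 / (real i - 1)) ^ (l + 1) \<le> C / real (T n) ^ l"
proof -
  define C where "C = (\<Prod>i<l. real (T i))"
  have "Ex n (\<lambda>i. 1 / (real i - 1)) ^ (l + 1) \<le> C / real (T n) ^ l" for n
  proof -
    define P where "P = (\<Prod>i<n. 1 - 1 / real (T i))"
    have one: "0 \<le> 1 - 1 / real (T i)" for i using T_pos[of i] by simp
    have P: "0 \<le> P" unfolding P_def by (intro prod_nonneg) (use one in auto)
    have "Ex n (\<lambda>i. 1 / (real i - 1)) = 1 / (real w - 1) * P"
      unfolding P_def by (rule expectation_chain_inverse) (use w2 T_ge1 in auto)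
    also have "\<dots> \<le> 1 * P" using P w2 by (intro mult_right_mono) auto
    finally have le: "Ex n (\<lambda>i. 1 / (real i - 1)) \<le> P" by simp
    have ge: "0 \<le> Ex n (\<lambda>i. 1 / (real i - 1))"
      using Ex_mono[of "\<lambda>_. 0" "\<lambda>i. 1 / (real i - 1)" n] w2 by simp
    have "Ex n (\<lambda>i. 1 / (real i - 1)) ^ (l + 1) \<le> P ^ (l + 1)" by (rule power_mono[OF le ge])
    also have "P ^ (l + 1) = (\<Prod>i<n. (1 - 1 / real (T i)) ^ (l + 1))"
      unfolding P_def prod_power_distrib[symmetric] ..
    also have "\<dots> \<le> (\<Prod>i<n. 1 / (real (T (i + l)) / real (T i)))"
    proof (rule prod_mono, rule conjI)
      fix i
      show "0 \<le> (1 - 1 / real (T i)) ^ (l + 1)" using one by simp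
      have t: "real (T i) > 0" using T_pos[of i] by simp
      \<comment> \<open>With \<open>x = 1 / T i\<close>, the inequality
        \<open>(1 - x) ^ (l + 1) * (1 + (l + 1) * x) \<le> 1\<close> follows from
        \<open>(1 - x) * (1 + x) \<le> 1\<close> and Bernoulli's inequality.\<close>
      have "(1 - 1 / real (T i)) * (1 + 1 / real (T i)) \<le> 1" by (simp add: algebra_simps)
      then have "((1 - 1 / real (T i)) * (1 + 1 / real (T i))) ^ (l + 1) \<le> 1"
        using one t by (intro power_le_one) auto
      then have a: "(1 - 1 / real (T i)) ^ (l + 1) * (1 + 1 / real (T i)) ^ (l + 1) \<le> 1"
        by (simp only: power_mult_distrib)
      have "1 + real (l + 1) * (1 / real (T i)) \<le> (1 + 1 / real (T i)) ^ (l + 1)"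
        by (rule Bernoulli_inequality) (use t in \<open>simp add: order_trans[of _ 0]\<close>)
      then have "(1 - 1 / real (T i)) ^ (l + 1) * (1 + real (l + 1) * (1 / real (T i)))
        \<le> (1 - 1 / real (T i)) ^ (l + 1) * (1 + 1 / real (T i)) ^ (l + 1)"
        using one by (intro mult_left_mono) auto
      with a have "(1 - 1 / real (T i)) ^ (l + 1) * (1 + real (l + 1) * (1 / real (T i))) \<le> 1"
        by linarith
      moreover have "1 + real (l + 1) * (1 / real (T i)) = real (T (i + l)) / real (T i)"
        using t by (simp add: T_shift field_simps)
      ultimately show "(1 - 1 / real (T i)) ^ (l + 1) \<le> 1 / (real (T (i + l)) / real (T i))"
        using t T_pos[of "i + l"] by (simp add: pos_le_divide_eq)
    qed
    also have "\<dots> = 1 / (\<Prod>i<n. real (T (i + l)) / real (T i))"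
      by (simp add: prod_dividef)
    also have "(\<Prod>i<n. real (T (i + l)) / real (T i)) = R n / C"
      unfolding R_def C_def using T_pos by (intro prod_shift_telescope) (simp add: less_imp_neq[OF T_pos, symmetric])
    also have "1 / (R n / C) = C / R n" by simp
    also have "\<dots> \<le> C / real (T n) ^ l"
      using R_ge[of n] T_pos[of n] unfolding C_def
      by (intro divide_left_mono prod_nonneg mult_pos_pos R_pos) auto
    finally show ?thesis .
  qed
  then show ?thesis by (intro exI[of _ C]) (auto simp: C_def intro: prod_nonneg)
qed

text \<open>The middle clauses say that \<open>c\<close> has the order of \<open>T n\<close> to the
  power \<open>- l / (l + 1)\<close>. The last one is a calibration: \<open>1 / R n\<close> agrees
  with \<open>(l + 1) * c ^ (l + 1)\<close> up to a relative error of order \<open>c\<close>, which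
  produces the coefficient \<open>b * x ^ b\<close> of the Stein equation.\<close>

definition scale_ok :: "real \<Rightarrow> nat \<Rightarrow> real \<Rightarrow> bool" where
  "scale_ok k n c \<longleftrightarrow> 0 < c \<and> c \<le> 1 \<and> 1 / k \<le> c ^ (l + 1) * real (T n) ^ l
     \<and> c ^ (l + 1) * real (T n) ^ l \<le> k \<and> \<bar>real (l + 1) * c ^ (l + 1) * R n - 1\<bar> \<le> k * c"

lemma power_add_le_split:
  fixes a y :: real
  assumes "0 \<le> a" "0 \<le> y"
  shows "(a + y) ^ m \<le> (2 * a) ^ m + (2 * y) ^ m"
proof -
  have "(a + y) ^ m \<le> (2 * max a y) ^ m" using assms by (intro power_mono) auto
  also have "\<dots> \<le> (2 * a) ^ m + (2 * y) ^ m"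
    using assms by (auto simp: max_def)
  finally show ?thesis .
qed

text \<open>The base is at least 1, so the exponent may be raised from \<open>K\<close> to the
  multiple \<open>K * (l + 1)\<close>, for which the moment bound is available.\<close>

lemma scaled_moment:
  assumes k: "k > 0" and B: "B \<ge> 1"
  shows "\<exists>C\<ge>0. \<forall>n c j. scale_ok k n c \<and> j \<le> l \<longrightarrow> Ex (n + j) (\<lambda>i. (B + c * real i) ^ K) \<le> C"
proof -
  define m where "m = K * (l + 1)"
  obtain C1 where C1: "C1 \<ge> 0" "\<And>n. Ex n (\<lambda>i. real i ^ m) \<le> C1 * real (T n) ^ (K * l)"
    using moment_bound[of K] unfolding m_def by blast
  define C where "C = (2 * B) ^ m + 2 ^ m * (C1 * (real (1 + 2 * l) ^ (K * l) * k ^ K))"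
  have "Ex (n + j) (\<lambda>i. (B + c * real i) ^ K) \<le> C" if ok: "scale_ok k n c" and j: "j \<le> l" for n c j
  proof -
    have c: "0 < c" "c ^ (l + 1) * real (T n) ^ l \<le> k" using ok by (auto simp: scale_ok_def)
    have "Ex (n + j) (\<lambda>i. (B + c * real i) ^ K) \<le> Ex (n + j) (\<lambda>i. (2 * B) ^ m + 2 ^ m * c ^ m * real i ^ m)"
    proof (rule Ex_mono)
      fix i
      have "(B + c * real i) ^ K \<le> (B + c * real i) ^ m"
        using B c by (intro power_increasing) (auto simp: m_def add_increasing2)
      also have "\<dots> \<le> (2 * B) ^ m + (2 * (c * real i)) ^ m"
        using B c by (intro power_add_le_split) auto
      finally show "(B + c * real i) ^ K \<le> (2 * B) ^ m + 2 ^ m * c ^ m * real i ^ m"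
        by (simp add: power_mult_distrib mult.assoc)
    qed
    also have "\<dots> = (2 * B) ^ m + 2 ^ m * c ^ m * Ex (n + j) (\<lambda>i. real i ^ m)" by simp
    also have "\<dots> \<le> (2 * B) ^ m + 2 ^ m * c ^ m * (C1 * real (T (n + j)) ^ (K * l))"
      using C1(2)[of "n + j"] c by (intro add_left_mono mult_left_mono) auto
    also have "\<dots> \<le> (2 * B) ^ m + 2 ^ m * c ^ m * (C1 * (real (1 + 2 * l) * real (T n)) ^ (K * l))"
    proof -
      have "T (n + j) \<le> (1 + 2 * l) * T n"
        using T_add_le[of n j] j by (meson add_left_mono le_trans mult_le_mono1 mult_le_mono2)
      then have "real (T (n + j)) \<le> real (1 + 2 * l) * real (T n)"
        by (metis of_nat_le_iff of_nat_mult)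
      then show ?thesis using C1(1) c by (intro add_left_mono mult_left_mono power_mono) auto
    qed
    also have "\<dots> = (2 * B) ^ m + 2 ^ m * (C1 * (real (1 + 2 * l) ^ (K * l) * (c ^ (l + 1) * real (T n) ^ l) ^ K))"
      by (simp only: power_mult_distrib m_def power_mult[symmetric] mult_ac)
    also have "\<dots> \<le> C"
      unfolding C_def using c C1(1) by (intro add_left_mono mult_left_mono power_mono) auto
    finally show ?thesis .
  qed
  moreover have "C \<ge> 0" using C1(1) B k by (auto simp: C_def intro!: add_nonneg_nonneg mult_nonneg_nonneg)
  ultimately show ?thesis by blast
qed

lemma scaled_inverse_moment:
  assumes k: "k > 0"
  shows "\<exists>C\<ge>0. \<forall>n c j. scale_ok k n c \<longrightarrow> Ex (n + j) (\<lambda>i. 1 / (real i - 1)) \<le> C * c"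
proof -
  obtain C1 where C1: "C1 \<ge> 0" "\<And>n. Ex n (\<lambda>i. 1 / (real i - 1)) ^ (l + 1) \<le> C1 / real (T n) ^ l"
    using inverse_moment_bound by blast
  \<comment> \<open>Made at least 1 so that \<open>C \<le> C ^ (l + 1)\<close>; then the
    \<open>(l + 1)\<close>-st root can be taken on both sides.\<close>
  define C where "C = 1 + C1 * k"
  have C: "C \<ge> 1" using C1 k by (simp add: C_def)
  have "Ex (n + j) (\<lambda>i. 1 / (real i - 1)) \<le> C * c" if ok: "scale_ok k n c" for n c j
  proof -
    have c: "0 < c" "1 / k \<le> c ^ (l + 1) * real (T n) ^ l" using ok by (auto simp: scale_ok_def)
    have t: "real (T n) ^ l > 0" using T_pos by simp
    have "Ex (n + j) (\<lambda>i. 1 / (real i - 1)) ^ (l + 1) \<le> C1 / real (T (n + j)) ^ l" by (rule C1)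
    also have "\<dots> \<le> C1 / real (T n) ^ l"
      using C1(1) t T_pos[of "n + j"] T_mono[of n "n + j"] by (intro divide_left_mono power_mono) auto
    also have "\<dots> \<le> C1 * (k * c ^ (l + 1))"
    proof -
      have "1 / real (T n) ^ l \<le> k * c ^ (l + 1)" using c(2) k t by (simp add: field_simps)
      then have "C1 * (1 / real (T n) ^ l) \<le> C1 * (k * c ^ (l + 1))" using C1(1) by (rule mult_left_mono)
      then show ?thesis by simp
    qed
    also have "\<dots> \<le> C * c ^ (l + 1)" using c by (simp add: C_def ring_distribs)
    also have "\<dots> \<le> C ^ (l + 1) * c ^ (l + 1)"
      using C c self_le_power[of C "l + 1"] by (intro mult_right_mono) auto
    also have "\<dots> = (C * c) ^ (l + 1)" by (simp only: power_mult_distrib)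
    finally have "Ex (n + j) (\<lambda>i. 1 / (real i - 1)) ^ Suc l \<le> (C * c) ^ Suc l" by simp
    then show ?thesis by (rule power_le_imp_le_base) (use C c in auto)
  qed
  then show ?thesis using C by (intro exI[of _ C]) auto
qed

text \<open>The constant part of the base is paid for by the inverse moment. In the other part one
  factor \<open>c * i\<close>, present because \<open>K > 0\<close>, cancels the denominator and
  leaves the \<open>c\<close>.\<close>

lemma scaled_moment_over:
  assumes k: "k > 0" and B: "B \<ge> 1" and K: "K > 0"
  shows "\<exists>C\<ge>0. \<forall>n c j. scale_ok k n c \<and> j \<le> l \<longrightarrow> Ex (n + j) (\<lambda>i. (B + c * real i) ^ K / real i) \<le> C * c"
proof -
  obtain C1 where C1: "C1 \<ge> 0" "\<And>n c j. scale_ok k n c \<Longrightarrow> j \<le> l \<Longrightarrow> Ex (n + j) (\<lambda>i. (B + c * real i) ^ K) \<le> C1"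
    using scaled_moment[OF k B, of K] by blast
  obtain C2 where C2: "C2 \<ge> 0" "\<And>n c j. scale_ok k n c \<Longrightarrow> Ex (n + j) (\<lambda>i. 1 / (real i - 1)) \<le> C2 * c"
    using scaled_inverse_moment[OF k] by blast
  define C where "C = (2 * B) ^ K * C2 + 2 ^ K * C1"
  have "Ex (n + j) (\<lambda>i. (B + c * real i) ^ K / real i) \<le> C * c" if ok: "scale_ok k n c" "j \<le> l" for n c j
  proof -
    have c: "0 < c" "c \<le> 1" using ok by (auto simp: scale_ok_def)
    have "Ex (n + j) (\<lambda>i. (B + c * real i) ^ K / real i)
      \<le> Ex (n + j) (\<lambda>i. (2 * B) ^ K * (1 / (real i - 1)) + 2 ^ K * c * (B + c * real i) ^ K)"
    proof (rule Ex_mono)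
      fix i assume "w \<le> i"
      then have i: "real i \<ge> 2" using w2 by simp
      have "(2 * B) ^ K / real i \<le> (2 * B) ^ K / (real i - 1)"
        using B i by (intro divide_left_mono) auto
      moreover have "(2 * (c * real i)) ^ K / real i \<le> 2 ^ K * c * (B + c * real i) ^ K"
      proof (cases K)
        case 0
        then show ?thesis using K by simp
      next
        case (Suc K')
        have "(2 * (c * real i)) ^ K / real i = 2 ^ K * c * (c * real i) ^ K'"
          using i by (simp add: Suc power_mult_distrib)
        also have "\<dots> \<le> 2 ^ K * c * (B + c * real i) ^ K'"
          using B c by (intro mult_left_mono power_mono) auto
        also have "\<dots> \<le> 2 ^ K * c * (B + c * real i) ^ K"
          using B c Suc by (intro mult_left_mono power_increasing) (auto simp: add_increasing2)
        finally show ?thesis .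
      qed
      moreover have "(B + c * real i) ^ K / real i \<le> ((2 * B) ^ K + (2 * (c * real i)) ^ K) / real i"
        using B c by (intro divide_right_mono power_add_le_split) auto
      ultimately show "(B + c * real i) ^ K / real i \<le> (2 * B) ^ K * (1 / (real i - 1)) + 2 ^ K * c * (B + c * real i) ^ K"
        by (simp add: add_divide_distrib)
    qed
    also have "\<dots> = (2 * B) ^ K * Ex (n + j) (\<lambda>i. 1 / (real i - 1)) + 2 ^ K * c * Ex (n + j) (\<lambda>i. (B + c * real i) ^ K)"
      by (simp only: Bochner_Integration.integral_add[OF integrable_chain integrable_chain] integral_mult_right_zero)
    also have "\<dots> \<le> (2 * B) ^ K * (C2 * c) + 2 ^ K * c * C1"
      using C1(2)[OF ok] C2(2)[OF ok(1), of j] B c by (intro add_mono mult_left_mono) auto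
    finally show ?thesis by (simp add: C_def algebra_simps)
  qed
  then show ?thesis using C1 C2 B by (intro exI[of _ C]) (auto simp: C_def)
qed

text \<open>The equation \<open>stein_op w G = indicator {k}\<close> solved for
  \<open>G (i + 1)\<close>; the solution is zero up to \<open>k\<close>.\<close>

primrec indicator_solution :: "nat \<Rightarrow> nat \<Rightarrow> real" where
  "indicator_solution k 0 = 0"
| "indicator_solution k (Suc i) = (if i < k then 0 else if i = k then 1 / real k
     else (1 - real w / real i) * indicator_solution k i)"

lemma stein_op_indicator_solution:
  assumes "0 < k" "0 < i"
  shows "stein_op w (indicator_solution k) i = indicator {k} i"
proof -
  have "indicator_solution k j = 0" if "j \<le> k" for j
    using that by (cases j) auto
  then show ?thesis using assms by (auto simp: stein_op_def field_simps split: split_indicator)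
qed

text \<open>Each factor \<open>1 - w / i\<close> is at most \<open>1 - 1 / i\<close>, and
  \<open>1 / (i - 1)\<close> solves exactly the recursion with the latter factor.\<close>

lemma indicator_solution_bounds:
  assumes "w \<le> k" "k < i"
  shows "0 \<le> indicator_solution k i \<and> indicator_solution k i \<le> 1 / (real i - 1)"
  using \<open>k < i\<close>
proof (induction i)
  case (Suc i)
  show ?case
  proof (cases "i = k")
    case False
    then have i: "k < i" using Suc.prems by simp
    then have r: "real i > real w" "real i \<ge> 2" using assms w2 by linarith+
    have IH: "0 \<le> indicator_solution k i" "indicator_solution k i \<le> 1 / (real i - 1)"
      using Suc.IH[OF i] by auto
    have "1 - real w / real i \<le> 1 - 1 / real i" using r w2 by (simp add: divide_right_mono)
    then have "(1 - real w / real i) * indicator_solution k i \<le> (1 - 1 / real i) * (1 / (real i - 1))"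
      using IH r by (intro mult_mono) auto
    also have "\<dots> = 1 / real i" using r by (simp add: field_simps)
    finally show ?thesis using i IH r by simp
  qed simp
qed simp

text \<open>The Stein identity for \<open>indicator_solution k\<close>: the decay of the solution
  cancels the top factor of \<open>pochhammer i (l + 1)\<close>. This lowers the order by one, and
  the missing order is the gain of one factor \<open>c\<close> after scaling.\<close>

lemma point_probability:
  assumes k: "w \<le> k"
  shows "pmf (X (n + l)) k \<le> Ex n (\<lambda>i. pochhammer (real i) l * indicator {k - l..} i) / R n"
proof -
  have "pmf (X (n + l)) k = Ex (n + l) (indicator {k})" by (simp add: pmf.rep_eq)
  also have "\<dots> = Ex (n + l) (stein_op w (indicator_solution k))"
    by (rule expectation_cong_on_support, subst stein_op_indicator_solution)
       (use k w2 in \<open>auto dest: supp_ge\<close>)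
  also have "\<dots> = Ex n (\<lambda>i. pochhammer (real i) (l + 1) * indicator_solution k (i + (l + 1))) / R n"
    by (rule Ex_stein)
  also have "\<dots> \<le> Ex n (\<lambda>i. pochhammer (real i) l * indicator {k - l..} i) / R n"
  proof (intro divide_right_mono Ex_mono)
    fix i assume i: "w \<le> i"
    have p: "pochhammer (real i) l \<ge> 0" by (rule pochhammer_nonneg) (use i w2 in simp)
    show "pochhammer (real i) (l + 1) * indicator_solution k (i + (l + 1)) \<le> pochhammer (real i) l * indicator {k - l..} i"
    proof (cases "k < i + (l + 1)")
      case True
      have "pochhammer (real i) (l + 1) * indicator_solution k (i + (l + 1))
         \<le> (pochhammer (real i) l * (real i + real l)) * (1 / (real i + real l))"
        using indicator_solution_bounds[OF k True] p
        by (simp only: Suc_eq_plus1[symmetric] pochhammer_Suc) (intro mult_left_mono; simp)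
      also have "\<dots> = pochhammer (real i) l" using i w2 by simp
      finally show ?thesis using True by simp
    next
      case False
      then have "indicator_solution k (i + (l + 1)) = 0" by (auto simp: not_less Suc_le_eq)
      then show ?thesis using p by simp
    qed
  qed (use R_pos[of n] in simp)
  finally show ?thesis .
qed

text \<open>The weight at the point can be moved inside the expectation, because the states
  occurring there are at most \<open>l\<close> below the point. Of the \<open>l + 1\<close> factors
  \<open>c\<close> supplied by \<open>1 / R n\<close>, \<open>l\<close> absorb the rising factorial
  and one remains.\<close>

lemma weighted_point_probability:
  assumes k: "k > 0" and B: "B \<ge> 1"
  shows "\<exists>C\<ge>0. \<forall>n c i. scale_ok k n c \<longrightarrow> pmf (X (n + l)) i * (B + c * real i) ^ K \<le> C * c"
proof -
  define A where "A = B + real l"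
  have A: "A \<ge> 1" using B by (simp add: A_def)
  obtain C1 where C1: "C1 \<ge> 0" "\<And>n c j. scale_ok k n c \<Longrightarrow> j \<le> l \<Longrightarrow> Ex (n + j) (\<lambda>i. (A + c * real i) ^ (K + l)) \<le> C1"
    using scaled_moment[OF k A, of "K + l"] by blast
  have "pmf (X (n + l)) i0 * (B + c * real i0) ^ K \<le> k * C1 * c" if ok: "scale_ok k n c" for n c i0
  proof (cases "w \<le> i0")
    case True
    have c: "0 < c" "c \<le> 1" "1 / k \<le> c ^ (l + 1) * real (T n) ^ l" using ok by (auto simp: scale_ok_def)
    have "1 / k \<le> c ^ (l + 1) * R n"
      using c R_ge[of n] by (meson mult_left_mono order_trans zero_le_power less_imp_le)
    then have invR: "1 / R n \<le> k * c ^ (l + 1)" using k R_pos[of n] by (simp add: field_simps)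
    have "pmf (X (n + l)) i0 * (B + c * real i0) ^ K
      \<le> Ex n (\<lambda>i. pochhammer (real i) l * indicator {i0 - l..} i) / R n * (B + c * real i0) ^ K"
      using point_probability[OF True, of n] B c by (intro mult_right_mono) auto
    also have "\<dots> = Ex n (\<lambda>i. pochhammer (real i) l * indicator {i0 - l..} i * (B + c * real i0) ^ K) * (1 / R n)"
      by simp
    also have "\<dots> \<le> Ex n (\<lambda>i. (real i + real l) ^ l * (A + c * real i) ^ K) * (1 / R n)"
    proof (intro mult_right_mono Ex_mono)
      fix i assume i: "w \<le> i"
      have "(\<Prod>j<l. real i + real j) \<le> (\<Prod>j<l. real i + real l)" by (rule prod_mono) auto
      then have p: "pochhammer (real i) l \<le> (real i + real l) ^ l" by (simp add: pochhammer_prod atLeast0LessThan)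
      show "pochhammer (real i) l * indicator {i0 - l..} i * (B + c * real i0) ^ K
        \<le> (real i + real l) ^ l * (A + c * real i) ^ K"
      proof (cases "i0 - l \<le> i")
        case True
        then have "real i0 \<le> real i + real l" by linarith
        then have "c * real i0 \<le> c * real i + 1 * real l"
          using c mult_left_mono[of "real i0" "real i + real l" c] mult_right_mono[of c 1 "real l"]
          by (simp add: ring_distribs)
        then have "(B + c * real i0) ^ K \<le> (A + c * real i) ^ K"
          using B c by (intro power_mono) (auto simp: A_def)
        then show ?thesis using p True B c by (auto intro!: mult_mono)
      next
        case False
        then show ?thesis using A c by simp
      qed
    qed (use R_pos[of n] in simp)
    also have "\<dots> \<le> Ex n (\<lambda>i. (real i + real l) ^ l * (A + c * real i) ^ K) * (k * c ^ (l + 1))"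
      using invR A c by (intro mult_left_mono Bochner_Integration.integral_nonneg) auto
    also have "\<dots> = k * c * Ex n (\<lambda>i. c ^ l * (real i + real l) ^ l * (A + c * real i) ^ K)"
      by (simp add: mult.assoc)
    also have "\<dots> \<le> k * c * Ex n (\<lambda>i. (A + c * real i) ^ (K + l))"
    proof (intro mult_left_mono Ex_mono)
      fix i
      have "c ^ l * (real i + real l) ^ l = (c * real i + c * real l) ^ l"
        by (simp add: power_mult_distrib[symmetric] ring_distribs)
      also have "\<dots> \<le> (A + c * real i) ^ l"
        using B c mult_right_mono[of c 1 "real l"] by (intro power_mono) (auto simp: A_def)
      finally have "c ^ l * (real i + real l) ^ l * (A + c * real i) ^ K \<le> (A + c * real i) ^ l * (A + c * real i) ^ K"
        using A c by (intro mult_right_mono) auto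
      then show "c ^ l * (real i + real l) ^ l * (A + c * real i) ^ K \<le> (A + c * real i) ^ (K + l)"
        by (simp add: power_add mult.commute)
    qed (use k c in auto)
    also have "\<dots> \<le> k * c * C1" using C1(2)[OF ok, of 0] k c by (intro mult_left_mono) auto
    finally show ?thesis by (simp add: mult_ac)
  next
    case False
    then have "i0 \<notin> set_pmf (X (n + l))" by (auto dest: supp_ge)
    then have "pmf (X (n + l)) i0 = 0" by (simp add: pmf_eq_0_set_pmf)
    then show ?thesis using C1 k ok by (simp add: scale_ok_def)
  qed
  then show ?thesis using C1 k by (intro exI[of _ "k * C1"]) auto
qed

end

subsection \<open>Kolmogorov distance to the generalised gamma distribution\<close>

lemma power_diff_le:
  fixes x y M :: real
  assumes "0 \<le> x" "x \<le> y" "y \<le> M" "1 \<le> M"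
  shows "y ^ n - x ^ n \<le> real n * (y - x) * M ^ n"
proof (induction n)
  case (Suc n)
  have "y ^ Suc n - x ^ Suc n = y * (y ^ n - x ^ n) + (y - x) * x ^ n" by (simp add: algebra_simps)
  also have "\<dots> \<le> M * (real n * (y - x) * M ^ n) + (y - x) * (M * M ^ n)"
  proof (intro add_mono)
    have "y * (y ^ n - x ^ n) \<le> M * (y ^ n - x ^ n)"
      using assms power_mono[of x y n] by (intro mult_right_mono) auto
    also have "\<dots> \<le> M * (real n * (y - x) * M ^ n)" using Suc assms by (intro mult_left_mono) auto
    finally show "y * (y ^ n - x ^ n) \<le> M * (real n * (y - x) * M ^ n)" .
    have "x ^ n \<le> 1 * M ^ n" using assms power_mono[of x M n] by simp
    also have "\<dots> \<le> M * M ^ n" using assms by (intro mult_right_mono) auto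
    finally show "(y - x) * x ^ n \<le> (y - x) * (M * M ^ n)" using assms by (intro mult_left_mono) auto
  qed
  finally show ?case by (simp add: algebra_simps)
qed simp

context immigration
begin

text \<open>Serves to compare the term \<open>b * x ^ b * g x\<close> of the Stein equation at the
  times \<open>n + l\<close> and \<open>n\<close>. A draw raises the count by at most one, so only
  \<open>l\<close> single increments of the function matter.\<close>

lemma expectation_drift:
  assumes "\<And>i. w \<le> i \<Longrightarrow> \<bar>\<Phi> (Suc i) - \<Phi> i\<bar> \<le> D i"
  shows "\<bar>Ex (n + j) \<Phi> - Ex n \<Phi>\<bar> \<le> (\<Sum>m<j. Ex (n + m) D)"
proof (induction j)
  case (Suc j)
  have "Ex (n + Suc j) \<Phi> - Ex (n + j) \<Phi> = Ex (n + j) (\<lambda>i. step_op (T (n + j)) \<Phi> i - \<Phi> i)"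
    using T_ge1[of "n + j"]
    by (simp add: expectation_chain_Suc del: chain.simps)
  also have "\<bar>\<dots>\<bar> \<le> Ex (n + j) D"
  proof (rule order_trans[OF integral_abs_bound], rule expectation_mono_on_support)
    fix i assume i: "i \<in> set_pmf (X (n + j))"
    have "\<bar>step_op (T (n + j)) \<Phi> i - \<Phi> i\<bar> = (real i / real (T (n + j))) * \<bar>\<Phi> (Suc i) - \<Phi> i\<bar>"
      by (simp add: step_op_def abs_mult)
    also have "\<dots> \<le> 1 * D i"
      using supp_le[OF i] supp_ge[OF i] assms[of i] T_pos[of "n + j"] by (intro mult_mono) auto
    finally show "\<bar>step_op (T (n + j)) \<Phi> i - \<Phi> i\<bar> \<le> D i" by simp
  qed simp
  finally have "\<bar>Ex (n + Suc j) \<Phi> - Ex (n + j) \<Phi>\<bar> \<le> Ex (n + j) D" .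
  then show ?case using Suc.IH by (simp del: chain.simps)
qed simp

text \<open>For the Stein solution \<open>g\<close> put \<open>G i = g (c * i)\<close>. The
  difference of the distribution functions is the expectation of
  \<open>stein_op w G - err - \<Phi>\<close> at time \<open>n + l\<close>, and its first term equals
  a size-biased expectation at time \<open>n\<close>. Three errors of order \<open>c\<close> remain:
  the discretisation \<open>err\<close>, the drift of \<open>\<Phi>\<close> over one period, and the
  comparison of \<open>\<Phi>\<close> with the size bias.\<close>

lemma kolmogorov_bound:
  assumes k: "k > 0"
  shows "\<exists>C\<ge>0. \<forall>n c t. scale_ok k n c \<longrightarrow>
    \<bar>measure_pmf.prob (X (n + l)) {i. c * real i \<le> t} - measure (prop_density (gga_weight w (l + 1))) {..t}\<bar> \<le> C * c"
proof -
  define b where "b = l + 1"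
  interpret Z: gga w b
    using w2 by unfold_locales (auto simp: b_def)
  define K where "K = w + 2 * b"
  \<comment> \<open>The base leaves room for arguments shifted by up to \<open>b\<close> lattice
    steps, as \<open>4 + c * (i + b) \<le> B + c * i\<close>; the exponent \<open>K2\<close> absorbs
    a further factor \<open>x ^ b\<close>.\<close>
  define B where "B = 4 + real b"
  define K2 where "K2 = K + b"
  have B: "B \<ge> 1" by (simp add: B_def)
  have K2: "K2 > 0" by (simp add: K2_def b_def)
  obtain C0 where C0: "C0 \<ge> 1" and sol: "\<And>t. t > 0 \<Longrightarrow> \<exists>g.
     (\<forall>x>0. \<bar>g x\<bar> \<le> C0 * (4 + x) ^ K) \<and>
     (\<forall>x>0. \<forall>c. 0 < c \<and> c \<le> 1 \<longrightarrow> \<bar>g (x + c) - g x\<bar> \<le> c * (C0 * (4 + x) ^ K / x)) \<and>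
     (\<forall>x>0. \<forall>c. 0 < c \<and> c \<le> 1 \<and> \<not> (x \<le> t \<and> t < x + c) \<longrightarrow>
        \<bar>g (x + c) - g x - c * (((if x \<le> t then 1 else 0) - Z.lower t / Z.total - (real w - real b * x ^ b) * g x) / x)\<bar>
        \<le> c * (c * (C0 * (4 + x) ^ K / x\<^sup>2)))"
    using Z.stein_solution unfolding K_def by blast
  obtain D1 where D1: "D1 \<ge> 0" "\<And>n c j. scale_ok k n c \<Longrightarrow> j \<le> l \<Longrightarrow> Ex (n + j) (\<lambda>i. (B + c * real i) ^ K2) \<le> D1"
    using scaled_moment[OF k B, of K2] by blast
  obtain D2 where D2: "D2 \<ge> 0" "\<And>n c j. scale_ok k n c \<Longrightarrow> j \<le> l \<Longrightarrow> Ex (n + j) (\<lambda>i. (B + c * real i) ^ K2 / real i) \<le> D2 * c"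
    using scaled_moment_over[OF k B K2] by blast
  obtain D3 where D3: "D3 \<ge> 0" "\<And>n c i. scale_ok k n c \<Longrightarrow> pmf (X (n + l)) i * (B + c * real i) ^ K2 \<le> D3 * c"
    using weighted_point_probability[OF k B, of K2] by blast
  \<comment> \<open>\<open>C4\<close> is for the crude bound on \<open>err\<close> at the
    exceptional lattice point, \<open>C5\<close> for the drift, and \<open>C6\<close> for the size
    bias.\<close>
  define C4 where "C4 = C0 + 1 + (real w + real b) * C0"
  define C5 where "C5 = real b * (C0 + real b * C0)"
  define C6 where "C6 = (real b ^ 3 + k\<^sup>2) * C0 + k * real b * C0"
  define C where "C = C0 * D2 + C4 * D3 + real l * (C5 * (D2 + D1)) + C6 * (D2 + D1)"
  have C_nonneg: "C4 \<ge> 0" "C5 \<ge> 0" "C6 \<ge> 0" using C0 k by (auto simp: C4_def C5_def C6_def)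
  have C: "C \<ge> 0" using C0 D1(1) D2(1) D3(1) C_nonneg by (auto simp: C_def)
  have "\<bar>measure_pmf.prob (X (n + l)) {i. c * real i \<le> t} - measure (prop_density (gga_weight w b)) {..t}\<bar> \<le> C * c"
    if ok: "scale_ok k n c" for n c t
  proof -
    have c: "0 < c" "c \<le> 1" "1 / k \<le> c ^ b * real (T n) ^ l" "\<bar>real b * c ^ b * R n - 1\<bar> \<le> k * c"
      using ok by (auto simp: scale_ok_def b_def)
    show ?thesis
    proof (cases "t > 0")
      case False
      have "c * real i > t" if "w \<le> i" for i
      proof -
        have "0 < c * real i" using that c w2 by simp
        then show ?thesis using False by linarith
      qed
      then have "set_pmf (X (n + l)) \<inter> {i. c * real i \<le> t} = {}" by (auto dest: supp_ge simp: not_le[symmetric])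
      then have "measure_pmf.prob (X (n + l)) {i. c * real i \<le> t} = 0"
        by (simp add: measure_pmf_zero_iff)
      then show ?thesis using False Z.lower_nonpos[of t] C c by (simp add: Z.cdf)
    next
      case True
      define q where "q = Z.lower t / Z.total"
      have q: "0 \<le> q" "q \<le> 1"
        unfolding q_def using Z.lower_nonneg Z.lower_le_total[of t] Z.total_pos by auto
      obtain g where "\<forall>x>0. \<bar>g x\<bar> \<le> C0 * (4 + x) ^ K"
        and "\<forall>x>0. \<forall>c. 0 < c \<and> c \<le> 1 \<longrightarrow> \<bar>g (x + c) - g x\<bar> \<le> c * (C0 * (4 + x) ^ K / x)"
        and "\<forall>x>0. \<forall>c. 0 < c \<and> c \<le> 1 \<and> \<not> (x \<le> t \<and> t < x + c) \<longrightarrow>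
          \<bar>g (x + c) - g x - c * (((if x \<le> t then 1 else 0) - q - (real w - real b * x ^ b) * g x) / x)\<bar>
          \<le> c * (c * (C0 * (4 + x) ^ K / x\<^sup>2))"
        using sol[OF True] unfolding q_def by (elim exE conjE)
      then have g:
        "\<And>x. x > 0 \<Longrightarrow> \<bar>g x\<bar> \<le> C0 * (4 + x) ^ K"
        "\<And>x. x > 0 \<Longrightarrow> \<bar>g (x + c) - g x\<bar> \<le> c * (C0 * (4 + x) ^ K / x)"
        "\<And>x. x > 0 \<Longrightarrow> \<not> (x \<le> t \<and> t < x + c) \<Longrightarrow>
          \<bar>g (x + c) - g x - c * (((if x \<le> t then 1 else 0) - q - (real w - real b * x ^ b) * g x) / x)\<bar>
          \<le> c * (c * (C0 * (4 + x) ^ K / x\<^sup>2))"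
        using c by simp_all
      define G where "G i = g (c * real i)" for i :: nat
      define h where "h i = (if c * real i \<le> t then 1 else 0 :: real)" for i :: nat
      define P where "P i = (B + c * real i) ^ K2" for i :: nat
      define err where "err i = real i * (G (Suc i) - G i) - (h i - q - (real w - real b * (c * real i) ^ b) * G i)" for i
      define \<Phi> where "\<Phi> i = real b * (c * real i) ^ b * G i" for i
      have ipos: "real i > 0" "real i \<ge> 1" "c * real i > 0" if "w \<le> i" for i using that w2 c by auto
      have GSuc: "G (Suc i) = g (c * real i + c)" for i by (simp add: G_def algebra_simps)
      have P_ge: "1 \<le> P i" "(B + c * real i) ^ K \<le> P i" if "w \<le> i" for i
        using ipos[OF that] B unfolding P_def K2_def
        by (auto intro!: one_le_power power_increasing simp: add_increasing2)
      have g1: "\<bar>G i\<bar> \<le> C0 * (B + c * real i) ^ K" if i: "w \<le> i" for i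
        unfolding G_def using ipos[OF i] C0
        by (intro order_trans[OF g(1)] mult_left_mono power_mono) (auto simp: B_def)
      have g2: "\<bar>G (Suc i) - G i\<bar> \<le> C0 * (4 + c * real i) ^ K / real i" if i: "w \<le> i" for i
        using g(2)[of "c * real i"] ipos[OF i] c unfolding GSuc by (simp add: G_def)
      have g2': "\<bar>G (Suc i) - G i\<bar> \<le> C0 * (B + c * real i) ^ K / real i" if i: "w \<le> i" for i
        using ipos[OF i] C0
        by (intro order_trans[OF g2[OF i]] divide_right_mono mult_left_mono power_mono) (auto simp: B_def)
      have g3: "\<bar>err i\<bar> \<le> C0 * P i / real i" if i: "w \<le> i" and good: "\<not> (c * real i \<le> t \<and> t < c * real i + c)" for i
      proof -
        let ?x = "c * real i"
        let ?D = "h i - q - (real w - real b * ?x ^ b) * G i"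
        have "\<bar>G (Suc i) - G i - c * (?D / ?x)\<bar> \<le> c * (c * (C0 * (4 + ?x) ^ K / ?x\<^sup>2))"
          using g(3)[OF ipos(3)[OF i] good] unfolding GSuc by (simp add: G_def h_def)
        then have "real i * \<bar>G (Suc i) - G i - c * (?D / ?x)\<bar> \<le> real i * (c * (c * (C0 * (4 + ?x) ^ K / ?x\<^sup>2)))"
          by (rule mult_left_mono) simp
        moreover have "err i = real i * (G (Suc i) - G i - c * (?D / ?x))"
          using ipos[OF i] c unfolding err_def right_diff_distrib by simp
        then have "\<bar>err i\<bar> = real i * \<bar>G (Suc i) - G i - c * (?D / ?x)\<bar>" by (simp only: abs_mult abs_of_nat)
        moreover have "real i * (c * (c * (C0 * (4 + ?x) ^ K / ?x\<^sup>2))) = C0 * (4 + ?x) ^ K / real i"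
          using ipos[OF i] c by (simp add: power2_eq_square)
        moreover have "C0 * (4 + ?x) ^ K / real i \<le> C0 * P i / real i"
        proof -
          have "(4 + ?x) ^ K \<le> (B + ?x) ^ K" using ipos[OF i] by (intro power_mono) (auto simp: B_def)
          then show ?thesis using P_ge(2)[OF i] C0 by (intro divide_right_mono mult_left_mono) auto
        qed
        ultimately show ?thesis by linarith
      qed
      have xb: "(c * real i) ^ b \<le> (B + c * real i) ^ b" "1 \<le> (B + c * real i) ^ b" if i: "w \<le> i" for i
        using ipos[OF i] B by (auto intro!: power_mono one_le_power)
      have PK: "(B + c * real i) ^ b * (C0 * (B + c * real i) ^ K) = C0 * P i" for i
        by (simp add: P_def K2_def power_add mult_ac)
      have g4: "\<bar>err i\<bar> \<le> C4 * P i" if i: "w \<le> i" for i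
      proof -
        have "\<bar>real i * (G (Suc i) - G i)\<bar> \<le> real i * (C0 * (B + c * real i) ^ K / real i)"
          unfolding abs_mult abs_of_nat using g2'[OF i] by (intro mult_left_mono) auto
        also have "\<dots> \<le> C0 * P i" using ipos[OF i] P_ge[OF i] C0 by simp
        finally have 1: "\<bar>real i * (G (Suc i) - G i)\<bar> \<le> C0 * P i" .
        have 2: "\<bar>h i - q\<bar> \<le> 1 * P i" using q P_ge[OF i] by (auto simp: h_def)
        have "\<bar>real w - real b * (c * real i) ^ b\<bar> \<le> real w + real b * (c * real i) ^ b"
          using ipos[OF i] by (auto simp: abs_le_iff)
        also have "\<dots> \<le> real w * (B + c * real i) ^ b + real b * (B + c * real i) ^ b"
          using xb[OF i] by (intro add_mono mult_left_mono) (auto simp: mult_le_cancel_left1)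
        finally have "\<bar>real w - real b * (c * real i) ^ b\<bar> \<le> (real w + real b) * (B + c * real i) ^ b"
          by (simp add: distrib_right)
        then have "\<bar>(real w - real b * (c * real i) ^ b) * G i\<bar>
          \<le> ((real w + real b) * (B + c * real i) ^ b) * (C0 * (B + c * real i) ^ K)"
          unfolding abs_mult using g1[OF i] xb[OF i] by (intro mult_mono) auto
        also have "\<dots> = (real w + real b) * C0 * P i" by (simp only: mult.assoc PK)
        finally have 3: "\<bar>(real w - real b * (c * real i) ^ b) * G i\<bar> \<le> (real w + real b) * C0 * P i" .
        have "\<bar>err i\<bar> \<le> \<bar>real i * (G (Suc i) - G i)\<bar> + \<bar>h i - q\<bar> + \<bar>(real w - real b * (c * real i) ^ b) * G i\<bar>"
          unfolding err_def by linarith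
        also have "\<dots> \<le> C4 * P i" using 1 2 3 by (simp add: C4_def distrib_right)
        finally show ?thesis .
      qed
      \<comment> \<open>The second-order expansion fails only when \<open>t\<close> lies in the
        lattice cell that starts at \<open>c * i\<close>. This happens for at most one
        \<open>i\<close>, where the crude bound \<open>g4\<close> is multiplied by a point
        probability of order \<open>c\<close>.\<close>
      define i0 where "i0 = nat \<lfloor>t / c\<rfloor>"
      have bad: "i = i0" if "c * real i \<le> t" "t < c * real i + c" for i
      proof -
        have "real i \<le> t / c" "t / c < real i + 1" using that c by (simp_all add: field_simps)
        then have "\<lfloor>t / c\<rfloor> = int i" by (simp add: floor_eq_iff)
        then show ?thesis by (simp add: i0_def)
      qed
      have err_bound: "\<bar>err i\<bar> \<le> C0 * (P i / real i) + C4 * P i0 * indicator {i0} i" if i: "w \<le> i" for i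
      proof (cases "c * real i \<le> t \<and> t < c * real i + c")
        case True
        then have "i = i0" using bad by auto
        then show ?thesis using g4[OF i] ipos[OF i] P_ge[OF i] C0 by (simp add: add_increasing)
      next
        case False
        have "0 \<le> C4 * P i0 * indicator {i0} i" using C_nonneg B c by (simp add: P_def)
        then show ?thesis using g3[OF i False] by simp
      qed
      have E_err: "\<bar>Ex (n + l) err\<bar> \<le> (C0 * D2 + C4 * D3) * c"
      proof -
        have "\<bar>Ex (n + l) err\<bar> \<le> Ex (n + l) (\<lambda>i. C0 * (P i / real i) + C4 * P i0 * indicator {i0} i)"
          by (rule Ex_abs_le) (rule err_bound)
        also have "\<dots> = C0 * Ex (n + l) (\<lambda>i. P i / real i) + C4 * P i0 * Ex (n + l) (indicator {i0})"
          by (simp only: Bochner_Integration.integral_add[OF integrable_chain integrable_chain] integral_mult_right_zero)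
        also have "\<dots> = C0 * Ex (n + l) (\<lambda>i. P i / real i) + C4 * (pmf (X (n + l)) i0 * P i0)"
          by (simp add: pmf.rep_eq)
        also have "\<dots> \<le> C0 * (D2 * c) + C4 * (D3 * c)"
          using D2(2)[OF ok, of l] D3(2)[OF ok, of i0] C0 C_nonneg unfolding P_def
          by (intro add_mono mult_left_mono) auto
        finally show ?thesis by (simp add: algebra_simps)
      qed
      have \<Phi>_step: "\<bar>\<Phi> (Suc i) - \<Phi> i\<bar> \<le> C5 * (P i / real i + c * P i)" if i: "w \<le> i" for i
      proof -
        let ?x = "c * real i"
        have Suc_x: "c * real (Suc i) = ?x + c" by (simp add: algebra_simps)
        have "\<Phi> (Suc i) - \<Phi> i = real b * ((?x + c) ^ b * (G (Suc i) - G i) + ((?x + c) ^ b - ?x ^ b) * G i)"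
          unfolding \<Phi>_def Suc_x by (simp add: algebra_simps)
        also have "\<bar>\<dots>\<bar> \<le> real b * (\<bar>(?x + c) ^ b * (G (Suc i) - G i)\<bar> + \<bar>((?x + c) ^ b - ?x ^ b) * G i\<bar>)"
          unfolding abs_mult[of "real b"] abs_of_nat by (intro mult_left_mono abs_triangle_ineq) simp
        also have "\<dots> \<le> real b * (C0 * P i / real i + real b * c * (C0 * P i))"
        proof (intro mult_left_mono add_mono)
          have "\<bar>(?x + c) ^ b * (G (Suc i) - G i)\<bar> \<le> (B + ?x) ^ b * (C0 * (B + ?x) ^ K / real i)"
            unfolding abs_mult using ipos[OF i] c g2'[OF i]
            by (intro mult_mono) (auto intro!: power_mono simp: B_def)
          also have "\<dots> = C0 * P i / real i" using PK[of i] by simp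
          finally show "\<bar>(?x + c) ^ b * (G (Suc i) - G i)\<bar> \<le> C0 * P i / real i" .
          have "(?x + c) ^ b - ?x ^ b \<le> real b * (?x + c - ?x) * (B + ?x) ^ b"
            using ipos[OF i] c by (intro power_diff_le) (auto simp: B_def)
          moreover have "0 \<le> (?x + c) ^ b - ?x ^ b" using ipos[OF i] c by (simp add: power_mono)
          ultimately have "\<bar>((?x + c) ^ b - ?x ^ b) * G i\<bar> \<le> (real b * c * (B + ?x) ^ b) * (C0 * (B + ?x) ^ K)"
            unfolding abs_mult using g1[OF i] ipos[OF i] c by (intro mult_mono) auto
          also have "\<dots> = real b * c * (C0 * P i)" by (simp only: mult.assoc PK)
          finally show "\<bar>((?x + c) ^ b - ?x ^ b) * G i\<bar> \<le> real b * c * (C0 * P i)" .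
        qed simp
        also have "\<dots> \<le> C5 * (P i / real i + c * P i)"
        proof -
          have "0 \<le> P i / real i" "0 \<le> c * P i" using P_ge[OF i] ipos[OF i] c by auto
          then have "C0 * (P i / real i) + real b * C0 * (c * P i)
             \<le> (C0 + real b * C0) * (P i / real i) + (C0 + real b * C0) * (c * P i)"
            using C0 by (intro add_mono mult_right_mono) auto
          then have "real b * (C0 * (P i / real i) + real b * C0 * (c * P i))
             \<le> real b * ((C0 + real b * C0) * (P i / real i) + (C0 + real b * C0) * (c * P i))"
            by (rule mult_left_mono) simp
          then show ?thesis by (simp add: C5_def algebra_simps)
        qed
        finally show ?thesis .
      qed
      have E_P: "Ex (n + j) (\<lambda>i. a * (P i / real i + c * P i)) \<le> a * (D2 + D1) * c" if "j \<le> l" "a \<ge> 0" for j a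
      proof -
        have "Ex (n + j) (\<lambda>i. a * (P i / real i + c * P i)) = a * (Ex (n + j) (\<lambda>i. P i / real i) + c * Ex (n + j) P)"
          by (simp only: Bochner_Integration.integral_add[OF integrable_chain integrable_chain] integral_mult_right_zero)
        also have "\<dots> \<le> a * (D2 * c + c * D1)"
          using D2(2)[OF ok that(1)] D1(2)[OF ok that(1)] that(2) c unfolding P_def[abs_def]
          by (intro mult_left_mono add_mono) auto
        finally show ?thesis by (simp add: algebra_simps)
      qed
      have E_drift: "\<bar>Ex (n + l) \<Phi> - Ex n \<Phi>\<bar> \<le> real l * (C5 * (D2 + D1)) * c"
      proof -
        have "\<bar>Ex (n + l) \<Phi> - Ex n \<Phi>\<bar> \<le> (\<Sum>m<l. Ex (n + m) (\<lambda>i. C5 * (P i / real i + c * P i)))"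
          by (rule expectation_drift) (rule \<Phi>_step)
        also have "\<dots> \<le> (\<Sum>m<l. C5 * (D2 + D1) * c)"
          by (rule sum_mono) (use E_P C_nonneg in auto)
        finally show ?thesis by simp
      qed
      have invR: "0 < 1 / R n" "1 / R n \<le> k * c ^ b"
      proof -
        have "1 / k \<le> c ^ b * R n"
          using c R_ge[of n] by (meson mult_left_mono order_trans zero_le_power less_imp_le)
        then show "1 / R n \<le> k * c ^ b" using k R_pos[of n] by (simp add: field_simps)
      qed (use R_pos in simp)
      \<comment> \<open>Three replacements: \<open>c ^ b * pochhammer i b\<close> against
        \<open>(c * i) ^ b\<close> in \<open>d1\<close>, the factor \<open>b * c ^ b\<close> against
        \<open>1 / R n\<close> in \<open>d2\<close> by the calibration, and \<open>G (i + b)\<close>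
        against \<open>G i\<close> in \<open>t2\<close>.\<close>
      have bias: "\<bar>\<Phi> i - pochhammer (real i) b * G (i + b) / R n\<bar> \<le> C6 * (P i / real i + c * P i)" if i: "w \<le> i" for i
      proof -
        let ?x = "c * real i" and ?p = "pochhammer (real i) b"
        have p: "real i ^ b \<le> ?p" "?p \<le> (real i + real b) ^ b"
        proof -
          have "(\<Prod>j<b. real i) \<le> (\<Prod>j<b. real i + real j)" "(\<Prod>j<b. real i + real j) \<le> (\<Prod>j<b. real i + real b)"
            by (rule prod_mono; auto)+
          then show "real i ^ b \<le> ?p" "?p \<le> (real i + real b) ^ b"
            by (simp_all add: pochhammer_prod atLeast0LessThan)
        qed
        have p0: "0 \<le> ?p" using p(1) by (rule order_trans[rotated]) simp
        have cb: "c * real b \<le> real b" using c by (simp add: mult_left_le_one_le)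
        have cib: "c ^ b * (real i + real b) ^ b = (?x + c * real b) ^ b"
          by (simp add: power_mult_distrib[symmetric] distrib_left)
        have cp: "c ^ b * ?p \<le> (B + ?x) ^ b"
        proof -
          have "c ^ b * ?p \<le> c ^ b * (real i + real b) ^ b" using p c by (intro mult_left_mono) auto
          also have "\<dots> \<le> (B + ?x) ^ b" unfolding cib using cb ipos[OF i] c by (intro power_mono) (auto simp: B_def)
          finally show ?thesis .
        qed
        have d1: "c ^ b * (?p - real i ^ b) \<le> real b * (c * real b) * (B + ?x) ^ b"
        proof -
          have "c ^ b * (?p - real i ^ b) \<le> c ^ b * (real i + real b) ^ b - c ^ b * real i ^ b"
            using p c by (simp add: right_diff_distrib mult_left_mono)
          also have "\<dots> = (?x + c * real b) ^ b - ?x ^ b" unfolding cib by (simp add: power_mult_distrib)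
          also have "\<dots> \<le> real b * (?x + c * real b - ?x) * (B + ?x) ^ b"
            using ipos[OF i] c cb by (intro power_diff_le) (auto simp: B_def)
          finally show ?thesis by simp
        qed
        have d2: "?p * \<bar>real b * c ^ b - 1 / R n\<bar> \<le> k * c * (k * (B + ?x) ^ b)"
        proof -
          have "\<bar>real b * c ^ b - 1 / R n\<bar> = \<bar>real b * c ^ b * R n - 1\<bar> * (1 / R n)"
          proof -
            have "real b * c ^ b - 1 / R n = (real b * c ^ b * R n - 1) * (1 / R n)"
              using R_pos[of n] by (simp add: field_simps)
            then have "\<bar>real b * c ^ b - 1 / R n\<bar> = \<bar>real b * c ^ b * R n - 1\<bar> * \<bar>1 / R n\<bar>"
              by (simp only: abs_mult)
            then show ?thesis using invR(1) by (simp only: abs_of_pos)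
          qed
          also have "\<dots> \<le> (k * c) * (k * c ^ b)" using c invR k by (intro mult_mono) auto
          finally have "?p * \<bar>real b * c ^ b - 1 / R n\<bar> \<le> ?p * ((k * c) * (k * c ^ b))"
            using p0 by (rule mult_left_mono)
          also have "\<dots> = k * c * (k * (c ^ b * ?p))" by (simp only: mult_ac)
          also have "\<dots> \<le> k * c * (k * (B + ?x) ^ b)" using cp k c by (intro mult_left_mono) auto
          finally show ?thesis .
        qed
        have t1: "\<bar>real b * ?x ^ b - ?p / R n\<bar> \<le> (real b ^ 3 + k\<^sup>2) * c * (B + ?x) ^ b"
        proof -
          have "real b * ?x ^ b - ?p / R n = - (real b * (c ^ b * (?p - real i ^ b))) + ?p * (real b * c ^ b - 1 / R n)"
            by (simp add: power_mult_distrib algebra_simps)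
          also have "\<bar>\<dots>\<bar> \<le> real b * (c ^ b * (?p - real i ^ b)) + ?p * \<bar>real b * c ^ b - 1 / R n\<bar>"
          proof -
            have "0 \<le> real b * (c ^ b * (?p - real i ^ b))" using p c by simp
            moreover have "\<bar>?p * (real b * c ^ b - 1 / R n)\<bar> = ?p * \<bar>real b * c ^ b - 1 / R n\<bar>"
              using p0 by (simp only: abs_mult abs_of_nonneg)
            ultimately show ?thesis by linarith
          qed
          also have "\<dots> \<le> real b * (real b * (c * real b) * (B + ?x) ^ b) + k * c * (k * (B + ?x) ^ b)"
            using d1 d2 by (intro add_mono mult_left_mono) auto
          finally show ?thesis by (simp add: power2_eq_square power3_eq_cube algebra_simps)
        qed
        have t2: "\<bar>G (i + b) - G i\<bar> \<le> real b * (C0 * (B + ?x) ^ K / real i)"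
        proof -
          have "G (i + b) - G i = (\<Sum>j<b. G (i + Suc j) - G (i + j))"
            by (subst sum_lessThan_telescope[of "\<lambda>j. G (i + j)"]) simp
          also have "\<bar>\<dots>\<bar> \<le> (\<Sum>j<b. C0 * (B + ?x) ^ K / real i)"
          proof (rule order_trans[OF sum_abs], rule sum_mono)
            fix j assume j: "j \<in> {..<b}"
            have "\<bar>G (i + Suc j) - G (i + j)\<bar> \<le> C0 * (4 + c * real (i + j)) ^ K / real (i + j)"
              using g2[of "i + j"] i by simp
            also have "\<dots> \<le> C0 * (B + ?x) ^ K / real i"
            proof (intro frac_le mult_left_mono power_mono)
              have "c * real j \<le> real b" using j c mult_mono[of c 1 "real j" "real b"] by simp
              then show "4 + c * real (i + j) \<le> B + ?x" by (simp add: B_def distrib_left)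
            qed (use ipos[OF i] C0 c B in auto)
            finally show "\<bar>G (i + Suc j) - G (i + j)\<bar> \<le> C0 * (B + ?x) ^ K / real i" .
          qed
          finally show ?thesis by simp
        qed
        have "\<Phi> i - ?p * G (i + b) / R n = (real b * ?x ^ b - ?p / R n) * G i - ?p * (1 / R n) * (G (i + b) - G i)"
          by (simp add: \<Phi>_def algebra_simps add_divide_distrib diff_divide_distrib)
        also have "\<bar>\<dots>\<bar> \<le> \<bar>(real b * ?x ^ b - ?p / R n) * G i\<bar> + \<bar>?p * (1 / R n) * (G (i + b) - G i)\<bar>"
          by (rule abs_triangle_ineq4)
        also have "\<dots> \<le> (real b ^ 3 + k\<^sup>2) * c * (C0 * P i) + k * (real b * (C0 * P i / real i))"
        proof (rule add_mono)
          have "\<bar>(real b * ?x ^ b - ?p / R n) * G i\<bar> \<le> ((real b ^ 3 + k\<^sup>2) * c * (B + ?x) ^ b) * (C0 * (B + ?x) ^ K)"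
            unfolding abs_mult using t1 g1[OF i] c ipos[OF i] B by (intro mult_mono) auto
          then show "\<bar>(real b * ?x ^ b - ?p / R n) * G i\<bar> \<le> (real b ^ 3 + k\<^sup>2) * c * (C0 * P i)"
            by (simp only: mult.assoc PK)
          have "?p * (1 / R n) \<le> ?p * (k * c ^ b)" using invR p0 by (intro mult_left_mono) auto
          also have "\<dots> = k * (c ^ b * ?p)" by (simp only: mult_ac)
          also have "\<dots> \<le> k * (B + ?x) ^ b" using cp k by (intro mult_left_mono) auto
          finally have "?p * (1 / R n) \<le> k * (B + ?x) ^ b" .
          moreover have "0 \<le> ?p * (1 / R n)" using p0 invR by simp
          ultimately have "\<bar>?p * (1 / R n) * (G (i + b) - G i)\<bar> \<le> (k * (B + ?x) ^ b) * (real b * (C0 * (B + ?x) ^ K / real i))"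
            using t2 unfolding abs_mult[of "?p * (1 / R n)"] by (intro mult_mono) auto
          also have "\<dots> = k * (real b * (((B + ?x) ^ b * (C0 * (B + ?x) ^ K)) / real i))" by simp
          also have "\<dots> = k * (real b * (C0 * P i / real i))" unfolding PK ..
          finally show "\<bar>?p * (1 / R n) * (G (i + b) - G i)\<bar> \<le> k * (real b * (C0 * P i / real i))" .
        qed
        also have "\<dots> = (real b ^ 3 + k\<^sup>2) * C0 * (c * P i) + k * real b * C0 * (P i / real i)"
          by simp
        also have "\<dots> \<le> C6 * (c * P i) + C6 * (P i / real i)"
        proof -
          have "0 \<le> P i / real i" "0 \<le> c * P i" using P_ge[OF i] ipos[OF i] c by auto
          then show ?thesis using C0 k by (intro add_mono mult_right_mono) (auto simp: C6_def)
        qed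
        finally show ?thesis by (simp add: algebra_simps)
      qed
      have E_bias: "\<bar>Ex n \<Phi> - Ex n (\<lambda>i. pochhammer (real i) b * G (i + b)) / R n\<bar> \<le> C6 * (D2 + D1) * c"
      proof -
        have "Ex n \<Phi> - Ex n (\<lambda>i. pochhammer (real i) b * G (i + b)) / R n
          = Ex n (\<lambda>i. \<Phi> i - pochhammer (real i) b * G (i + b) / R n)" by simp
        also have "\<bar>\<dots>\<bar> \<le> Ex n (\<lambda>i. C6 * (P i / real i + c * P i))"
          by (rule Ex_abs_le) (rule bias)
        also have "\<dots> \<le> C6 * (D2 + D1) * c" using E_P[of 0 C6] C_nonneg by simp
        finally show ?thesis .
      qed
      have "h i - q = stein_op w G i - err i - \<Phi> i" for i
        by (simp add: stein_op_def err_def \<Phi>_def algebra_simps)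
      then have "Ex (n + l) (\<lambda>i. h i - q) = Ex (n + l) (\<lambda>i. stein_op w G i - err i - \<Phi> i)" by simp
      then have "Ex (n + l) h - q = Ex (n + l) (stein_op w G) - Ex (n + l) err - Ex (n + l) \<Phi>" by simp
      also have "Ex (n + l) (stein_op w G) = Ex n (\<lambda>i. pochhammer (real i) b * G (i + b)) / R n"
        unfolding b_def by (rule Ex_stein)
      finally have "\<bar>Ex (n + l) h - q\<bar> \<le> (C0 * D2 + C4 * D3) * c + real l * (C5 * (D2 + D1)) * c + C6 * (D2 + D1) * c"
        using E_err E_drift E_bias by linarith
      also have "\<dots> = C * c" by (simp add: C_def algebra_simps)
      also have "Ex (n + l) h = measure_pmf.prob (X (n + l)) {i. c * real i \<le> t}"
      proof -
        have "h = indicator {i. c * real i \<le> t}" by (auto simp: h_def fun_eq_iff)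
        then show ?thesis by simp
      qed
      finally show ?thesis by (simp add: Z.cdf q_def)
    qed
  qed
  then show ?thesis using C unfolding b_def by blast
qed

end

subsection \<open>Conditional structure of the urn\<close>

text \<open>The effect of one more ball of color \<open>c\<close> on a vector of cumulative
  counts.\<close>

definition bump :: "nat \<Rightarrow> (nat \<Rightarrow> nat) \<Rightarrow> nat \<Rightarrow> nat" where
  "bump c v i = v i + (if c \<le> i then 1 else 0)"

text \<open>Measurability with respect to the counts from \<open>k\<close> on, phrased without
  sigma-algebras. For such a function of cumulative counts, a ball of any color up to
  \<open>k\<close> acts like one of color \<open>k\<close>.\<close>

definition dep_from :: "nat \<Rightarrow> ((nat \<Rightarrow> 'a) \<Rightarrow> 'b) \<Rightarrow> bool" where
  "dep_from k f \<longleftrightarrow> (\<forall>v v'. (\<forall>i\<ge>k. v i = v' i) \<longrightarrow> f v = f v')"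

lemma dep_fromD: "dep_from k f \<Longrightarrow> (\<And>i. k \<le> i \<Longrightarrow> v i = v' i) \<Longrightarrow> f v = f v'"
  by (auto simp: dep_from_def)

definition counts :: "nat multiset \<Rightarrow> nat \<Rightarrow> nat" where "counts U k = Mcount k U"

lemma Mcount_add [simp]: "Mcount k (U + W) = Mcount k U + Mcount k W"
  by (simp add: Mcount_def)

lemma Mcount_add_mset [simp]: "Mcount k (add_mset c U) = Mcount k U + (if 1 \<le> c \<and> c \<le> k then 1 else 0)"
  by (simp add: Mcount_def)

lemma Mcount_empty [simp]: "Mcount k {#} = 0"
  by (simp add: Mcount_def)

lemma Mcount_replicate [simp]: "Mcount k (replicate_mset j c) = (if 1 \<le> c \<and> c \<le> k then j else 0)"
  by (induction j) auto

lemma Mcount_eq_size: "(\<And>c. c \<in># U \<Longrightarrow> 1 \<le> c \<and> c \<le> k) \<Longrightarrow> Mcount k U = size U"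
  unfolding Mcount_def by (subst filter_mset_cong[OF refl, of U _ "\<lambda>_. True"]) auto

lemma Mcount_eq_sum: "Mcount k U = (\<Sum>c=1..k. count U c)"
proof -
  have "Mcount k U = (\<Sum>c\<in>set_mset (filter_mset (\<lambda>c. 1 \<le> c \<and> c \<le> k) U). count (filter_mset (\<lambda>c. 1 \<le> c \<and> c \<le> k) U) c)"
    by (simp add: Mcount_def size_multiset_overloaded_eq)
  also have "\<dots> = (\<Sum>c=1..k. count U c)"
    by (rule sum.mono_neutral_cong_left) (auto simp: not_in_iff)
  finally show ?thesis .
qed

lemma expectation_pmf_of_multiset:
  fixes g :: "'a \<Rightarrow> real"
  assumes "U \<noteq> {#}"
  shows "measure_pmf.expectation (pmf_of_multiset U) g = (\<Sum>c\<in>set_mset U. real (count U c) * g c) / real (size U)"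
proof -
  have "measure_pmf.expectation (pmf_of_multiset U) g = (\<Sum>c\<in>set_mset U. g c * pmf (pmf_of_multiset U) c)"
    by (rule integral_measure_pmf_real) (use assms in auto)
  then show ?thesis using assms by (simp add: sum_divide_distrib mult.commute)
qed

locale urn_model =
  fixes l s :: nat and m :: "nat \<Rightarrow> nat"
  assumes l1: "l \<ge> 1" and s1: "s \<ge> 1" and m1: "m 1 \<ge> 1"
    and m_incr: "\<And>k. 1 \<le> k \<Longrightarrow> k < s \<Longrightarrow> m (k + 1) \<ge> m k + 1"
begin

abbreviation U :: "nat \<Rightarrow> nat multiset pmf" where "U \<equiv> urn l s m"
abbreviation EU :: "nat \<Rightarrow> (nat multiset \<Rightarrow> real) \<Rightarrow> real" where "EU n \<equiv> measure_pmf.expectation (U n)"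

text \<open>The count of colors up to \<open>k\<close> at the moment color \<open>k + 1\<close> is
  first present. For \<open>k \<ge> s\<close> it consists of \<open>m s\<close> initial balls,
  \<open>l * (k - s + 1)\<close> balls from draws and \<open>k - s\<close> immigrants.\<close>

definition a :: "nat \<Rightarrow> nat" where "a k = (if k < s then m k else m s + (l + 1) * (k - s) + l)"
definition b :: "nat \<Rightarrow> nat" where "b k = (if k < s then m (k + 1) - m k else 1)"
text \<open>Truncated subtraction gives 0 for \<open>k < s\<close>, where color \<open>k + 1\<close>
  is present from the beginning.\<close>

definition start :: "nat \<Rightarrow> nat" where "start k = l * (k + 1 - s)"

lemma m_ge: "1 \<le> k \<Longrightarrow> k \<le> s \<Longrightarrow> k \<le> m k"
proof (induction k rule: nat_induct_at_least)
  case (Suc k)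
  then show ?case using m_incr[of k] by simp
qed (use m1 in simp)

lemma a_ge: "1 \<le> k \<Longrightarrow> k \<le> a k"
proof (cases "k < s")
  case False
  have "k - s \<le> (l + 1) * (k - s)" by simp
  then show ?thesis using m_ge[of s] s1 False by (simp add: a_def)
qed (use m_ge in \<open>simp add: a_def\<close>)

lemma b_ge: "1 \<le> k \<Longrightarrow> 1 \<le> b k"
  using m_incr[of k] by (auto simp: b_def)

lemma Mcount_urn0: "1 \<le> k \<Longrightarrow> k \<le> s \<Longrightarrow> Mcount k (urn0 s m) = m k"
proof -
  have "(\<forall>k. 1 \<le> k \<and> k < s' \<longrightarrow> m (k + 1) \<ge> m k + 1) \<Longrightarrow> k \<ge> 1 \<Longrightarrow> Mcount k (urn0 s' m) = m (min k s')"
    if "s' \<ge> 1" for s'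
    using that
  proof (induction s' rule: nat_induct_at_least)
    case base
    then show ?case by (simp add: urn0_def)
  next
    case (Suc s')
    have "urn0 (Suc s') m = urn0 s' m + replicate_mset (m (Suc s') - m s') (Suc s')"
      using Suc.hyps by (simp add: urn0_def)
    moreover have "Mcount k (urn0 s' m) = m (min k s')"
      using Suc.IH Suc.prems by simp
    moreover have "m (Suc s') \<ge> m s' + 1" using Suc.prems(1) Suc.hyps by simp
    ultimately show ?case by (cases "Suc s' \<le> k") (auto simp: min_def not_le)
  qed
  from this[OF s1] show "1 \<le> k \<Longrightarrow> k \<le> s \<Longrightarrow> Mcount k (urn0 s m) = m k"
    using m_incr by (simp add: min_def)
qed

lemma colors_urn0: "c \<in># urn0 s m \<Longrightarrow> 1 \<le> c \<and> c \<le> s"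
  by (auto simp: urn0_def set_mset_sum split: if_splits)

lemma urn_support:
  assumes "W \<in> set_pmf (U n)"
  shows "size W = m s + n + n div l \<and> (\<forall>c. c \<in># W \<longrightarrow> 1 \<le> c \<and> c \<le> s + n div l)"
  using assms
proof (induction n arbitrary: W)
  case 0
  then show ?case using Mcount_eq_size[of "urn0 s m" s] colors_urn0 Mcount_urn0[of s] s1 by auto
next
  case (Suc n)
  then obtain W' c where W': "W' \<in> set_pmf (U n)" "c \<in> set_pmf (pmf_of_multiset W')"
    and W: "W = add_mset c W' + (if l dvd Suc n then {# s + Suc n div l #} else {#})" by auto
  have size: "size W' = m s + n + n div l" and col: "\<And>c. c \<in># W' \<Longrightarrow> 1 \<le> c \<and> c \<le> s + n div l"
    using Suc.IH[OF W'(1)] by auto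
  have "m s \<ge> 1" using m_ge[of s] s1 by simp
  then have "W' \<noteq> {#}" using size by auto
  then have c: "c \<in># W'" using W'(2) by simp
  have "Suc n div l = (if l dvd Suc n then Suc (n div l) else n div l)"
    by (simp add: div_Suc dvd_eq_mod_eq_0)
  moreover have "1 \<le> d \<and> d \<le> Suc (s + n div l)" if "d \<in># W'" for d using col[OF that] by simp
  ultimately show ?case using size col c W s1 by auto
qed

lemma urn_support_nonempty: "W \<in> set_pmf (U n) \<Longrightarrow> W \<noteq> {#}"
  using urn_support[of W n] m_ge[of s] s1 by auto

lemma finite_set_pmf_urn [simp]: "finite (set_pmf (U n))"
proof (induction n)
  case (Suc n)
  then show ?case using urn_support_nonempty by auto
qed simp

section \<open>One draw in terms of cumulative counts\<close>

definition immigrate :: "nat \<Rightarrow> (nat \<Rightarrow> nat) \<Rightarrow> nat \<Rightarrow> nat" where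
  "immigrate n v = (if l dvd Suc n then bump (s + Suc n div l) v else v)"

lemma expectation_urn_Suc:
  "EU (Suc n) (\<lambda>W. f (counts W)) = EU n (\<lambda>W. (\<Sum>c=1..s + n div l. real (count W c) * f (immigrate n (bump c (counts W))))
     / real (m s + n + n div l))"
proof -
  have "EU (Suc n) (\<lambda>W. f (counts W)) = EU n (\<lambda>W. measure_pmf.expectation (pmf_of_multiset W)
      (\<lambda>c. f (counts (add_mset c W + (if l dvd Suc n then {# s + Suc n div l #} else {#})))))"
    unfolding urn.simps
    by (subst expectation_bind_finite) (use urn_support_nonempty in auto)
  also have "\<dots> = EU n (\<lambda>W. (\<Sum>c=1..s + n div l. real (count W c) * f (immigrate n (bump c (counts W))))
     / real (m s + n + n div l))"
  proof (rule expectation_cong_on_support)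
    fix W assume W: "W \<in> set_pmf (U n)"
    note supp = urn_support[OF W]
    let ?g = "\<lambda>c. f (counts (add_mset c W + (if l dvd Suc n then {# s + Suc n div l #} else {#})))"
    have g: "?g c = f (immigrate n (bump c (counts W)))" if "1 \<le> c" for c
    proof -
      have "counts (add_mset c W + (if l dvd Suc n then {# s + Suc n div l #} else {#})) = immigrate n (bump c (counts W))"
        using that s1 by (auto simp: fun_eq_iff counts_def bump_def immigrate_def)
      then show ?thesis by simp
    qed
    have "measure_pmf.expectation (pmf_of_multiset W) ?g = (\<Sum>c\<in>set_mset W. real (count W c) * ?g c) / real (size W)"
      by (rule expectation_pmf_of_multiset) (use urn_support_nonempty[OF W] in auto)
    also have "(\<Sum>c\<in>set_mset W. real (count W c) * ?g c)
      = (\<Sum>c=1..s + n div l. real (count W c) * f (immigrate n (bump c (counts W))))"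
      by (rule sum.mono_neutral_cong_left) (use supp g in \<open>auto simp: not_in_iff\<close>)
    finally show "measure_pmf.expectation (pmf_of_multiset W) ?g
      = (\<Sum>c=1..s + n div l. real (count W c) * f (immigrate n (bump c (counts W)))) / real (m s + n + n div l)"
      using supp by simp
  qed
  finally show ?thesis .
qed

lemma start_le_iff: "start k \<le> n \<longleftrightarrow> k + 1 \<le> s + n div l"
  unfolding start_def using l1 by (metis div_le_mono le_diff_conv less_eq_div_iff_mult_less_eq mult.commute add.commute One_nat_def Suc_le_eq)

lemma counts_at_start:
  assumes k: "1 \<le> k" and W: "W \<in> set_pmf (U (start k))"
  shows "counts W k = a k" "counts W (k + 1) = a k + b k"
proof -
  have "counts W k = a k \<and> counts W (k + 1) = a k + b k"
  proof (cases "k < s")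
    case True
    then have "W = urn0 s m" using W by (simp add: start_def)
    then show ?thesis using True k Mcount_urn0[of k] Mcount_urn0[of "k + 1"] m_incr[of k]
      by (simp add: counts_def a_def b_def)
  next
    case False
    define j where "j = k - s"
    have k_eq: "k = s + j" using False by (simp add: j_def)
    \<comment> \<open>The time just before the draw that is followed by the immigration of color
      \<open>k + 1\<close>; all balls then have colors up to \<open>k\<close>, so
      \<open>Mcount\<close> is the size of the urn.\<close>
    define n where "n = l * Suc j - 1"
    have Suc_n: "start k = Suc n" using l1 by (simp add: start_def k_eq n_def)
    have Suc_n': "Suc n = l * Suc j" using l1 by (simp add: n_def)
    have ndiv: "n div l = j"
      by (rule div_nat_eqI) (use l1 in \<open>simp_all add: n_def\<close>)
    from W[unfolded Suc_n] obtain W' c where W': "W' \<in> set_pmf (U n)" "c \<in> set_pmf (pmf_of_multiset W')"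
      and W: "W = add_mset c W' + (if l dvd Suc n then {# s + Suc n div l #} else {#})" by auto
    have c: "c \<in># W'" using W'(2) urn_support_nonempty[OF W'(1)] by simp
    have col: "\<And>c. c \<in># W' \<Longrightarrow> 1 \<le> c \<and> c \<le> k" and size: "size W' = m s + n + j"
      using urn_support[OF W'(1)] by (auto simp: ndiv k_eq)
    have "Mcount k W' = size W'" "Mcount (k + 1) W' = size W'"
      by (rule Mcount_eq_size; use col in force)+
    moreover have "W = add_mset (k + 1) (add_mset c W')" using W l1 unfolding Suc_n' by (simp add: k_eq)
    ultimately show ?thesis using col[OF c] Suc_n' l1 unfolding counts_def size
      by (simp add: a_def b_def k_eq)
  qed
  then show "counts W k = a k" "counts W (k + 1) = a k + b k" by auto
qed

lemma counts_ge_start: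
  assumes k: "1 \<le> k" and n: "start k \<le> n" and W: "W \<in> set_pmf (U n)"
  shows "a k + b k \<le> counts W (k + 1)"
  using n W
proof (induction n arbitrary: W rule: nat_induct_at_least)
  case base
  then show ?case using counts_at_start[OF k] by simp
next
  case (Suc n)
  then obtain W' c where "W' \<in> set_pmf (U n)"
    "W = add_mset c W' + (if l dvd Suc n then {# s + Suc n div l #} else {#})" by auto
  then show ?case using Suc.IH[of W'] by (auto simp: counts_def)
qed

text \<open>The conditional expectation of \<open>f\<close> given the counts from
  \<open>k + 1\<close> on, as \<open>expectation_resample\<close> confirms: since color
  \<open>k + 1\<close> appeared, the inner urn of colors up to \<open>k + 1\<close> has been drawn
  from \<open>v (k + 1) - (a k + b k)\<close> times.\<close>

definition resample :: "nat \<Rightarrow> ((nat \<Rightarrow> nat) \<Rightarrow> real) \<Rightarrow> (nat \<Rightarrow> nat) \<Rightarrow> real" where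
  "resample k f v = measure_pmf.expectation (polya (a k) (b k) (v (k + 1) - (a k + b k))) (\<lambda>i. f (v(k := i)))"

text \<open>The expectation after one draw, multiplied by the total. Colors up to \<open>k\<close>
  are merged, and multiplicities are differences of cumulative counts, so that it is again a
  function of the counts from \<open>k\<close> on.\<close>

definition draw :: "nat \<Rightarrow> nat \<Rightarrow> ((nat \<Rightarrow> nat) \<Rightarrow> real) \<Rightarrow> (nat \<Rightarrow> nat) \<Rightarrow> real" where
  "draw k R f v = real (v k) * f (bump k v) + (real (v (k + 1)) - real (v k)) * f (bump (k + 1) v)
     + (\<Sum>c=k+2..R. (real (v c) - real (v (c - 1))) * f (bump c v))"

lemma draw_counts:
  assumes k: "1 \<le> k" "k + 1 \<le> R" and f: "dep_from k f"
  shows "(\<Sum>c=1..R. real (count W c) * f (bump c (counts W))) = draw k R f (counts W)"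
proof -
  have cnt: "real (count W c) = real (counts W c) - real (counts W (c - 1))" if "1 \<le> c" for c
  proof -
    have "Mcount c W = Mcount (c - 1) W + count W c"
      using that by (cases c) (auto simp: Mcount_eq_sum)
    then show ?thesis by (simp add: counts_def)
  qed
  have "{1..R} = {1..k} \<union> {k+1} \<union> {k+2..R}" using k by auto
  then have "(\<Sum>c=1..R. real (count W c) * f (bump c (counts W)))
    = (\<Sum>c=1..k. real (count W c) * f (bump c (counts W))) + real (count W (k + 1)) * f (bump (k + 1) (counts W))
      + (\<Sum>c=k+2..R. real (count W c) * f (bump c (counts W)))"
    by (simp add: sum.union_disjoint)
  also have "(\<Sum>c=1..k. real (count W c) * f (bump c (counts W))) = (\<Sum>c=1..k. real (count W c) * f (bump k (counts W)))"
  proof (rule sum.cong)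
    fix c assume c: "c \<in> {1..k}"
    have "f (bump c (counts W)) = f (bump k (counts W))"
      by (rule dep_fromD[OF f]) (use c in \<open>simp add: bump_def\<close>)
    then show "real (count W c) * f (bump c (counts W)) = real (count W c) * f (bump k (counts W))" by simp
  qed simp
  also have "\<dots> = real (counts W k) * f (bump k (counts W))"
    by (simp add: counts_def Mcount_eq_sum sum_distrib_right)
  also have "(\<Sum>c=k+2..R. real (count W c) * f (bump c (counts W)))
     = (\<Sum>c=k+2..R. (real (counts W c) - real (counts W (c - 1))) * f (bump c (counts W)))"
    by (rule sum.cong) (simp_all add: cnt)
  finally show ?thesis using cnt[of "k + 1"] by (simp add: draw_def)
qed

lemma dep_from_draw: "dep_from k f \<Longrightarrow> dep_from k (draw k R f)"
  unfolding dep_from_def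
proof (intro allI impI)
  fix v v' :: "nat \<Rightarrow> nat"
  assume f: "\<forall>v v'. (\<forall>i\<ge>k. v i = v' i) \<longrightarrow> f v = f v'" and eq: "\<forall>i\<ge>k. v i = v' i"
  have "f (bump c v) = f (bump c v')" for c by (rule f[rule_format]) (simp add: bump_def eq)
  then show "draw k R f v = draw k R f v'"
    using eq by (auto simp: draw_def intro!: sum.cong)
qed

text \<open>Drawing and resampling intertwine. A drawn ball of color at most \<open>k + 1\<close>
  advances the clock of the inner urn by one, whichever of these colors it has, and the inner urn
  then makes exactly a Polya step; a ball of higher color leaves the inner urn alone.\<close>

lemma draw_resample:
  assumes v: "a k + b k \<le> v (k + 1)"
  shows "draw k R (resample k f) v = resample k (draw k R f) v"
proof -
  define t where "t = v (k + 1) - (a k + b k)"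
  define p where "p = polya (a k) (b k) t"
  have vk: "v (k + 1) = a k + b k + t" using v by (simp add: t_def)
  have int: "integrable (measure_pmf p) g" for g :: "nat \<Rightarrow> real"
    unfolding p_def polya_def by simp
  have r: "resample k g v = measure_pmf.expectation p (\<lambda>i. g (v(k := i)))" for g
    by (simp add: resample_def p_def t_def)
  \<comment> \<open>Resampling overwrites entry \<open>k\<close>, so it does not see whether the
    ball was of color \<open>k\<close> or of color \<open>k + 1\<close>.\<close>
  have rk: "resample k f (bump k v) = resample k f (bump (k + 1) v)"
  proof -
    have "(bump k v)(k := i) = (bump (k + 1) v)(k := i)" for i by (auto simp: bump_def)
    then show ?thesis by (simp add: resample_def bump_def)
  qed
  have rc: "resample k f (bump c v) = measure_pmf.expectation p (\<lambda>i. f (bump c (v(k := i))))" if "c \<ge> k + 2" for c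
  proof -
    have "(bump c v)(k := i) = bump c (v(k := i))" for i using that by (auto simp: bump_def)
    then show ?thesis using that by (simp add: resample_def p_def t_def bump_def)
  qed
  have first: "real (v (k + 1)) * resample k f (bump (k + 1) v)
    = measure_pmf.expectation p (\<lambda>i. real i * f (bump k (v(k := i))) + (real (v (k + 1)) - real i) * f (bump (k + 1) (v(k := i))))"
  proof -
    define H where "H i = f ((bump (k + 1) v)(k := i))" for i
    have H: "H i = f (bump (k + 1) (v(k := i)))" "H (Suc i) = f (bump k (v(k := i)))" for i
    proof -
      have "(bump (k + 1) v)(k := i) = bump (k + 1) (v(k := i))" "(bump (k + 1) v)(k := Suc i) = bump k (v(k := i))"
        by (auto simp: bump_def)
      then show "H i = f (bump (k + 1) (v(k := i)))" "H (Suc i) = f (bump k (v(k := i)))" by (simp_all add: H_def)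
    qed
    have "bump (k + 1) v (k + 1) - (a k + b k) = Suc t" using vk by (simp add: bump_def)
    then have "resample k f (bump (k + 1) v) = measure_pmf.expectation (polya (a k) (b k) (Suc t)) H"
      unfolding resample_def H_def by simp
    also have "\<dots> = measure_pmf.expectation p (step_op (real (v (k + 1))) H)"
      unfolding p_def polya_def vk by (rule expectation_chain_Suc) simp
    also have "real (v (k + 1)) * \<dots> = measure_pmf.expectation p (\<lambda>i. real (v (k + 1)) * step_op (real (v (k + 1))) H i)"
      by simp
    also have "\<dots> = measure_pmf.expectation p (\<lambda>i. real i * H (Suc i) + (real (v (k + 1)) - real i) * H i)"
    proof (rule expectation_cong_on_support)
      fix i assume i: "i \<in> set_pmf p"
      show "real (v (k + 1)) * step_op (real (v (k + 1))) H i = real i * H (Suc i) + (real (v (k + 1)) - real i) * H i"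
      proof (cases "v (k + 1) = 0")
        case True
        then have "i = 0" using i set_pmf_chain[of _ "a k" t] vk unfolding p_def polya_def by fastforce
        then show ?thesis using True by simp
      next
        case False
        then show ?thesis by (simp add: step_op_def distrib_left) (simp add: algebra_simps)
      qed
    qed
    finally show ?thesis unfolding H(2) unfolding H(1) .
  qed
  have "draw k R (resample k f) v = real (v (k + 1)) * resample k f (bump (k + 1) v)
     + (\<Sum>c=k+2..R. (real (v c) - real (v (c - 1))) * resample k f (bump c v))"
    unfolding draw_def rk by (simp add: left_diff_distrib)
  also have "(\<Sum>c=k+2..R. (real (v c) - real (v (c - 1))) * resample k f (bump c v))
    = measure_pmf.expectation p (\<lambda>i. \<Sum>c=k+2..R. (real (v c) - real (v (c - 1))) * f (bump c (v(k := i))))"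
    by (subst Bochner_Integration.integral_sum) (auto intro!: sum.cong int simp: rc)
  also have "real (v (k + 1)) * resample k f (bump (k + 1) v) + \<dots>
    = measure_pmf.expectation p (\<lambda>i. draw k R f (v(k := i)))"
    unfolding first
    by (subst Bochner_Integration.integral_add[symmetric])
       (auto intro!: int expectation_cong_on_support sum.cong simp: draw_def)
  finally show ?thesis unfolding r .
qed

text \<open>Given the counts of colors up to \<open>k + 1\<close>, the count up to \<open>k\<close> is distributed as in a classical Polya urn.\<close>

lemma expectation_resample:
  assumes k: "1 \<le> k" and n: "start k \<le> n" and f: "dep_from k f"
  shows "EU n (\<lambda>W. f (counts W)) = EU n (\<lambda>W. resample k f (counts W))"
  using n f
proof (induction n arbitrary: f rule: nat_induct_at_least)
  case base
  show ?case
  proof (rule expectation_cong_on_support)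
    fix W assume "W \<in> set_pmf (U (start k))"
    note c = counts_at_start[OF k this]
    have "(counts W)(k := a k) = counts W" using c by auto
    then show "f (counts W) = resample k f (counts W)" using c by (simp add: resample_def polya_def)
  qed
next
  case (Suc n)
  define R where "R = s + n div l"
  define T where "T = real (m s + n + n div l)"
  have kR: "k + 1 \<le> R" using Suc.hyps start_le_iff unfolding R_def by simp
  \<comment> \<open>The immigrating color lies above all colors present, in particular above
    \<open>k + 1\<close>; it changes neither entry \<open>k\<close> nor the clock of the inner
    urn.\<close>
  have imm_color: "l dvd Suc n \<Longrightarrow> R < s + Suc n div l" 
    unfolding R_def by (simp add: div_Suc dvd_eq_mod_eq_0)
  define f' where "f' v = f (immigrate n v)" for v
  have f': "dep_from k f'"
    unfolding dep_from_def f'_def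
    by (intro allI impI dep_fromD[OF Suc.prems]) (auto simp: immigrate_def bump_def)
  have step: "EU (Suc n) (\<lambda>W. g (counts W)) = EU n (\<lambda>W. draw k R (\<lambda>v. g (immigrate n v)) (counts W)) / T"
    if "dep_from k (\<lambda>v. g (immigrate n v))" for g
    unfolding expectation_urn_Suc using draw_counts[OF k kR that] by (simp add: R_def T_def)
  have rs: "resample k f (immigrate n v) = resample k f' v" for v
  proof -
    have "(immigrate n v)(k := i) = immigrate n (v(k := i))" for i
      using imm_color kR by (auto simp: immigrate_def bump_def)
    moreover have "immigrate n v (k + 1) = v (k + 1)"
      using imm_color kR by (auto simp: immigrate_def bump_def)
    ultimately show ?thesis unfolding resample_def f'_def by simp
  qed
  have rs_dep: "dep_from k (\<lambda>v. resample k f' v)"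
    unfolding dep_from_def
  proof (intro allI impI)
    fix v v' :: "nat \<Rightarrow> nat" assume eq: "\<forall>i\<ge>k. v i = v' i"
    have "f' (v(k := i)) = f' (v'(k := i))" for i by (rule dep_fromD[OF f']) (use eq in auto)
    then show "resample k f' v = resample k f' v'" using eq by (simp add: resample_def)
  qed
  have "EU (Suc n) (\<lambda>W. f (counts W)) = EU n (\<lambda>W. draw k R f' (counts W)) / T"
    using step[of f] f' unfolding f'_def by simp
  \<comment> \<open>The induction hypothesis is applied to the function after the draw, and the
    intertwining relation then moves the resampling inside the draw.\<close>
  also have "EU n (\<lambda>W. draw k R f' (counts W)) = EU n (\<lambda>W. resample k (draw k R f') (counts W))"
    by (rule Suc.IH) (rule dep_from_draw[OF f'])
  also have "\<dots> = EU n (\<lambda>W. draw k R (resample k f') (counts W))"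
    by (rule expectation_cong_on_support)
       (use draw_resample[of k] counts_ge_start[OF k Suc.hyps] in auto)
  also have "\<dots> / T = EU (Suc n) (\<lambda>W. resample k f (counts W))"
    using step[of "resample k f"] rs_dep unfolding rs by simp
  finally show ?case .
qed

text \<open>Colors up to \<open>r\<close> are hit in proportion to their joint count, and after
  \<open>start r\<close> all immigrants have higher colors; so the count is a birth chain, with the
  totals of \<open>immigration\<close>.\<close>

lemma expectation_top_count:
  assumes r: "s \<le> r"
  shows "EU (start r + n) (\<lambda>W. H (counts W r)) = measure_pmf.expectation (chain (\<lambda>i. a r + 1 + i + i div l) (a r) n) H"
proof (induction n arbitrary: H)
  case 0
  have "EU (start r) (\<lambda>W. H (counts W r)) = EU (start r) (\<lambda>W. H (a r))"
    by (rule expectation_cong_on_support) (use counts_at_start[of r] r s1 in auto)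
  then show ?case by simp
next
  case (Suc n)
  define N where "N = start r + n"
  define R where "R = s + N div l"
  define T where "T = a r + 1 + n + n div l"
  have start: "start r = l * (r + 1 - s)" by (simp add: start_def)
  have Ndiv: "N div l = (r + 1 - s) + n div l" using l1 by (simp add: N_def start)
  have rR: "r \<le> R" using r by (simp add: R_def Ndiv)
  have T_eq: "m s + N + N div l = T"
  proof -
    obtain j where "r = s + j" using r le_Suc_ex by blast
    then show ?thesis unfolding Ndiv T_def by (simp add: N_def start_def a_def algebra_simps)
  qed
  have imm: "immigrate N v r = v r" for v
    using r by (auto simp: immigrate_def bump_def div_Suc dvd_eq_mod_eq_0 Ndiv)
  have "EU (Suc N) (\<lambda>W. H (counts W r)) = EU N (\<lambda>W. step_op (real T) H (counts W r))"
    unfolding expectation_urn_Suc[where f="\<lambda>v. H (v r)"]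
  proof (rule expectation_cong_on_support)
    fix W assume W: "W \<in> set_pmf (U N)"
    have supp: "size W = T" "\<And>c. c \<in># W \<Longrightarrow> 1 \<le> c \<and> c \<le> R"
      using urn_support[OF W] by (auto simp: T_eq R_def)
    have tot: "(\<Sum>c=1..R. real (count W c)) = real T"
      using Mcount_eq_size[of W R] supp Mcount_eq_sum[of R W] by (simp add: of_nat_sum[symmetric] del: of_nat_sum)
    have low: "(\<Sum>c=1..r. real (count W c)) = real (counts W r)"
      by (simp add: counts_def Mcount_eq_sum)
    let ?x = "counts W r"
    have split: "(\<Sum>c=1..R. f c) = (\<Sum>c=1..r. f c) + (\<Sum>c=r+1..R. f c)" for f :: "nat \<Rightarrow> real"
    proof -
      have "{1..R} = {1..r} \<union> {r+1..R}" using rR by auto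
      then show ?thesis by (simp add: sum.union_disjoint)
    qed
    have "(\<Sum>c=1..R. real (count W c) * H (immigrate N (bump c (counts W)) r))
      = (\<Sum>c=1..r. real (count W c) * H (Suc ?x)) + (\<Sum>c=r+1..R. real (count W c) * H ?x)"
      unfolding imm split by (intro arg_cong2[where f="(+)"] sum.cong) (auto simp: bump_def)
    also have "\<dots> = real ?x * H (Suc ?x) + (real T - real ?x) * H ?x"
      using low tot split[of "\<lambda>c. real (count W c)"] by (simp add: sum_distrib_right[symmetric])
    finally show "(\<Sum>c=1..s + N div l. real (count W c) * H (immigrate N (bump c (counts W)) r)) / real (m s + N + N div l)
      = step_op (real T) H ?x"
      unfolding T_eq R_def[symmetric] by (simp add: step_op_def T_def field_simps)
  qed
  also have "\<dots> = measure_pmf.expectation (chain (\<lambda>i. a r + 1 + i + i div l) (a r) n) (step_op (real T) H)"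
    unfolding N_def by (rule Suc.IH)
  also have "\<dots> = measure_pmf.expectation (chain (\<lambda>i. a r + 1 + i + i div l) (a r) (Suc n)) H"
    unfolding T_def by (rule expectation_chain_Suc[symmetric]) simp
  finally show ?case by (simp add: N_def)
qed

end

subsection \<open>Replacing Polya steps by beta variables\<close>

text \<open>Functions of bounded variation along every affine line: the convexity of a set enters the
  argument only through this property of its indicator.\<close>

definition line_variation_le :: "real \<Rightarrow> ((nat \<Rightarrow> real) \<Rightarrow> real) \<Rightarrow> bool" where
  "line_variation_le V f \<longleftrightarrow> (\<forall>u d. variation_le (\<lambda>x. f (\<lambda>i. u i + x * d i)) V)"

lemma line_variationD: "line_variation_le V f \<Longrightarrow> variation_le (\<lambda>x. f (\<lambda>i. u i + x * d i)) V"
  by (simp add: line_variation_le_def)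

lemma line_variation_upd:
  assumes "line_variation_le V f"
  shows "variation_le (\<lambda>x. f (v(k := x * c))) V"
proof -
  have "v(k := x * c) = (\<lambda>i. (v(k := 0)) i + x * ((\<lambda>_. 0)(k := c)) i)" for x by auto
  then show ?thesis using line_variationD[OF assms, of "v(k := 0)" "(\<lambda>_. 0)(k := c)"] by simp
qed

text \<open>Entry \<open>k\<close> becomes a random multiple of entry \<open>k + 1\<close>, then
  entry \<open>k - 1\<close> a random multiple of the new entry \<open>k\<close>, and so on: the
  limit vector is generated downwards by nested integrals, in the same order as the Polya steps, and
  without a product measure.\<close>

primrec integrate_down :: "(nat \<Rightarrow> real measure) \<Rightarrow> ((nat \<Rightarrow> real) \<Rightarrow> real) \<Rightarrow> nat \<Rightarrow> (nat \<Rightarrow> real) \<Rightarrow> real" where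
  "integrate_down L f 0 v = f v"
| "integrate_down L f (Suc k) v = (\<integral>b. integrate_down L f k (v(Suc k := b * v (Suc (Suc k)))) \<partial>L (Suc k))"

text \<open>Replacing one entry by \<open>b\<close> times another is linear, so affine lines go to
  affine lines. For every \<open>b\<close> the variation is then at most \<open>V\<close>, and
  averaging over a probability law keeps that bound.\<close>

lemma integrate_down_line_variation:
  assumes f: "line_variation_le V f" "\<And>v. 0 \<le> f v \<and> f v \<le> 1"
    and L: "\<And>j. 1 \<le> j \<Longrightarrow> j \<le> k \<Longrightarrow> prob_space (L j) \<and> sets (L j) = sets borel"
  shows "line_variation_le V (integrate_down L f k) \<and> (\<forall>v. 0 \<le> integrate_down L f k v \<and> integrate_down L f k v \<le> 1)"
  using L
proof (induction k)
  case 0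
  then show ?case using f by (simp add: fun_eq_iff[of "integrate_down L f 0" f, simplified] line_variation_le_def)
next
  case (Suc k)
  let ?F = "integrate_down L f k"
  have IH: "line_variation_le V ?F" "\<And>v. 0 \<le> ?F v" "\<And>v. ?F v \<le> 1" using Suc by auto
  interpret prob_space "L (Suc k)" using Suc.prems[of "Suc k"] by simp
  have sets [measurable_cong]: "sets (L (Suc k)) = sets borel" using Suc.prems[of "Suc k"] by simp
  have meas: "(\<lambda>b. ?F (v(Suc k := b * c))) \<in> borel_measurable (L (Suc k))" for v c
    using variation_le_borel_measurable[OF line_variation_upd[OF IH(1)], of v "Suc k" c]
    by (simp add: measurable_def sets sets_eq_imp_space_eq[OF sets])
  have int: "integrable (L (Suc k)) (\<lambda>b. ?F (v(Suc k := b * c)))" for v c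
    by (rule integrable_const_bound[where B=1]) (use IH meas in auto)
  have bounds: "0 \<le> integrate_down L f (Suc k) v \<and> integrate_down L f (Suc k) v \<le> 1" for v
  proof
    show "0 \<le> integrate_down L f (Suc k) v" using IH by simp
    have "integrate_down L f (Suc k) v \<le> (\<integral>b. 1 \<partial>L (Suc k))"
      unfolding integrate_down.simps by (intro integral_mono int) (use IH in auto)
    then show "integrate_down L f (Suc k) v \<le> 1" using prob_space by simp
  qed
  moreover have "line_variation_le V (integrate_down L f (Suc k))"
    unfolding line_variation_le_def variation_le_def
  proof (intro allI impI)
    fix u d :: "nat \<Rightarrow> real" and t :: "nat \<Rightarrow> real" and n :: nat
    assume t: "mono t"
    define p where "p x = (\<lambda>i. u i + x * d i)" for x
    have line: "(p x)(Suc k := b * p x (Suc (Suc k)))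
      = (\<lambda>i. (u(Suc k := b * u (Suc (Suc k)))) i + x * (d(Suc k := b * d (Suc (Suc k)))) i)" for b x
      by (auto simp: p_def algebra_simps)
    define h where "h b x = ?F ((p x)(Suc k := b * p x (Suc (Suc k))))" for b x
    have h_int: "integrable (L (Suc k)) (\<lambda>b. h b x)" for x unfolding h_def by (rule int)
    have "(\<Sum>i<n. \<bar>(\<integral>b. h b (t (Suc i)) \<partial>L (Suc k)) - (\<integral>b. h b (t i) \<partial>L (Suc k))\<bar>)
       \<le> (\<Sum>i<n. \<integral>b. \<bar>h b (t (Suc i)) - h b (t i)\<bar> \<partial>L (Suc k))"
    proof (rule sum_mono)
      fix i
      show "\<bar>(\<integral>b. h b (t (Suc i)) \<partial>L (Suc k)) - (\<integral>b. h b (t i) \<partial>L (Suc k))\<bar> \<le> (\<integral>b. \<bar>h b (t (Suc i)) - h b (t i)\<bar> \<partial>L (Suc k))"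
        by (subst Bochner_Integration.integral_diff[symmetric, OF h_int h_int]) (rule integral_abs_bound)
    qed
    also have "\<dots> = (\<integral>b. (\<Sum>i<n. \<bar>h b (t (Suc i)) - h b (t i)\<bar>) \<partial>L (Suc k))"
      by (rule Bochner_Integration.integral_sum[symmetric]) (intro integrable_abs Bochner_Integration.integrable_diff h_int)
    also have "\<dots> \<le> (\<integral>b. V \<partial>L (Suc k))"
    proof (intro integral_mono)
      show "(\<Sum>i<n. \<bar>h b (t (Suc i)) - h b (t i)\<bar>) \<le> V" for b
        using variation_leD[OF line_variationD[OF IH(1)] t] unfolding h_def line .
    qed (auto intro!: integrable_sum integrable_abs Bochner_Integration.integrable_diff h_int)
    also have "\<dots> = V" using prob_space by simp
    finally show "(\<Sum>i<n. \<bar>integrate_down L f (Suc k) (\<lambda>j. u j + t (Suc i) * d j) - integrate_down L f (Suc k) (\<lambda>j. u j + t i * d j)\<bar>) \<le> V"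
      by (simp add: h_def p_def)
  qed
  ultimately show ?case by blast
qed

text \<open>All entries up to \<open>k\<close> are overwritten before \<open>f\<close> is evaluated.
  For \<open>k = r - 1\<close> only entry \<open>r\<close> is left, which reduces the last
  comparison to one dimension.\<close>

lemma integrate_down_cong:
  assumes f: "\<And>v v'. (\<And>i. 1 \<le> i \<Longrightarrow> i \<le> r \<Longrightarrow> v i = v' i) \<Longrightarrow> f v = f v'"
    and k: "k < r" and eq: "\<And>i. k < i \<Longrightarrow> i \<le> r \<Longrightarrow> v i = v' i"
  shows "integrate_down L f k v = integrate_down L f k v'"
  using k eq
proof (induction k arbitrary: v v')
  case 0
  then show ?case using f[of v v'] by simp
next
  case (Suc k)
  have "integrate_down L f k (v(Suc k := b * v (Suc (Suc k)))) = integrate_down L f k (v'(Suc k := b * v' (Suc (Suc k))))" for b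
    using Suc.prems by (intro Suc.IH) auto
  then show ?case by simp
qed

text \<open>An interval is a difference of two upper sets, its up-closure and the part of that
  beyond the interval; each contributes variation at most 1.\<close>

lemma variation_le_convex_indicator:
  assumes I: "\<And>x y z. x \<in> I \<Longrightarrow> z \<in> I \<Longrightarrow> x \<le> y \<Longrightarrow> y \<le> z \<Longrightarrow> y \<in> I"
  shows "variation_le (indicator I :: real \<Rightarrow> real) 2"
  unfolding variation_le_def
proof (intro allI impI)
  fix t :: "nat \<Rightarrow> real" and n :: nat assume t: "mono t"
  define A where "A = {y. \<exists>x\<in>I. x \<le> y}"
  have mono_bound: "(\<Sum>i<n. \<bar>indicator S (t (Suc i)) - indicator S (t i) :: real\<bar>) \<le> 1"
    if "\<And>x y. x \<in> S \<Longrightarrow> x \<le> y \<Longrightarrow> y \<in> S" for S :: "real set"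
  proof -
    have "indicator S (t i) \<le> (indicator S (t (Suc i)) :: real)" for i
      using that[of "t i" "t (Suc i)"] monoD[OF t, of i "Suc i"] by (auto split: split_indicator)
    then have "(\<Sum>i<n. \<bar>indicator S (t (Suc i)) - indicator S (t i) :: real\<bar>) = (\<Sum>i<n. indicator S (t (Suc i)) - indicator S (t i))"
      by (intro sum.cong) auto
    also have "\<dots> = indicator S (t n) - indicator S (t 0)" by (rule sum_lessThan_telescope)
    also have "\<dots> \<le> 1" by (auto split: split_indicator)
    finally show ?thesis .
  qed
  have "I \<subseteq> A" by (auto simp: A_def)
  then have split: "indicator I x = indicator A x - (indicator (A - I) x :: real)" for x
    by (auto split: split_indicator)
  have "(\<Sum>i<n. \<bar>indicator I (t (Suc i)) - indicator I (t i) :: real\<bar>)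
    \<le> (\<Sum>i<n. \<bar>indicator A (t (Suc i)) - indicator A (t i)\<bar> + \<bar>indicator (A - I) (t (Suc i)) - indicator (A - I) (t i)\<bar>)"
    unfolding split by (intro sum_mono) linarith
  also have "\<dots> \<le> 1 + 1"
    unfolding sum.distrib
  proof (intro add_mono mono_bound)
    show "y \<in> A" if "x \<in> A" "x \<le> y" for x y using that unfolding A_def by (blast intro: order_trans)
    show "y \<in> A - I" if "x \<in> A - I" "x \<le> y" for x y
    proof -
      from that obtain z where z: "z \<in> I" "z \<le> x" "x \<notin> I" by (auto simp: A_def)
      have "y \<notin> I" using I[OF z(1) _ z(2), of y] that z by auto
      moreover have "y \<in> A" using z that unfolding A_def by (blast intro: order_trans)
      ultimately show ?thesis by simp
    qed
  qed
  finally show "(\<Sum>i<n. \<bar>indicator I (t (Suc i)) - indicator I (t i) :: real\<bar>) \<le> 2" by simp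
qed

text \<open>The restriction extends the indicator to all sequences, so that affine lines need not
  respect the extensional representation of vectors.\<close>

definition restricted_indicator :: "nat \<Rightarrow> (nat \<Rightarrow> real) set \<Rightarrow> (nat \<Rightarrow> real) \<Rightarrow> real" where
  "restricted_indicator r K v = indicator K (restrict v {1..r})"

lemma line_variation_convex:
  assumes "convex_fun K"
  shows "line_variation_le 2 (restricted_indicator r K)"
  unfolding line_variation_le_def
proof (intro allI)
  fix u d :: "nat \<Rightarrow> real"
  define p where "p x = restrict (\<lambda>i. u i + x * d i) {1..r}" for x
  have "variation_le (indicator {x. p x \<in> K} :: real \<Rightarrow> real) 2"
  proof (rule variation_le_convex_indicator)
    fix x y z :: real assume *: "x \<in> {x. p x \<in> K}" "z \<in> {x. p x \<in> K}" "x \<le> y" "y \<le> z"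
    show "y \<in> {x. p x \<in> K}"
    proof (cases "x = z")
      case False
      define th where "th = (y - x) / (z - x)"
      have th: "0 \<le> th" "th \<le> 1" using * False by (auto simp: th_def)
      have y: "y = (1 - th) * x + th * z"
      proof -
        have "th * (z - x) = y - x" using False by (simp add: th_def)
        then show ?thesis by (simp add: algebra_simps)
      qed
      have "(\<lambda>k. (1 - th) * p x k + th * p z k) \<in> K"
        using assms * th unfolding convex_fun_def by blast
      moreover have "(\<lambda>k. (1 - th) * p x k + th * p z k) = p y"
        unfolding p_def y by (auto simp: fun_eq_iff algebra_simps)
      ultimately show ?thesis by simp
    qed (use * in auto)
  qed
  moreover have "indicator {x. p x \<in> K} = (\<lambda>x. restricted_indicator r K (\<lambda>i. u i + x * d i))"
    by (auto simp: restricted_indicator_def p_def fun_eq_iff split: split_indicator)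
  ultimately show "variation_le (\<lambda>x. restricted_indicator r K (\<lambda>i. u i + x * d i)) 2" by simp
qed

text \<open>The eigenvalue product telescopes. Consequently an error of the form constant over count
  minus one, averaged over a Polya step, has the same form one level higher.\<close>

lemma polya_inverse_moment:
  assumes "2 \<le> a"
  shows "measure_pmf.expectation (polya a b t) (\<lambda>i. 1 / (real i - 1))
    = (real a + real b - 1) / ((real a - 1) * (real a + real b + real t - 1))"
proof -
  have "(\<Prod>i<t. 1 - 1 / real (a + b + i)) = (real a + real b - 1) / (real a + real b + real t - 1)"
    using assms by (induction t) (simp_all add: divide_simps)
  then show ?thesis
    unfolding polya_def using assms by (subst expectation_chain_inverse) auto
qed

lemma polya_beta_kolmogorov:
  assumes "1 \<le> a" "1 \<le> b"
  shows "\<exists>C\<ge>0. \<forall>t y. \<bar>measure_pmf.prob (polya a b t) {i. real i \<le> y * real (a + b + t)}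
     - measure (prop_density (beta_weight a b)) {..y}\<bar> \<le> C / real (a + b + t)"
proof -
  obtain a' b' where "a = Suc a'" "b = Suc b'" using assms by (metis Suc_le_D One_nat_def)
  then show ?thesis using polya_beta_kolmogorov_Suc[of a' b'] by (simp add: algebra_simps)
qed

lemma polya_beta_integral:
  assumes "1 \<le> a" "1 \<le> b"
  shows "\<exists>C\<ge>0. \<forall>t h. variation_le h 2 \<and> (\<forall>x. 0 \<le> h x \<and> h x \<le> 1) \<longrightarrow>
     \<bar>measure_pmf.expectation (polya a b t) (\<lambda>i. h (real i / real (a + b + t)))
     - (\<integral>x. h x \<partial>prop_density (beta_weight a b))\<bar> \<le> C / real (a + b + t)"
proof -
  interpret beta: proportional_density "beta_weight a b"
    by (rule proportional_density_beta)
  obtain C where C: "C \<ge> 0" "\<And>t y. \<bar>measure_pmf.prob (polya a b t) {i. real i \<le> y * real (a + b + t)}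
     - measure (prop_density (beta_weight a b)) {..y}\<bar> \<le> C / real (a + b + t)"
    using polya_beta_kolmogorov[OF assms] by blast
  have "\<bar>measure_pmf.expectation (polya a b t) (\<lambda>i. h (real i / real (a + b + t)))
     - (\<integral>x. h x \<partial>prop_density (beta_weight a b))\<bar> \<le> (5 * C) / real (a + b + t)"
    if h: "variation_le h 2" "\<And>x. 0 \<le> h x \<and> h x \<le> 1" for t h
  proof -
    let ?j = "real (a + b + t)"
    have j: "?j > 0" using assms by simp
    let ?M = "distr (measure_pmf (polya a b t)) borel (\<lambda>i. real i / ?j)"
    interpret kolmogorov_close ?M "prop_density (beta_weight a b)" "C / ?j"
    proof (intro kolmogorov_close.intro kolmogorov_close_axioms.intro)
      show "prob_space ?M" by (rule measure_pmf.prob_space_distr) simp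
      show "prob_space (prop_density (beta_weight a b))" by (rule beta.prob_space_axioms)
      fix y
      have "measure ?M {..y} = measure_pmf.prob (polya a b t) {i. real i \<le> y * ?j}"
        using j by (subst measure_distr) (auto simp: vimage_def pos_divide_le_eq)
      then show "\<bar>measure ?M {..y} - measure (prop_density (beta_weight a b)) {..y}\<bar> \<le> C / ?j"
        using C(2)[of t y] by simp
    qed simp_all
    have "\<bar>(\<integral>x. h x \<partial>?M) - (\<integral>x. h x \<partial>prop_density (beta_weight a b))\<bar> \<le> (2 * 2 + 1) * (C / ?j)"
      by (rule integral_variation_close) (use h in auto)
    moreover have "(\<integral>x. h x \<partial>?M) = measure_pmf.expectation (polya a b t) (\<lambda>i. h (real i / ?j))"
      using variation_le_borel_measurable[OF h(1)] by (subst integral_distr) auto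
    ultimately show ?thesis by simp
  qed
  then show ?thesis using C(1) by (intro exI[of _ "5 * C"]) auto
qed

context urn_model
begin

primrec resample_down :: "((nat \<Rightarrow> nat) \<Rightarrow> real) \<Rightarrow> nat \<Rightarrow> (nat \<Rightarrow> nat) \<Rightarrow> real" where
  "resample_down f 0 = f"
| "resample_down f (Suc k) = resample (Suc k) (resample_down f k)"

lemma dep_from_resample:
  assumes "dep_from k f"
  shows "dep_from (Suc k) (resample k f)"
  unfolding dep_from_def
proof (intro allI impI)
  fix v v' :: "nat \<Rightarrow> nat" assume eq: "\<forall>i\<ge>Suc k. v i = v' i"
  have "f (v(k := i)) = f (v'(k := i))" for i
  proof (rule dep_fromD[OF assms])
    fix j assume "k \<le> j"
    then show "(v(k := i)) j = (v'(k := i)) j" using eq by (cases "j = k") auto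
  qed
  then show "resample k f v = resample k f v'" using eq by (simp add: resample_def)
qed

lemma dep_from_resample_down: "dep_from 1 f \<Longrightarrow> dep_from (Suc k) (resample_down f k)"
  by (induction k) (auto intro: dep_from_resample)

lemma start_mono: "j \<le> k \<Longrightarrow> start j \<le> start k"
  unfolding start_def by (intro mult_le_mono2 diff_le_mono) simp

lemma expectation_resample_down:
  assumes f: "dep_from 1 f" and n: "start k \<le> n"
  shows "EU n (\<lambda>W. f (counts W)) = EU n (\<lambda>W. resample_down f k (counts W))"
  using n
proof (induction k)
  case (Suc k)
  then have "EU n (\<lambda>W. f (counts W)) = EU n (\<lambda>W. resample_down f k (counts W))"
    using start_mono[of k "Suc k"] by simp
  also have "\<dots> = EU n (\<lambda>W. resample (Suc k) (resample_down f k) (counts W))"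
    by (rule expectation_resample) (use Suc.prems dep_from_resample_down[OF f] in auto)
  finally show ?case by simp
qed simp

text \<open>Counts do not decrease between the entrances of colors \<open>k + 1\<close> and
  \<open>k + 2\<close>. A count sampled at level \<open>k + 1\<close> is thereby large enough for
  the Polya urn at level \<open>k\<close>.\<close>

lemma a_Suc_ge: "1 \<le> k \<Longrightarrow> a k + b k \<le> a (k + 1)"
proof -
  assume k: "1 \<le> k"
  consider "k + 1 < s" | "k + 1 = s" | "s \<le> k" by linarith
  then show ?thesis
  proof cases
    case 3
    then obtain j where "k = s + j" using le_Suc_ex by blast
    then show ?thesis by (simp add: a_def b_def algebra_simps)
  qed (use m_incr[of k] k in \<open>auto simp: a_def b_def\<close>)
qed

text \<open>Induction over the levels. The inherited error is averaged over the Polya law and keeps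
  its form by \<open>polya_inverse_moment\<close>; the new error is a one-dimensional comparison of
  that law with its beta limit, the test function being a section of
  \<open>integrate_down L f k\<close>.\<close>

lemma resample_integrate_close:
  assumes L: "\<And>j. 1 \<le> j \<Longrightarrow> j \<le> k \<Longrightarrow> L j = prop_density (beta_weight (a j) (b j))"
  shows "\<exists>C\<ge>0. \<forall>f c v. line_variation_le 2 f \<and> (\<forall>v. 0 \<le> f v \<and> f v \<le> 1) \<and> (1 \<le> k \<longrightarrow> a k + b k \<le> v (k + 1)) \<longrightarrow>
    \<bar>resample_down (\<lambda>v. f (\<lambda>i. c * real (v i))) k v - integrate_down L f k (\<lambda>i. c * real (v i))\<bar> \<le> C / (real (v (k + 1)) - 1)"
  using L
proof (induction k)
  case 0
  then show ?case by (intro exI[of _ 0]) simp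
next
  case (Suc k)
  obtain C where C: "C \<ge> 0" "\<And>f c v. line_variation_le 2 f \<Longrightarrow> (\<And>v. 0 \<le> f v \<and> f v \<le> 1) \<Longrightarrow> (1 \<le> k \<Longrightarrow> a k + b k \<le> v (k + 1)) \<Longrightarrow>
    \<bar>resample_down (\<lambda>v. f (\<lambda>i. c * real (v i))) k v - integrate_down L f k (\<lambda>i. c * real (v i))\<bar> \<le> C / (real (v (k + 1)) - 1)"
    using Suc.IH Suc.prems by (metis le_SucI)
  define A B where "A = a (Suc k)" and "B = b (Suc k)"
  have AB: "1 \<le> A" "1 \<le> B" "Suc k \<le> A" using a_ge[of "Suc k"] b_ge[of "Suc k"] by (auto simp: A_def B_def)
  have LSuc: "L (Suc k) = prop_density (beta_weight A B)" using Suc.prems[of "Suc k"] by (simp add: A_def B_def)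
  obtain C' where C': "C' \<ge> 0" "\<And>t h. variation_le h 2 \<Longrightarrow> (\<And>x. 0 \<le> h x \<and> h x \<le> 1) \<Longrightarrow>
     \<bar>measure_pmf.expectation (polya A B t) (\<lambda>i. h (real i / real (A + B + t)))
     - (\<integral>x. h x \<partial>prop_density (beta_weight A B))\<bar> \<le> C' / real (A + B + t)"
    using polya_beta_integral[OF AB(1,2)] by blast
  \<comment> \<open>At the lowest level nothing is inherited, and \<open>A\<close> may be 1; on all
    higher levels \<open>A \<ge> Suc k \<ge> 2\<close>, so the quotient makes sense.\<close>
  define C1 where "C1 = (if k = 0 then 0 else C * (real A + real B - 1) / (real A - 1))"
  have C1: "C1 \<ge> 0" using C(1) AB by (auto simp: C1_def)
  have LL: "prob_space (L j) \<and> sets (L j) = sets borel" if "1 \<le> j" "j \<le> k" for j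
    using Suc.prems[of j] that proportional_density.sets_prop_density[OF proportional_density_beta]
      proportional_density.prob_space_prop_density[OF proportional_density_beta] by simp
  have "\<bar>resample_down (\<lambda>v. f (\<lambda>i. c * real (v i))) (Suc k) v - integrate_down L f (Suc k) (\<lambda>i. c * real (v i))\<bar>
      \<le> (C1 + C') / (real (v (Suc k + 1)) - 1)"
    if f: "line_variation_le 2 f" "\<And>v. 0 \<le> f v \<and> f v \<le> 1" and v: "A + B \<le> v (Suc k + 1)" for f c v
  proof -
    define j where "j = v (Suc (Suc k))"
    define t where "t = j - (A + B)"
    have jt: "j = A + B + t" using v by (simp add: t_def j_def)
    have j2: "real j - 1 > 0" "real j > 0" using jt AB by auto
    let ?p = "polya A B t"
    let ?R = "resample_down (\<lambda>v. f (\<lambda>i. c * real (v i))) k"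
    let ?I = "integrate_down L f k"
    let ?e = "\<lambda>v i. c * real (v i)"
    have int: "integrable (measure_pmf ?p) g" for g :: "nat \<Rightarrow> real" unfolding polya_def by simp
    have R_eq: "resample_down (\<lambda>v. f (\<lambda>i. c * real (v i))) (Suc k) v = measure_pmf.expectation ?p (\<lambda>i. ?R (v(Suc k := i)))"
      by (simp add: resample_def A_def B_def t_def j_def)
    have supp: "A \<le> i" if "i \<in> set_pmf ?p" for i
      using subsetD[OF set_pmf_chain that[unfolded polya_def]] by auto
    have part1: "\<bar>measure_pmf.expectation ?p (\<lambda>i. ?R (v(Suc k := i))) - measure_pmf.expectation ?p (\<lambda>i. ?I (?e (v(Suc k := i))))\<bar>
       \<le> C1 / (real j - 1)"
    proof (cases "k = 0")
      case True
      then show ?thesis by (simp add: C1_def)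
    next
      case False
      have "\<bar>measure_pmf.expectation ?p (\<lambda>i. ?R (v(Suc k := i))) - measure_pmf.expectation ?p (\<lambda>i. ?I (?e (v(Suc k := i))))\<bar>
        \<le> measure_pmf.expectation ?p (\<lambda>i. \<bar>?R (v(Suc k := i)) - ?I (?e (v(Suc k := i)))\<bar>)"
        by (subst Bochner_Integration.integral_diff[symmetric, OF int int]) (rule integral_abs_bound)
      also have "\<dots> \<le> measure_pmf.expectation ?p (\<lambda>i. C * (1 / (real i - 1)))"
      proof (rule expectation_mono_on_support)
        fix i assume i: "i \<in> set_pmf ?p"
        have "a k + b k \<le> i" if "1 \<le> k" using a_Suc_ge[OF that] supp[OF i] by (simp add: A_def)
        then show "\<bar>?R (v(Suc k := i)) - ?I (?e (v(Suc k := i)))\<bar> \<le> C * (1 / (real i - 1))"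
          using C(2)[OF f, of "v(Suc k := i)" c] by simp
      qed (simp add: polya_def)
      also have "\<dots> = C * ((real A + real B - 1) / ((real A - 1) * (real A + real B + real t - 1)))"
        unfolding integral_mult_right_zero using polya_inverse_moment[of A B t] AB(3) False by simp
      also have "\<dots> = C1 / (real j - 1)"
        using False by (simp add: C1_def jt)
      finally show ?thesis .
    qed
    define h where "h x = ?I ((?e v)(Suc k := x * (c * real j)))" for x
    have line: "line_variation_le 2 ?I" "\<And>v. 0 \<le> ?I v \<and> ?I v \<le> 1"
      using integrate_down_line_variation[OF f LL] by auto
    have "\<bar>measure_pmf.expectation ?p (\<lambda>i. h (real i / real (A + B + t))) - (\<integral>x. h x \<partial>prop_density (beta_weight A B))\<bar> \<le> C' / real (A + B + t)"
      by (rule C'(2)) (use line line_variation_upd[OF line(1)] in \<open>auto simp: h_def\<close>)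
    moreover have "h (real i / real (A + B + t)) = ?I (?e (v(Suc k := i)))" for i
    proof -
      have "(?e v)(Suc k := real i / real (A + B + t) * (c * real j)) = ?e (v(Suc k := i))"
        using j2 unfolding jt[symmetric] by auto
      then show ?thesis by (simp add: h_def)
    qed
    moreover have "(\<integral>x. h x \<partial>prop_density (beta_weight A B)) = integrate_down L f (Suc k) (?e v)"
      by (simp add: h_def LSuc j_def)
    moreover have "C' / real (A + B + t) \<le> C' / (real j - 1)"
      using C'(1) j2 unfolding jt[symmetric] by (intro divide_left_mono) auto
    ultimately have "\<bar>measure_pmf.expectation ?p (\<lambda>i. ?I (?e (v(Suc k := i)))) - integrate_down L f (Suc k) (?e v)\<bar> \<le> C' / (real j - 1)"
      by simp
    then show ?thesis unfolding R_eq using part1 by (simp add: j_def add_divide_distrib)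
  qed
  then show ?case using C1 C'(1) unfolding A_def B_def by (intro exI[of _ "C1 + C'"]) auto
qed

end

subsection \<open>Convex sets under the limit law\<close>

locale continuous_laws =
  fixes L :: "nat \<Rightarrow> real measure" and r :: nat
  assumes prob_L: "\<And>k. prob_space (L k)"
    and sets_L [measurable_cong, simp]: "\<And>k. sets (L k) = sets borel"
    and null_singleton: "\<And>k x. {x} \<in> null_sets (L k)"
begin

sublocale P: product_prob_space L UNIV
  by (intro product_prob_space.intro product_sigma_finite.intro product_prob_space_axioms.intro
      prob_L prob_space_imp_sigma_finite)

lemma space_L [simp]: "space (L k) = UNIV"
  using sets_eq_imp_space_eq[OF sets_L] by simp

abbreviation Bor :: "nat set \<Rightarrow> (nat \<Rightarrow> real) measure" where "Bor I \<equiv> PiM I (\<lambda>_. borel)"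

lemma sets_PiM_L [measurable_cong, simp]: "sets (PiM I L) = sets (Bor I)"
  by (rule sets_PiM_cong) auto

lemma space_PiM_L [simp]: "space (PiM I L) = PiE I (\<lambda>_. UNIV)"
  by (simp add: space_PiM)

lemma finite_null: "finite S \<Longrightarrow> emeasure (L k) S = 0"
proof -
  assume "finite S"
  then have "(\<Union>x\<in>S. {x}) \<in> null_sets (L k)" by (intro null_sets_UN' countable_finite null_singleton)
  then show ?thesis by (simp add: null_sets_def)
qed

text \<open>The coordinates from \<open>k\<close> on of the limit vector, with the top variable as
  last factor; the freedom in \<open>k\<close> serves the induction on the dimension.\<close>

definition tails :: "nat \<Rightarrow> (nat \<Rightarrow> real) \<Rightarrow> nat \<Rightarrow> real" where
  "tails k \<eta> = (\<lambda>i\<in>{k..r}. \<Prod>j=i..r. \<eta> j)"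

lemma tails_measurable [measurable]: "tails k \<in> measurable (Bor {k..r}) (Bor {k..r})"
  unfolding tails_def
proof (rule measurable_restrict)
  fix i assume "i \<in> {k..r}"
  then show "(\<lambda>\<eta>. \<Prod>j=i..r. \<eta> j) \<in> borel_measurable (Bor {k..r})"
    by (intro borel_measurable_prod measurable_component_singleton) auto
qed

lemma tails_upd:
  assumes "k \<le> r"
  shows "tails k (\<eta>(k := b)) k = b * (\<Prod>j=Suc k..r. \<eta> j)"
    "restrict (tails k (\<eta>(k := b))) {Suc k..r} = tails (Suc k) \<eta>"
proof -
  have "(\<Prod>j=k..r. (\<eta>(k := b)) j) = b * (\<Prod>j=Suc k..r. (\<eta>(k := b)) j)"
    using assms by (subst prod.atLeast_Suc_atMost) auto
  also have "(\<Prod>j=Suc k..r. (\<eta>(k := b)) j) = (\<Prod>j=Suc k..r. \<eta> j)" by (rule prod.cong) auto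
  finally show "tails k (\<eta>(k := b)) k = b * (\<Prod>j=Suc k..r. \<eta> j)" using assms by (simp add: tails_def)
  have "(\<Prod>j=i..r. (\<eta>(k := b)) j) = (\<Prod>j=i..r. \<eta> j)" if "Suc k \<le> i" for i
    using that by (intro prod.cong) auto
  then show "restrict (tails k (\<eta>(k := b))) {Suc k..r} = tails (Suc k) \<eta>"
    by (auto simp: tails_def fun_eq_iff restrict_def)
qed

text \<open>Read \<open>Lo q\<close> and \<open>Hi q\<close> as: the section has a point below
  \<open>q\<close>, respectively above \<open>q\<close>. A number that passes the outer test but not
  the inner one is then the lower or upper end of the section; \<open>S1\<close> and
  \<open>S2\<close> contain at most one point each.\<close>

lemma at_most_two_exceptional_points:
  fixes Lo Hi :: "rat \<Rightarrow> bool"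
  shows "finite {x::real. (\<forall>q. (x < of_rat q \<longrightarrow> Lo q) \<and> (of_rat q < x \<longrightarrow> Hi q)) \<and>
    \<not> (\<exists>q1 q2. of_rat q1 < x \<and> x < of_rat q2 \<and> Lo q1 \<and> Hi q2)}"
proof -
  define S1 where "S1 = {x::real. (\<forall>q. x < of_rat q \<longrightarrow> Lo q) \<and> (\<forall>q. of_rat q < x \<longrightarrow> \<not> Lo q)}"
  define S2 where "S2 = {x::real. (\<forall>q. of_rat q < x \<longrightarrow> Hi q) \<and> (\<forall>q. x < of_rat q \<longrightarrow> \<not> Hi q)}"
  have 1: "\<not> x < y" if xy: "x \<in> S1" "y \<in> S1" for x y
  proof
    assume "x < y"
    then obtain q where "x < of_rat q" "of_rat q < y" using of_rat_dense by blast
    then show False using xy by (auto simp: S1_def)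
  qed
  have 2: "\<not> x < y" if xy: "x \<in> S2" "y \<in> S2" for x y
  proof
    assume "x < y"
    then obtain q where "x < of_rat q" "of_rat q < y" using of_rat_dense by blast
    then show False using xy by (auto simp: S2_def)
  qed
  have fin: "finite S" if "\<And>x y. x \<in> S \<Longrightarrow> y \<in> S \<Longrightarrow> \<not> x < y" for S :: "real set"
  proof (cases "S = {}")
    case False
    then obtain x where "x \<in> S" by auto
    then have "S \<subseteq> {x}" using that by (metis insertCI linorder_neqE subsetI)
    then show ?thesis by (rule finite_subset) simp
  qed simp
  have "finite (S1 \<union> S2)" using fin[of S1] fin[of S2] 1 2 by blast
  moreover have "{x::real. (\<forall>q. (x < of_rat q \<longrightarrow> Lo q) \<and> (of_rat q < x \<longrightarrow> Hi q)) \<and>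
    \<not> (\<exists>q1 q2. of_rat q1 < x \<and> x < of_rat q2 \<and> Lo q1 \<and> Hi q2)} \<subseteq> S1 \<union> S2"
    by (auto simp: S1_def S2_def)
  ultimately show ?thesis by (rule finite_subset[rotated])
qed

lemma convex_fun_restrict_image:
  assumes "convex_fun K" "\<And>x y u. x \<in> K \<Longrightarrow> y \<in> K \<Longrightarrow> Q (x k) \<Longrightarrow> Q (y k) \<Longrightarrow> 0 \<le> u \<Longrightarrow> u \<le> 1 \<Longrightarrow> Q ((1 - u) * x k + u * y k)"
  shows "convex_fun ((\<lambda>y. restrict y J) ` {y \<in> K. Q (y k)})"
  unfolding convex_fun_def
proof (intro ballI allI impI)
  fix x' y' and u :: real
  assume "x' \<in> (\<lambda>y. restrict y J) ` {y \<in> K. Q (y k)}" "y' \<in> (\<lambda>y. restrict y J) ` {y \<in> K. Q (y k)}" and u: "0 \<le> u \<and> u \<le> 1"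
  then obtain x y where xy: "x \<in> K" "Q (x k)" "x' = restrict x J" "y \<in> K" "Q (y k)" "y' = restrict y J" by auto
  define z where "z = (\<lambda>k. (1 - u) * x k + u * y k)"
  have "z \<in> K" using assms(1) xy u unfolding convex_fun_def z_def by blast
  moreover have "Q (z k)" unfolding z_def by (rule assms(2)) (use xy u in auto)
  moreover have "(\<lambda>k. (1 - u) * x' k + u * y' k) = restrict z J"
    unfolding xy z_def by (auto simp: fun_eq_iff algebra_simps)
  ultimately show "(\<lambda>k. (1 - u) * x' k + u * y' k) \<in> (\<lambda>y. restrict y J) ` {y \<in> K. Q (y k)}" by auto
qed

text \<open>A convex set is squeezed between Borel sets by induction on the dimension: the sections along the
  first coordinate are intervals, and their end points are described by the projections of
  \<open>{y \<in> K. y k < q}\<close> and \<open>{y \<in> K. q < y k}\<close>, which are again convex.\<close>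

lemma convex_squeeze:
  assumes "k \<le> Suc r"
  shows "K \<subseteq> PiE {k..r} (\<lambda>_. UNIV) \<Longrightarrow> convex_fun K \<Longrightarrow>
    \<exists>A B. A \<in> sets (Bor {k..r}) \<and> B \<in> sets (Bor {k..r}) \<and> A \<subseteq> K \<and> K \<subseteq> B \<and>
      (AE \<eta> in PiM {k..r} L. tails k \<eta> \<notin> B - A)"
  using assms
proof (induction k arbitrary: K rule: inc_induct)
  case base
  have "K = {} \<or> K = {\<lambda>_. undefined}" using base by (auto simp: PiE_empty_domain)
  moreover have "{\<lambda>_. undefined} \<in> sets (Bor {Suc r..r})"
  proof -
    have "space (Bor {Suc r..r}) = {\<lambda>_. undefined}" by (simp add: space_PiM)
    then show ?thesis by (metis sets.top)
  qed
  ultimately show ?case by (intro exI[of _ K] conjI) auto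
next
  case (step k K)
  have kr: "k \<le> r" using step.hyps by simp
  define I where "I = {Suc k..r}"
  have ins: "{k..r} = insert k I" and kI: "k \<notin> I" and I: "finite I" using kr by (auto simp: I_def)
  define Lo where "Lo q = (\<lambda>y. restrict y I) ` {y \<in> K. y k < real_of_rat q}" for q
  define Hi where "Hi q = (\<lambda>y. restrict y I) ` {y \<in> K. real_of_rat q < y k}" for q
  have conv_lo: "convex_fun (Lo q)" for q unfolding Lo_def
  proof (rule convex_fun_restrict_image[OF step.prems(2)])
    fix x y :: "nat \<Rightarrow> real" and u :: real
    assume *: "x k < real_of_rat q" "y k < real_of_rat q" "0 \<le> u" "u \<le> 1"
    then show "(1 - u) * x k + u * y k < real_of_rat q"
      by (intro convex_bound_lt) auto
  qed
  have conv_hi: "convex_fun (Hi q)" for q unfolding Hi_def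
  proof (rule convex_fun_restrict_image[OF step.prems(2)])
    fix x y :: "nat \<Rightarrow> real" and u :: real
    assume *: "real_of_rat q < x k" "real_of_rat q < y k" "0 \<le> u" "u \<le> 1"
    have "(1 - u) * (- x k) + u * (- y k) < - real_of_rat q"
      using * by (intro convex_bound_lt) auto
    then show "real_of_rat q < (1 - u) * x k + u * y k" by simp
  qed
  have ext_lo_hi: "Lo q \<subseteq> PiE I (\<lambda>_. UNIV)" "Hi q \<subseteq> PiE I (\<lambda>_. UNIV)" for q
    by (auto simp: Lo_def Hi_def)
  note IH = step.IH[folded I_def]
  have "\<forall>q. \<exists>A B. A \<in> sets (Bor I) \<and> B \<in> sets (Bor I) \<and> A \<subseteq> Lo q \<and> Lo q \<subseteq> B \<and> (AE \<eta> in PiM I L. tails (Suc k) \<eta> \<notin> B - A)"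
    "\<forall>q. \<exists>A B. A \<in> sets (Bor I) \<and> B \<in> sets (Bor I) \<and> A \<subseteq> Hi q \<and> Hi q \<subseteq> B \<and> (AE \<eta> in PiM I L. tails (Suc k) \<eta> \<notin> B - A)"
    by (rule allI, rule IH, rule ext_lo_hi, rule conv_lo) (rule allI, rule IH, rule ext_lo_hi, rule conv_hi)
  then obtain Al Bl Ah Bh where
    l: "\<And>q. Al q \<in> sets (Bor I)" "\<And>q. Bl q \<in> sets (Bor I)" "\<And>q. Al q \<subseteq> Lo q" "\<And>q. Lo q \<subseteq> Bl q"
      "\<And>q. AE \<eta> in PiM I L. tails (Suc k) \<eta> \<notin> Bl q - Al q" and
    h: "\<And>q. Ah q \<in> sets (Bor I)" "\<And>q. Bh q \<in> sets (Bor I)" "\<And>q. Ah q \<subseteq> Hi q" "\<And>q. Hi q \<subseteq> Bh q"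
      "\<And>q. AE \<eta> in PiM I L. tails (Suc k) \<eta> \<notin> Bh q - Ah q"
    by metis
  \<comment> \<open>\<open>A\<close> asks for points of the section on both sides, which suffices by
    convexity; \<open>B\<close> asks only for what every point of \<open>K\<close> satisfies.
    Rational thresholds make both countable combinations of Borel sets.\<close>
  define A where "A = {x \<in> space (Bor {k..r}). \<exists>q1 q2. real_of_rat q1 < x k \<and> x k < real_of_rat q2 \<and>
      restrict x I \<in> Al q1 \<and> restrict x I \<in> Ah q2}"
  define B where "B = {x \<in> space (Bor {k..r}). \<forall>q. (x k < real_of_rat q \<longrightarrow> restrict x I \<in> Bl q) \<and>
      (real_of_rat q < x k \<longrightarrow> restrict x I \<in> Bh q)}"
  have comp [measurable]: "(\<lambda>x. x k) \<in> borel_measurable (Bor {k..r})"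
    by (rule measurable_component_singleton) (use kr in auto)
  have rest [measurable]: "(\<lambda>x. restrict x I) \<in> measurable (Bor {k..r}) (Bor I)"
    by (rule measurable_restrict_subset) (auto simp: I_def)
  note [measurable] = l(1,2) h(1,2)
  have A: "A \<in> sets (Bor {k..r})" unfolding A_def by measurable
  have B: "B \<in> sets (Bor {k..r})" unfolding B_def by measurable
  have "A \<subseteq> K"
  proof
    fix x assume x: "x \<in> A"
    then obtain q1 q2 where q: "real_of_rat q1 < x k" "x k < real_of_rat q2" "restrict x I \<in> Lo q1" "restrict x I \<in> Hi q2"
      using l(3) h(3) unfolding A_def by blast
    then obtain y z where y: "y \<in> K" "y k < real_of_rat q1" "restrict x I = restrict y I"
      and z: "z \<in> K" "real_of_rat q2 < z k" "restrict x I = restrict z I"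
      unfolding Lo_def Hi_def by auto
    have ext: "x i = undefined" "y i = undefined" "z i = undefined" if "i \<notin> {k..r}" for i
      using that x y(1) z(1) step.prems(1) by (auto simp: A_def space_PiM PiE_def extensional_def)
    have eqI: "y i = x i" "z i = x i" if "i \<in> I" for i
      using that fun_cong[OF y(3), of i] fun_cong[OF z(3), of i] by auto
    define u where "u = (x k - y k) / (z k - y k)"
    have lt: "y k < x k" "x k < z k" using q y z by auto
    have u: "0 \<le> u" "u \<le> 1" using lt by (auto simp: u_def)
    have "(\<lambda>i. (1 - u) * y i + u * z i) \<in> K"
      using step.prems(2) y(1) z(1) u unfolding convex_fun_def by blast
    moreover have "(1 - u) * y i + u * z i = x i" for i
    proof -
      consider "i = k" | "i \<in> I" | "i \<notin> {k..r}" using ins by blast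
      then show ?thesis
      proof cases
        case 1
        have "u * (z k - y k) = x k - y k" using lt by (simp add: u_def)
        then show ?thesis using 1 by (simp add: algebra_simps)
      qed (use ext eqI in \<open>simp_all add: algebra_simps\<close>)
    qed
    ultimately show "x \<in> K" by simp
  qed
  moreover have "K \<subseteq> B"
    using step.prems(1) l(4) h(4) unfolding B_def Lo_def Hi_def by (fastforce simp: space_PiM)
  moreover have "AE \<eta> in PiM {k..r} L. tails k \<eta> \<notin> B - A"
  proof -
    define N where "N = {\<eta> \<in> space (PiM (insert k I) L). tails k \<eta> \<in> B - A}"
    have N: "N \<in> sets (PiM (insert k I) L)"
      unfolding N_def ins[symmetric] using A B by measurable
    have "emeasure (PiM (insert k I) L) N = (\<integral>\<^sup>+\<eta>. indicator N \<eta> \<partial>PiM (insert k I) L)"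
      using N by simp
    also have "\<dots> = (\<integral>\<^sup>+\<eta>. (\<integral>\<^sup>+b. indicator N (\<eta>(k := b)) \<partial>L k) \<partial>PiM I L)"
      using N by (intro P.product_nn_integral_insert I kI) simp
    also have "\<dots> = (\<integral>\<^sup>+\<eta>. 0 \<partial>PiM I L)"
    proof (rule nn_integral_cong_AE)
      \<comment> \<open>Almost surely no factor is zero, so multiplication by \<open>z\<close> is
        injective and the finite exceptional set of values \<open>b * z\<close> comes from finitely
        many \<open>b\<close>.\<close>
      have nz: "AE \<eta> in PiM I L. \<forall>j\<in>I. \<eta> j \<noteq> 0"
      proof (rule AE_finite_allI[OF I])
        fix j assume "j \<in> I"
        have "AE x in L j. x \<noteq> 0" using AE_not_in[OF null_singleton[of 0 j]] by simp
        then show "AE \<eta> in PiM I L. \<eta> j \<noteq> 0"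
          by (rule AE_PiM_component[OF prob_L \<open>j \<in> I\<close>])
      qed
      have good: "AE \<eta> in PiM I L. \<forall>q. tails (Suc k) \<eta> \<notin> Bl q - Al q \<and> tails (Suc k) \<eta> \<notin> Bh q - Ah q"
        using l(5) h(5) by (subst AE_all_countable) auto
      show "AE \<eta> in PiM I L. (\<integral>\<^sup>+b. indicator N (\<eta>(k := b)) \<partial>L k) = 0"
        using nz good
      proof eventually_elim
        case (elim \<eta>)
        let ?y = "tails (Suc k) \<eta>"
        define z where "z = (\<Prod>j=Suc k..r. \<eta> j)"
        have z: "z \<noteq> 0" using elim(1) by (simp add: z_def I_def)
        define S where "S = {x::real. (\<forall>q. (x < of_rat q \<longrightarrow> ?y \<in> Lo q) \<and> (of_rat q < x \<longrightarrow> ?y \<in> Hi q)) \<and>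
          \<not> (\<exists>q1 q2. of_rat q1 < x \<and> x < of_rat q2 \<and> ?y \<in> Lo q1 \<and> ?y \<in> Hi q2)}"
        have S: "finite S" unfolding S_def by (rule at_most_two_exceptional_points)
        have same: "?y \<in> Bl q \<longleftrightarrow> ?y \<in> Lo q" "?y \<in> Al q \<longleftrightarrow> ?y \<in> Lo q"
          "?y \<in> Bh q \<longleftrightarrow> ?y \<in> Hi q" "?y \<in> Ah q \<longleftrightarrow> ?y \<in> Hi q" for q
          using elim(2) l(3,4)[of q] h(3,4)[of q] by blast+
        have sub: "b \<in> (\<lambda>x. x / z) ` S" if "\<eta>(k := b) \<in> N" for b
        proof -
          have t: "tails k (\<eta>(k := b)) k = b * z" "restrict (tails k (\<eta>(k := b))) I = ?y"
            using tails_upd[OF kr] by (simp_all add: z_def I_def)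
          have "tails k (\<eta>(k := b)) \<in> B" "tails k (\<eta>(k := b)) \<notin> A" "tails k (\<eta>(k := b)) \<in> space (Bor {k..r})"
            using that by (auto simp: N_def B_def)
          then have "b * z \<in> S"
            unfolding S_def A_def B_def using t same by auto
          then show ?thesis using z by (intro image_eqI[of _ _ "b * z"]) auto
        qed
        have "(\<integral>\<^sup>+b. indicator N (\<eta>(k := b)) \<partial>L k) \<le> (\<integral>\<^sup>+b. indicator ((\<lambda>x. x / z) ` S) b \<partial>L k)"
          by (rule nn_integral_mono) (use sub in \<open>auto split: split_indicator\<close>)
        also have "\<dots> = emeasure (L k) ((\<lambda>x. x / z) ` S)"
          using S by (intro nn_integral_indicator) (auto intro!: borel_closed finite_imp_closed)
        also have "\<dots> = 0" using S by (intro finite_null) simp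
        finally show ?case by simp
      qed
    qed
    finally have "emeasure (PiM (insert k I) L) N = 0" by simp
    then have "N \<in> null_sets (PiM (insert k I) L)" using N by auto
    then show ?thesis unfolding ins by (rule AE_I') (auto simp: N_def)
  qed
  ultimately show ?case using A B by blast
qed

text \<open>The extra coordinate \<open>Suc r\<close> carries the constant 1, so that the top
  variable is treated by the same recursion as the others.\<close>

abbreviation Ext :: "(nat \<Rightarrow> real) measure" where "Ext \<equiv> Bor {1..Suc r}"

text \<open>Entries up to \<open>k\<close> are placeholders that \<open>integrate_down\<close>
  overwrites; at \<open>Suc r\<close> the empty product supplies the 1.\<close>

definition pad :: "nat \<Rightarrow> (nat \<Rightarrow> real) \<Rightarrow> nat \<Rightarrow> real" where
  "pad k \<eta> = (\<lambda>i\<in>{1..Suc r}. if k < i then (\<Prod>j=i..r. \<eta> j) else 0)"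

lemma pad_measurable: "pad k \<in> measurable (Bor {Suc k..r}) Ext"
  unfolding pad_def
proof (rule measurable_restrict)
  fix i assume "i \<in> {1..Suc r}"
  show "(\<lambda>\<eta>. if k < i then \<Prod>j=i..r. \<eta> j else 0) \<in> borel_measurable (Bor {Suc k..r})"
  proof (cases "k < i")
    case True
    then show ?thesis
      by (auto intro!: borel_measurable_prod measurable_component_singleton)
  qed simp
qed

lemma pad_upd:
  assumes "Suc k \<le> r"
  shows "pad k (\<eta>(Suc k := b)) = (pad (Suc k) \<eta>)(Suc k := b * pad (Suc k) \<eta> (Suc (Suc k)))"
proof
  fix i
  have other: "(\<Prod>j=i..r. (\<eta>(Suc k := b)) j) = (\<Prod>j=i..r. \<eta> j)" if "Suc k < i"
    using that by (intro prod.cong) auto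
  have "(\<Prod>j=Suc k..r. (\<eta>(Suc k := b)) j) = b * (\<Prod>j=Suc (Suc k)..r. (\<eta>(Suc k := b)) j)"
    using assms by (subst prod.atLeast_Suc_atMost) auto
  also have "(\<Prod>j=Suc (Suc k)..r. (\<eta>(Suc k := b)) j) = (\<Prod>j=Suc (Suc k)..r. \<eta> j)" by (rule prod.cong) auto
  finally show "pad k (\<eta>(Suc k := b)) i = ((pad (Suc k) \<eta>)(Suc k := b * pad (Suc k) \<eta> (Suc (Suc k)))) i"
    using assms other by (cases i "Suc k" rule: linorder_cases) (auto simp: pad_def)
qed

text \<open>A common roof for two sources of measurability: Fubini's theorem for Borel functions,
  and the Jordan decomposition for bounded line variation. The Borel sets that squeeze a convex set
  use the former, the convex set itself the latter, and their nested integrals have to be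
  compared.\<close>

definition regular :: "((nat \<Rightarrow> real) \<Rightarrow> real) \<Rightarrow> bool" where
  "regular f \<longleftrightarrow> (\<forall>k v. Suc k \<le> r \<longrightarrow> v \<in> space Ext \<longrightarrow>
     (\<lambda>b. integrate_down L f k (v(Suc k := b * v (Suc (Suc k))))) \<in> borel_measurable borel)"

lemma upd_space_Ext: "Suc k \<le> r \<Longrightarrow> v \<in> space Ext \<Longrightarrow> v(Suc k := c) \<in> space Ext"
  by (auto simp: space_PiM PiE_def extensional_def)

lemma integrate_down_measurable:
  assumes f: "f \<in> borel_measurable Ext" and k: "k \<le> r"
  shows "integrate_down L f k \<in> borel_measurable Ext"
  using k
proof (induction k)
  case 0
  have "integrate_down L f 0 = f" by auto
  then show ?case using f by simp
next
  case (Suc k)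
  note IH = Suc.IH[OF Suc_leD[OF Suc.prems]]
  have c: "(\<lambda>v. v (Suc (Suc k))) \<in> borel_measurable Ext"
    by (rule measurable_component_singleton) (use Suc.prems in auto)
  have "(\<lambda>p. (fst p)(Suc k := snd p * fst p (Suc (Suc k)))) \<in> measurable (Ext \<Otimes>\<^sub>M L (Suc k)) Ext"
  proof (rule measurable_fun_upd)
    show "{1..Suc r} = {1..Suc r} \<union> {Suc k}" using Suc.prems by auto
    show "(\<lambda>p. snd p * fst p (Suc (Suc k))) \<in> borel_measurable (Ext \<Otimes>\<^sub>M L (Suc k))"
      using measurable_compose[OF measurable_fst c] by measurable
  qed simp
  from measurable_compose[OF this IH]
  have "(\<lambda>(v, b). integrate_down L f k (v(Suc k := b * v (Suc (Suc k))))) \<in> borel_measurable (Ext \<Otimes>\<^sub>M L (Suc k))"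
    unfolding case_prod_beta' .
  then show ?case unfolding integrate_down.simps[abs_def]
    by (rule sigma_finite_measure.borel_measurable_lebesgue_integral[OF prob_space_imp_sigma_finite[OF prob_L]])
qed

lemma regular_measurable:
  assumes f: "f \<in> borel_measurable Ext"
  shows "regular f"
  unfolding regular_def
proof (intro allI impI)
  fix k v assume k: "Suc k \<le> r" and v: "v \<in> space Ext"
  have "(\<lambda>b. v(Suc k := b * v (Suc (Suc k)))) \<in> measurable borel Ext"
  proof (rule measurable_fun_upd)
    show "{1..Suc r} = {1..Suc r} \<union> {Suc k}" using k by auto
  qed (use v in simp_all)
  from measurable_compose[OF this integrate_down_measurable[OF f Suc_leD[OF k]]]
  show "(\<lambda>b. integrate_down L f k (v(Suc k := b * v (Suc (Suc k))))) \<in> borel_measurable borel" .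
qed

lemma regular_line_variation:
  assumes f: "line_variation_le V f" "\<And>v. 0 \<le> f v \<and> f v \<le> 1"
  shows "regular f"
  unfolding regular_def
proof (intro allI impI)
  fix k v
  have "line_variation_le V (integrate_down L f k)"
    using integrate_down_line_variation[OF f, of k L] prob_L by simp
  from variation_le_borel_measurable[OF line_variation_upd[OF this]]
  show "(\<lambda>b. integrate_down L f k (v(Suc k := b * v (Suc (Suc k))))) \<in> borel_measurable borel" .
qed

lemma measurable_L_iff [simp]: "measurable (L k) M = measurable borel M"
  by (rule measurable_cong_sets) auto

lemma integrate_down_bounds:
  assumes f: "regular f" "\<And>v. 0 \<le> f v \<and> f v \<le> 1" and k: "k \<le> r" and v: "v \<in> space Ext"
  shows "0 \<le> integrate_down L f k v \<and> integrate_down L f k v \<le> 1"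
  using k v
proof (induction k arbitrary: v)
  case (Suc k)
  let ?h = "\<lambda>b. integrate_down L f k (v(Suc k := b * v (Suc (Suc k))))"
  have b: "0 \<le> ?h b \<and> ?h b \<le> 1" for b using Suc upd_space_Ext[OF Suc.prems] by simp
  have int: "integrable (L (Suc k)) ?h"
    by (rule finite_measure.integrable_const_bound[OF prob_space.finite_measure[OF prob_L], where B=1]) (use b f(1) Suc.prems in \<open>auto simp: regular_def\<close>)
  have "(\<integral>b. ?h b \<partial>L (Suc k)) \<le> (\<integral>b. 1 \<partial>L (Suc k))" by (intro integral_mono int) (use b in auto)
  then show ?case using b prob_space.prob_space[OF prob_L, of "Suc k"] by simp
qed (use f in simp)

lemma integrate_down_mono:
  assumes f: "regular f" "\<And>v. 0 \<le> f v \<and> f v \<le> 1" and g: "regular g" "\<And>v. 0 \<le> g v \<and> g v \<le> 1"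
    and fg: "\<And>v. f v \<le> g v" and k: "k \<le> r" and v: "v \<in> space Ext"
  shows "integrate_down L f k v \<le> integrate_down L g k v"
  using k v
proof (induction k arbitrary: v)
  case (Suc k)
  let ?v = "\<lambda>b. v(Suc k := b * v (Suc (Suc k)))"
  have v: "?v b \<in> space Ext" for b by (rule upd_space_Ext) (use Suc.prems in auto)
  have int: "integrable (L (Suc k)) (\<lambda>b. integrate_down L h k (?v b))"
    if h: "regular h" "\<And>v. 0 \<le> h v \<and> h v \<le> 1" for h
    by (rule finite_measure.integrable_const_bound[OF prob_space.finite_measure[OF prob_L], where B=1])
       (use integrate_down_bounds[OF h _ v] h(1) Suc.prems in \<open>auto simp: regular_def\<close>)
  show ?case unfolding integrate_down.simps
    by (intro integral_mono int f g Suc.IH v) (use Suc.prems in auto)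
qed (use fg in simp)

text \<open>Variables are integrated out from the smallest index on: after \<open>k\<close> rounds
  the inner integrals form \<open>integrate_down L f k\<close>, and the remaining variables supply
  the entries above \<open>k\<close>.\<close>

lemma integrate_down_fubini:
  assumes f: "f \<in> borel_measurable Ext" "\<And>v. 0 \<le> f v \<and> f v \<le> 1" and k: "k \<le> r"
  shows "(\<integral>\<eta>. f (pad 0 \<eta>) \<partial>PiM {1..r} L) = (\<integral>\<eta>. integrate_down L f k (pad k \<eta>) \<partial>PiM {Suc k..r} L)"
  using k
proof (induction k)
  case (Suc k)
  let ?F = "integrate_down L f k"
  have ins: "{Suc k..r} = insert (Suc k) {Suc (Suc k)..r}" using Suc.prems by auto
  interpret PP: prob_space "PiM (insert (Suc k) {Suc (Suc k)..r}) L" by (rule prob_space_PiM) (rule prob_L)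
  have meas: "(\<lambda>\<eta>. ?F (pad k \<eta>)) \<in> borel_measurable (PiM {Suc k..r} L)"
    using measurable_compose[OF pad_measurable[of k] integrate_down_measurable[OF f(1), of k]] Suc.prems
    by (simp cong: measurable_cong_sets)
  have "?F (pad k \<eta>) \<in> {0..1}" for \<eta>
  proof -
    have "pad k \<eta> \<in> space Ext" by (simp add: pad_def space_PiM)
    then show ?thesis using integrate_down_bounds[OF regular_measurable[OF f(1)] f(2)] Suc.prems by simp
  qed
  then have int: "integrable (PiM (insert (Suc k) {Suc (Suc k)..r}) L) (\<lambda>\<eta>. ?F (pad k \<eta>))"
    using meas unfolding ins by (intro PP.integrable_const_bound[where B=1]) auto
  have "(\<integral>\<eta>. f (pad 0 \<eta>) \<partial>PiM {1..r} L) = (\<integral>\<eta>. ?F (pad k \<eta>) \<partial>PiM (insert (Suc k) {Suc (Suc k)..r}) L)"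
    using Suc.IH Suc.prems unfolding ins by simp
  also have "\<dots> = (\<integral>\<eta>. (\<integral>b. ?F (pad k (\<eta>(Suc k := b))) \<partial>L (Suc k)) \<partial>PiM {Suc (Suc k)..r} L)"
    by (rule P.product_integral_insert[OF _ _ int]) auto
  also have "\<dots> = (\<integral>\<eta>. integrate_down L f (Suc k) (pad (Suc k) \<eta>) \<partial>PiM {Suc (Suc k)..r} L)"
    unfolding pad_upd[OF Suc.prems] integrate_down.simps ..
  finally show ?case .
qed simp

definition Z_measure :: "(nat \<Rightarrow> real) measure" where
  "Z_measure = distr (PiM {1..r} L) (PiM {1..r} (\<lambda>_. lborel)) (Zmap r)"

lemma Zmap_eq_tails: "Zmap r \<eta> = tails 1 \<eta>"
proof
  fix i
  have "(\<Prod>j\<in>{i..<r}. \<eta> j) * \<eta> r = (\<Prod>j=i..r. \<eta> j)" if "i \<le> r"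
    using that by (metis prod.last_plus mult.commute atLeastLessThanSuc_atLeastAtMost prod.atLeastLessThan_Suc)
  then show "Zmap r \<eta> i = tails 1 \<eta> i" by (simp add: Zmap_def tails_def restrict_def)
qed

text \<open>For Borel sets this is Fubini's theorem. A convex set lies between two Borel sets that
  differ by a null set, and both sides are monotone in the set.\<close>

lemma measure_Z_completion:
  assumes K: "K \<subseteq> PiE {1..r} (\<lambda>_. UNIV)" "convex_fun K"
  shows "measure (completion Z_measure) K = integrate_down L (restricted_indicator r K) r (pad r (\<lambda>_. 0))"
proof -
  have sets_Z: "sets Z_measure = sets (Bor {1..r})"
    unfolding Z_measure_def by (simp add: sets_PiM_cong[of _ _ "\<lambda>_. lborel" "\<lambda>_. borel"])
  interpret PP: prob_space "PiM {1..r} L" by (rule prob_space_PiM) (rule prob_L)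
  have Zm: "Zmap r \<in> measurable (PiM {1..r} L) (PiM {1..r} (\<lambda>_. lborel))"
    using tails_measurable[of 1] unfolding Zmap_eq_tails[abs_def]
    by (simp cong: measurable_cong_sets add: sets_PiM_cong[of _ _ "\<lambda>_. lborel" "\<lambda>_. borel"])
  obtain A B where A: "A \<in> sets (Bor {1..r})" and B: "B \<in> sets (Bor {1..r})" and sub: "A \<subseteq> K" "K \<subseteq> B"
    and ae: "AE \<eta> in PiM {1..r} L. tails 1 \<eta> \<notin> B - A"
    using convex_squeeze[of 1 K] K by auto
  let ?v = "pad r (\<lambda>_. 0)"
  have v: "?v \<in> space Ext" by (simp add: pad_def space_PiM)
  have emeas: "emeasure Z_measure D = ennreal (integrate_down L (restricted_indicator r D) r ?v)"
    and reg: "regular (restricted_indicator r D)"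
    if D: "D \<in> sets (Bor {1..r})" for D
  proof -
    have "(\<lambda>v. restrict v {1..r}) \<in> measurable Ext (Bor {1..r})"
      by (rule measurable_restrict_subset) auto
    then have f: "restricted_indicator r D \<in> borel_measurable Ext"
      unfolding restricted_indicator_def[abs_def]
      by (rule measurable_compose) (use D in simp)
    then show "regular (restricted_indicator r D)" by (rule regular_measurable)
    have fb: "0 \<le> restricted_indicator r D v \<and> restricted_indicator r D v \<le> 1" for v
      by (simp add: restricted_indicator_def)
    have "emeasure Z_measure D = emeasure (PiM {1..r} L) (Zmap r -` D \<inter> space (PiM {1..r} L))"
      unfolding Z_measure_def using D by (intro emeasure_distr Zm) (simp add: sets_PiM_cong[of _ _ "\<lambda>_. lborel" "\<lambda>_. borel"])
    also have "\<dots> = ennreal (measure (PiM {1..r} L) (Zmap r -` D \<inter> space (PiM {1..r} L)))"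
      by (rule PP.emeasure_eq_measure)
    also have "measure (PiM {1..r} L) (Zmap r -` D \<inter> space (PiM {1..r} L))
      = (\<integral>\<eta>. indicator (Zmap r -` D \<inter> space (PiM {1..r} L)) \<eta> \<partial>PiM {1..r} L)"
      using measurable_sets[OF Zm, of D] D
      by (simp add: sets_PiM_cong[of _ _ "\<lambda>_. lborel" "\<lambda>_. borel"])
    also have "\<dots> = (\<integral>\<eta>. restricted_indicator r D (pad 0 \<eta>) \<partial>PiM {1..r} L)"
    proof (rule Bochner_Integration.integral_cong)
      fix \<eta> assume "\<eta> \<in> space (PiM {1..r} L)"
      moreover have "restrict (pad 0 \<eta>) {1..r} = Zmap r \<eta>"
        unfolding Zmap_eq_tails by (auto simp: pad_def tails_def fun_eq_iff restrict_def)
      ultimately show "indicator (Zmap r -` D \<inter> space (PiM {1..r} L)) \<eta> = restricted_indicator r D (pad 0 \<eta>)"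
        by (simp add: restricted_indicator_def indicator_def)
    qed simp
    also have "\<dots> = (\<integral>\<eta>. integrate_down L (restricted_indicator r D) r (pad r \<eta>) \<partial>PiM {Suc r..r} L)"
      by (rule integrate_down_fubini[OF f fb order_refl])
    also have "\<dots> = (\<integral>\<eta>. integrate_down L (restricted_indicator r D) r ?v \<partial>PiM {Suc r..r} L)"
    proof -
      have "pad r \<eta> = ?v" for \<eta> by (auto simp: pad_def fun_eq_iff restrict_def)
      then show ?thesis by metis
    qed
    also have "\<dots> = integrate_down L (restricted_indicator r D) r ?v"
      using prob_space.prob_space[OF prob_space_PiM[of "{Suc r..r}" L, OF prob_L]] by simp
    finally show "emeasure Z_measure D = ennreal (integrate_down L (restricted_indicator r D) r ?v)" .
  qed
  have null: "B - A \<in> null_sets Z_measure"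
  proof -
    have "emeasure Z_measure (B - A) = emeasure (PiM {1..r} L) (Zmap r -` (B - A) \<inter> space (PiM {1..r} L))"
      unfolding Z_measure_def using A B by (intro emeasure_distr Zm) (simp add: sets_PiM_cong[of _ _ "\<lambda>_. lborel" "\<lambda>_. borel"])
    also have "\<dots> = 0"
    proof -
      have "Zmap r -` (B - A) \<inter> space (PiM {1..r} L) \<in> sets (PiM {1..r} L)"
        by (rule measurable_sets[OF Zm]) (use A B in \<open>simp add: sets_PiM_cong[of _ _ "\<lambda>_. lborel" "\<lambda>_. borel"]\<close>)
      moreover have "AE \<eta> in PiM {1..r} L. \<eta> \<notin> Zmap r -` (B - A) \<inter> space (PiM {1..r} L)"
        using ae unfolding Zmap_eq_tails by eventually_elim auto
      ultimately show ?thesis by (subst (asm) AE_iff_null_sets[symmetric]) auto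
    qed
    finally show ?thesis using A B sets_Z by (auto simp: null_sets_def)
  qed
  have eq: "emeasure Z_measure B = emeasure Z_measure A"
  proof -
    have "B = A \<union> (B - A)" using sub by auto
    then show ?thesis using emeasure_Un_null_set[OF _ null, of A] A sets_Z by simp
  qed
  have mK: "K \<in> sets (completion Z_measure)"
    by (rule sets_completionI[of K A "K - A" "B - A"]) (use sub A sets_Z null in auto)
  have "emeasure (completion Z_measure) A \<le> emeasure (completion Z_measure) K"
    "emeasure (completion Z_measure) K \<le> emeasure (completion Z_measure) B"
    by (rule emeasure_mono[OF sub(1) mK], rule emeasure_mono[OF sub(2)]) (use B sets_Z in simp)
  then have eK: "emeasure (completion Z_measure) K = emeasure Z_measure A"
    using A B sets_Z eq by simp
  let ?F = "\<lambda>D. integrate_down L (restricted_indicator r D) r ?v"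
  have regK: "regular (restricted_indicator r K)"
    by (rule regular_line_variation[OF line_variation_convex[OF K(2)]]) (simp add: restricted_indicator_def)
  have "?F A \<le> ?F K" "?F K \<le> ?F B"
    by (rule integrate_down_mono;
        use reg[OF A] reg[OF B] regK v sub in \<open>auto simp: restricted_indicator_def indicator_def\<close>)+
  moreover have "0 \<le> ?F A" "0 \<le> ?F B"
    using integrate_down_bounds[OF reg[OF A] _ order_refl v] integrate_down_bounds[OF reg[OF B] _ order_refl v]
    by (simp_all add: restricted_indicator_def)
  moreover have "?F A = ?F B" using eq emeas[OF A] emeas[OF B] calculation by simp
  ultimately have "?F K = ?F A" by simp
  moreover have "measure (completion Z_measure) K = ?F A"
    unfolding measure_def eK emeas[OF A] using \<open>0 \<le> ?F A\<close> by simp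
  ultimately show ?thesis by simp
qed

end

subsection \<open>The rate of convergence\<close>

lemma prod_near_one:
  fixes x :: "nat \<Rightarrow> real"
  assumes "\<And>i. i < n \<Longrightarrow> \<bar>x i - 1\<bar> \<le> d" "0 \<le> d" "d \<le> D"
  shows "\<bar>(\<Prod>i<n. x i) - 1\<bar> \<le> real n * (1 + D) ^ n * d"
  using assms(1)
proof (induction n)
  case (Suc n)
  have IH: "\<bar>(\<Prod>i<n. x i) - 1\<bar> \<le> real n * (1 + D) ^ n * d" using Suc by simp
  have xn: "\<bar>x n - 1\<bar> \<le> d" using Suc.prems by simp
  then have xn': "\<bar>x n\<bar> \<le> 1 + D" using assms by linarith
  have "(\<Prod>i<Suc n. x i) - 1 = ((\<Prod>i<n. x i) - 1) * x n + (x n - 1)" by (simp add: algebra_simps)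
  also have "\<bar>\<dots>\<bar> \<le> \<bar>(\<Prod>i<n. x i) - 1\<bar> * \<bar>x n\<bar> + \<bar>x n - 1\<bar>"
    using abs_triangle_ineq[of "((\<Prod>i<n. x i) - 1) * x n" "x n - 1"] by (simp only: abs_mult)
  also have "\<dots> \<le> (real n * (1 + D) ^ n * d) * (1 + D) + 1 * d"
    using IH xn xn' assms by (intro add_mono mult_mono) auto
  also have "\<dots> \<le> (real n * (1 + D) ^ n * d) * (1 + D) + (1 + D) ^ Suc n * d"
    using assms by (intro add_left_mono mult_right_mono one_le_power) auto
  also have "\<dots> = real (Suc n) * (1 + D) ^ Suc n * d" by (simp add: algebra_simps)
  finally show ?case .
qed simp

context immigration
begin

text \<open>The factor in front of the counts in \<open>Wvec\<close>, as a function of time.\<close>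

definition scale :: "real \<Rightarrow> real" where
  "scale x = real l powr (real l / (real l + 1)) / ((real l + 1) * x powr (real l / (real l + 1)))"

lemma scale_power: "x > 0 \<Longrightarrow> scale x ^ (l + 1) = real l ^ l / ((real l + 1) ^ (l + 1) * x ^ l)"
proof -
  assume x: "x > 0"
  have root: "(y powr (real l / (real l + 1))) ^ (l + 1) = y ^ l" if "y > 0" for y :: real
  proof -
    have "(y powr (real l / (real l + 1))) ^ (l + 1) = y powr (real l / (real l + 1) * real (l + 1))"
      using that by (subst powr_realpow[symmetric]) (simp_all only: powr_gt_zero powr_powr)
    also have "real l / (real l + 1) * real (l + 1) = real l" by (simp add: add.commute)
    finally show ?thesis using that by (simp add: powr_realpow)
  qed
  have "real l > 0" using l1 by simp
  then show ?thesis unfolding scale_def power_divide power_mult_distrib root[OF \<open>real l > 0\<close>] root[OF x] by simp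
qed

text \<open>In the application \<open>n1\<close> draws pass until color \<open>r + 1\<close> enters,
  \<open>n\<close> is the index of the chain, and \<open>l\<close> the lag in the Stein identity.
  The constants \<open>k1\<close>, \<open>k2\<close>, \<open>k3\<close> serve the upper bound, the
  lower bound and the calibration; the last holds since \<open>l * T (n + i)\<close> and
  \<open>(l + 1) * x\<close> differ by at most \<open>E\<close>.\<close>

lemma scale_ok_eventually: "\<exists>k>0. \<forall>n. scale_ok k n (scale (real (n1 + n + l)))"
proof -
  define c0 where "c0 = real l ^ l / (real l + 1) ^ (l + 1)"
  define c1 where "c1 = real l powr (real l / (real l + 1)) / (real l + 1)"
  define E where "E = real l * (real w + 1) + real l + (real l + 1) * (real n1 + real l)"
  define k1 where "k1 = c0 * (real w + 3) ^ l"
  define k2 where "k2 = (real n1 + real l + 1) ^ l / c0"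
  define k3 where "k3 = real l * (1 + E) ^ l * E / c1"
  define k where "k = k1 + k2 + k3 + 1"
  have l0: "real l > 0" using l1 by simp
  have c: "c0 > 0" "c1 > 0" using l0 by (auto simp: c0_def c1_def)
  have E: "E \<ge> 0" by (simp add: E_def)
  have k: "k1 \<ge> 0" "k2 \<ge> 0" "k3 \<ge> 0" using c E by (auto simp: k1_def k2_def k3_def)
  have k_ge: "k1 \<le> k" "k2 \<le> k" "k3 \<le> k" "0 < k" using k by (auto simp: k_def)
  have "scale_ok k n (scale (real (n1 + n + l)))" for n
  proof -
    define x where "x = real (n1 + n + l)"
    define t where "t = real (T n)"
    have x: "x \<ge> 1" "x \<ge> real l" "x > 0" using l1 by (auto simp: x_def)
    have t: "t > 0" using T_pos[of n] by (simp add: t_def)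
    have pow: "scale x ^ (l + 1) = c0 / x ^ l" using scale_power[OF x(3)] by (simp add: c0_def)
    have tx: "t \<le> (real w + 3) * x" "x \<le> (real n1 + real l + 1) * t"
    proof -
      have "t \<le> real w + 1 + 2 * real n"
        using div_le_dividend[of n l] by (simp add: t_def T_def del: div_le_dividend)
      also have "\<dots> \<le> (real w + 1) * x + 2 * x"
        using x mult_left_mono[of 1 x "real w + 1"] by (intro add_mono) (auto simp: x_def)
      finally show "t \<le> (real w + 3) * x" by (simp add: algebra_simps)
      have "1 \<le> t" "real n \<le> t" using T_ge[of n] by (auto simp: t_def)
      have "x = (real n1 + real l) * 1 + real n" by (simp add: x_def)
      also have "\<dots> \<le> (real n1 + real l) * t + t"
        using \<open>1 \<le> t\<close> \<open>real n \<le> t\<close> by (intro add_mono mult_left_mono) auto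
      finally show "x \<le> (real n1 + real l + 1) * t" by (simp add: algebra_simps)
    qed
    have ct: "scale x ^ (l + 1) * t ^ l = c0 * (t / x) ^ l"
      unfolding pow by (simp add: power_divide)
    have "c0 * (t / x) ^ l \<le> k1"
      unfolding k1_def using tx(1) t x c
      by (intro mult_left_mono power_mono) (auto simp: pos_divide_le_eq)
    then have upper: "scale x ^ (l + 1) * t ^ l \<le> k" using k_ge ct by simp
    have "1 / k2 \<le> c0 * (t / x) ^ l"
    proof -
      have "1 / (real n1 + real l + 1) \<le> t / x" using tx(2) t x by (simp add: field_simps)
      then have "(1 / (real n1 + real l + 1)) ^ l \<le> (t / x) ^ l" by (intro power_mono) auto
      then have "c0 * (1 / (real n1 + real l + 1)) ^ l \<le> c0 * (t / x) ^ l" using c by (intro mult_left_mono) auto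
      then show ?thesis by (simp add: k2_def power_divide)
    qed
    moreover have "1 / k \<le> 1 / k2"
    proof -
      have "k2 > 0" unfolding k2_def using c by (intro divide_pos_pos zero_less_power) auto
      then show ?thesis using k_ge by (intro divide_left_mono) auto
    qed
    ultimately have lower: "1 / k \<le> scale x ^ (l + 1) * t ^ l" using ct by simp
    have c1x: "scale x = c1 / x powr (real l / (real l + 1))" by (simp add: scale_def c1_def)
    have s0: "0 < scale x" using c x unfolding c1x by simp
    have "real l powr (real l / (real l + 1)) \<le> x powr (real l / (real l + 1))"
      using x by (intro powr_mono2) auto
    also have "\<dots> \<le> (real l + 1) * x powr (real l / (real l + 1))"
      using x by (simp add: mult_le_cancel_right1)
    finally have s1: "scale x \<le> 1" using x unfolding scale_def by (simp add: divide_le_eq_1)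
    \<comment> \<open>Errors of order \<open>1 / x\<close> are absorbed by the scale, whose exponent
      \<open>l / (l + 1)\<close> is below 1.\<close>
    have inv: "1 / x \<le> scale x / c1"
    proof -
      have "x powr (real l / (real l + 1)) \<le> x powr 1" using x by (intro powr_mono) auto
      then have "1 / x \<le> 1 / x powr (real l / (real l + 1))" using x by (intro divide_left_mono) auto
      then show ?thesis unfolding c1x using c by simp
    qed
    \<comment> \<open>Every one of the \<open>l\<close> factors of \<open>R n\<close> receives one
      factor \<open>l / ((l + 1) * x)\<close>, which makes each of them close to 1.\<close>
    have "real (l + 1) * scale x ^ (l + 1) * R n = (\<Prod>i<l. real l * real (T (n + i)) / ((real l + 1) * x))"
    proof -
      have "real (l + 1) * scale x ^ (l + 1) = (real l / ((real l + 1) * x)) ^ l"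
        unfolding pow c0_def by (simp add: power_divide power_mult_distrib add.commute)
      then have "real (l + 1) * scale x ^ (l + 1) * R n = (\<Prod>i<l. real l / ((real l + 1) * x)) * (\<Prod>i<l. real (T (n + i)))"
        by (simp add: R_def)
      also have "\<dots> = (\<Prod>i<l. real l * real (T (n + i)) / ((real l + 1) * x))"
        unfolding prod.distrib[symmetric] by simp
      finally show ?thesis .
    qed
    also have "\<bar>\<dots> - 1\<bar> \<le> real l * (1 + E) ^ l * (E / x)"
    proof (rule prod_near_one)
      fix i assume i: "i < l"
      define j where "j = n + i"
      have "real l * real (j div l) \<le> real j" "real j - real l \<le> real l * real (j div l)"
      proof -
        have "l * (j div l) + j mod l = j" by simp
        then have eq: "real l * real (j div l) + real (j mod l) = real j" by (metis of_nat_add of_nat_mult)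
        have "j mod l < l" using l1 by simp
        then have "real (j mod l) \<le> real l" by simp
        then show "real l * real (j div l) \<le> real j" "real j - real l \<le> real l * real (j div l)" using eq by linarith+
      qed
      moreover have "real l * real (T j) = real l * (real w + 1) + real l * real j + real l * real (j div l)"
        by (simp add: T_def algebra_simps)
      moreover have "(real l + 1) * x = (real l + 1) * real n + (real l + 1) * (real n1 + real l)"
        by (simp add: x_def algebra_simps)
      moreover have "(real l + 1) * real j = real l * real j + real j" "(real l + 1) * real j = (real l + 1) * real n + (real l + 1) * real i"
        by (simp_all add: j_def algebra_simps)
      moreover have "(real l + 1) * real i \<le> (real l + 1) * (real n1 + real l)" "0 \<le> (real l + 1) * real i"
        using i by (auto intro!: mult_left_mono)
      moreover have "0 \<le> real l * (real w + 1)" by simp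
      ultimately have diff: "\<bar>real l * real (T j) - (real l + 1) * x\<bar> \<le> E"
        unfolding E_def abs_le_iff by linarith
      have "real l * real (T j) / ((real l + 1) * x) - 1 = (real l * real (T j) - (real l + 1) * x) / ((real l + 1) * x)"
        using x by (simp add: diff_divide_distrib)
      also have "\<bar>\<dots>\<bar> \<le> E / x"
        unfolding abs_divide using diff x E by (intro frac_le) (auto simp: mult_le_cancel_right1)
      finally show "\<bar>real l * real (T (n + i)) / ((real l + 1) * x) - 1\<bar> \<le> E / x" by (simp add: j_def)
    next
      show "E / x \<le> E" using x E by (simp add: pos_divide_le_eq mult_le_cancel_left1)
    qed (use E x in simp)
    also have "\<dots> = real l * (1 + E) ^ l * E * (1 / x)" by simp
    also have "\<dots> \<le> real l * (1 + E) ^ l * E * (scale x / c1)"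
      using inv E by (intro mult_left_mono mult_nonneg_nonneg) auto
    also have "\<dots> = k3 * scale x" by (simp add: k3_def)
    also have "\<dots> \<le> k * scale x" using k_ge s0 by (intro mult_right_mono) auto
    finally show ?thesis unfolding scale_ok_def x_def[symmetric] t_def[symmetric]
      using s0 s1 lower upper by simp
  qed
  then show ?thesis using k_ge by blast
qed

end

lemma null_singleton_prop_density:
  assumes "proportional_density f"
  shows "{x} \<in> null_sets (prop_density f)"
  by (rule proportional_density.null_sets_prop_density[OF assms]) auto

lemma (in urn_model) comp_law_beta:
  assumes "1 \<le> k" "k < r"
  shows "comp_law l s m r k = prop_density (beta_weight (a k) (b k))"
proof (cases "k < s")
  case True
  have "real (m (k + 1)) - real (m k) = real (b k)" using m_incr[of k] assms True by (simp add: b_def of_nat_diff)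
  then show ?thesis
    using True Beta_dist_eq_weight[of "a k" "b k"] a_ge[of k] b_ge[of k] assms by (simp add: comp_law_def a_def)
next
  case False
  have "real (m s) + (real l + 1) * (real k - real s) + real l = real (a k)"
  proof -
    obtain d where "k = s + d" using False le_Suc_ex by (metis not_less)
    then show ?thesis by (simp add: a_def algebra_simps)
  qed
  then show ?thesis
    using False Beta_dist_eq_weight[of "a k" "b k"] a_ge[of k] b_ge[of k] assms by (simp add: comp_law_def b_def)
qed

lemma (in urn_model) comp_law_gga:
  assumes "s < r"
  shows "comp_law l s m r r = prop_density (gga_weight (a r) (l + 1))"
proof -
  have "real (m s) + (real l + 1) * (real r - real s) + real l = real (a r)"
  proof -
    obtain d where "r = s + d" using assms less_imp_add_positive by blast
    then show ?thesis by (simp add: a_def algebra_simps)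
  qed
  then show ?thesis
    using assms GGa_dist_eq_weight[of "a r" "l + 1"] a_ge[of r] by (simp add: comp_law_def add.commute)
qed

theorem theorem2p1:
  fixes l s r :: nat and m :: "nat \<Rightarrow> nat"
  assumes "l \<ge> 1" and "s \<ge> 1" and "m 1 \<ge> 1"
    and "\<forall>k. 1 \<le> k \<and> k < s \<longrightarrow> m (k + 1) \<ge> m k + 1"
    and "r > s"
  shows "\<exists>C>0. \<forall>n\<ge>1. \<forall>K. K \<subseteq> PiE {1..r} (\<lambda>_. UNIV) \<and> convex_fun K \<longrightarrow>
           \<bar>measure_pmf.prob (urn l s m n) {U. Wvec l r n U \<in> K}
             - measure (completion (Z_law l s m r)) K\<bar>
           \<le> C / real n powr (real l / (real l + 1))"
proof -
  interpret urn_model l s m using assms by unfold_locales auto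
  define w where "w = a r"
  have w: "w \<ge> 2" using a_ge[of r] assms by (simp add: w_def)
  interpret Im: immigration l w using assms w by unfold_locales auto
  obtain r' where r': "r = Suc r'" "1 \<le> r'" using assms by (cases r) auto
  \<comment> \<open>Outside \<open>{1..r}\<close> the value is a dummy:
    \<open>continuous_laws\<close> expects an atomless probability law at every index.\<close>
  define L where "L k = comp_law l s m r (if k \<in> {1..r} then k else r)" for k
  have L_beta: "L k = prop_density (beta_weight (a k) (b k))" if "1 \<le> k" "k \<le> r'" for k
    using that comp_law_beta[of k r] r' by (simp add: L_def)
  have L_gga: "L r = prop_density (gga_weight w (l + 1))"
    using comp_law_gga[of r] assms by (simp add: L_def w_def)
  have L_cases: "\<exists>f. proportional_density f \<and> L k = prop_density f" for k
  proof (cases "1 \<le> k \<and> k \<le> r'")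
    case True
    then show ?thesis using L_beta proportional_density_beta by blast
  next
    case False
    then have "k = r \<or> k \<notin> {1..r}" using r' by (auto simp: le_Suc_eq)
    then have "L k = L r" by (auto simp: L_def)
    moreover have "proportional_density (gga_weight w (l + 1))"
      using w by (intro proportional_density_gga) auto
    ultimately show ?thesis using L_gga by auto
  qed
  interpret Law: continuous_laws L r
  proof (rule continuous_laws.intro)
    fix k x
    obtain f where f: "proportional_density f" "L k = prop_density f" using L_cases by blast
    show "prob_space (L k)" unfolding f(2) by (rule proportional_density.prob_space_prop_density[OF f(1)])
    show "sets (L k) = sets borel" unfolding f(2) by (rule proportional_density.sets_prop_density[OF f(1)])
    show "{x} \<in> null_sets (L k)" unfolding f(2) by (rule null_singleton_prop_density[OF f(1)])
  qed
  have Z_eq: "Z_law l s m r = Law.Z_measure"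
    unfolding Z_law_def Law.Z_measure_def
    by (intro arg_cong2[where f="\<lambda>M. distr M (PiM {1..r} (\<lambda>_. lborel))"] PiM_cong) (auto simp: L_def)
  define n1 where "n1 = start r"
  obtain k where k: "k > 0" "\<And>n. Im.scale_ok k n (Im.scale (real (n1 + n + l)))"
    using Im.scale_ok_eventually by blast
  obtain C1 where C1_nonneg: "C1 \<ge> 0" and C1_all:
    "\<forall>f c v. line_variation_le 2 f \<and> (\<forall>v. 0 \<le> f v \<and> f v \<le> 1) \<and> (1 \<le> r' \<longrightarrow> a r' + b r' \<le> v (r' + 1)) \<longrightarrow>
    \<bar>resample_down (\<lambda>v. f (\<lambda>i. c * real (v i))) r' v - integrate_down L f r' (\<lambda>i. c * real (v i))\<bar> \<le> C1 / (real (v (r' + 1)) - 1)"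
    by (atomize_elim, rule resample_integrate_close, rule L_beta, assumption+)
  have C1: "C1 \<ge> 0" "\<bar>resample_down (\<lambda>v. f (\<lambda>i. c * real (v i))) r' v - integrate_down L f r' (\<lambda>i. c * real (v i))\<bar> \<le> C1 / (real (v (r' + 1)) - 1)"
    if "line_variation_le 2 f" "\<And>v. 0 \<le> f v \<and> f v \<le> 1" "a r' + b r' \<le> v (r' + 1)" for f c v
    using C1_nonneg C1_all[THEN spec, of f, THEN spec, of c, THEN spec, of v] that by simp_all
  obtain C2 where C2: "C2 \<ge> 0" "\<And>n c j. Im.scale_ok k n c \<Longrightarrow> Im.Ex (n + j) (\<lambda>i. 1 / (real i - 1)) \<le> C2 * c"
    using Im.scaled_inverse_moment[OF k(1)] by blast
  obtain C3 where C3: "C3 \<ge> 0" "\<And>n c t. Im.scale_ok k n c \<Longrightarrow>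
    \<bar>measure_pmf.prob (Im.X (n + l)) {i. c * real i \<le> t} - measure (prop_density (gga_weight w (l + 1))) {..t}\<bar> \<le> C3 * c"
    using Im.kolmogorov_bound[OF k(1)] by blast
  define \<alpha> where "\<alpha> = real l / (real l + 1)"
  have \<alpha>: "0 \<le> \<alpha>" by (simp add: \<alpha>_def)
  define D where "D = real l powr \<alpha> / (real l + 1)"
  \<comment> \<open>The first summand collects the two errors below, converted from the scale
    \<open>c\<close> to a power of the time; the second covers all times before
    \<open>n1 + l\<close> through the trivial bound 1.\<close>
  define C where "C = (C1 * C2 + 5 * C3) * D + real (n1 + l) powr \<alpha> + 1"
  have D: "D \<ge> 0" by (simp add: D_def)
  have C_pos: "C > 0" unfolding C_def using C1_nonneg C2(1) C3(1) D by (intro add_nonneg_pos) auto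
  have "\<bar>measure_pmf.prob (urn l s m N) {U. Wvec l r N U \<in> K} - measure (completion (Z_law l s m r)) K\<bar> \<le> C / real N powr \<alpha>"
    if N: "N \<ge> 1" and K: "K \<subseteq> PiE {1..r} (\<lambda>_. UNIV)" "convex_fun K" for N K
  proof -
    define f where "f = restricted_indicator r K"
    have f: "line_variation_le 2 f" "\<And>v. 0 \<le> f v \<and> f v \<le> 1"
      unfolding f_def by (rule line_variation_convex[OF K(2)]) (simp add: restricted_indicator_def)
    have Z: "measure (completion (Z_law l s m r)) K = integrate_down L f r (Law.pad r (\<lambda>_. 0))"
      unfolding Z_eq f_def by (rule Law.measure_Z_completion[OF K])
    have Z01: "0 \<le> measure (completion (Z_law l s m r)) K" "measure (completion (Z_law l s m r)) K \<le> 1"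
      using integrate_down_line_variation[OF f, of r L] Law.prob_L unfolding Z by auto
    have Npow: "real N powr \<alpha> > 0" using N by simp
    show ?thesis
    proof (cases "n1 + l \<le> N")
      case False
      have "\<bar>measure_pmf.prob (urn l s m N) {U. Wvec l r N U \<in> K} - measure (completion (Z_law l s m r)) K\<bar> \<le> 1"
        using Z01 measure_pmf.prob_le_1[of "urn l s m N" "{U. Wvec l r N U \<in> K}"]
          measure_nonneg[of "measure_pmf (urn l s m N)" "{U. Wvec l r N U \<in> K}"] by linarith
      also have "1 \<le> C / real N powr \<alpha>"
      proof -
        have "real N powr \<alpha> \<le> real (n1 + l) powr \<alpha>" using False \<alpha> by (intro powr_mono2) auto
        also have "\<dots> \<le> C" unfolding C_def using C1_nonneg C2(1) C3(1) D by simp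
        finally show ?thesis using Npow by simp
      qed
      finally show ?thesis .
    next
      case True
      then obtain n where n: "N = n1 + n + l" by (metis add.assoc add.commute le_Suc_ex)
      define c where "c = Im.scale (real N)"
      have ok: "Im.scale_ok k n c" using k(2)[of n] by (simp add: c_def n)
      have c0: "c > 0" using ok by (simp add: Im.scale_ok_def)
      have c_eq: "c = D / real N powr \<alpha>" by (simp add: c_def Im.scale_def D_def \<alpha>_def)
      define F where "F = integrate_down L f r'"
      have F: "line_variation_le 2 F" "\<And>v. 0 \<le> F v \<and> F v \<le> 1"
        using integrate_down_line_variation[OF f, of r' L] Law.prob_L unfolding F_def by auto
      \<comment> \<open>Since \<open>F\<close> depends on entry \<open>r\<close> alone, it may be
        evaluated on constant vectors; \<open>h\<close> is then the section of \<open>F\<close>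
        along a line and inherits the variation bound.\<close>
      define h where "h x = F (\<lambda>_. x)" for x
      have F_h: "F v = h (v r)" for v
        unfolding F_def h_def
      proof (rule integrate_down_cong[where r=r])
        fix v v' :: "nat \<Rightarrow> real" assume "\<And>i. 1 \<le> i \<Longrightarrow> i \<le> r \<Longrightarrow> v i = v' i"
        then have "restrict v {1..r} = restrict v' {1..r}" by auto
        then show "f v = f v'" by (simp add: f_def restricted_indicator_def)
      next
        fix i assume "r' < i" "i \<le> r"
        then have "i = r" using r' by simp
        then show "v i = v r" by simp
      qed (use r' in simp)
      have h: "variation_le h 2" "\<And>x. 0 \<le> h x" "\<And>x. h x \<le> 1"
        using line_variationD[OF F(1), of "\<lambda>_. 0" "\<lambda>_. 1"] F(2) by (simp_all add: h_def[abs_def])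
      have top: "EU N (\<lambda>W. H (counts W r)) = Im.Ex (n + l) H" for H
      proof -
        have "(\<lambda>i. a r + 1 + i + i div l) = Im.T" by (rule ext, unfold Im.T_def, simp add: w_def)
        then show ?thesis using expectation_top_count[of r "n + l" H] assms(5)
          by (simp add: n n1_def w_def add.assoc)
      qed
      let ?g = "\<lambda>v. f (\<lambda>i. c * real (v i))"
      have "measure_pmf.prob (urn l s m N) {U. Wvec l r N U \<in> K} = EU N (\<lambda>W. ?g (counts W))"
      proof -
        have Wvec_eq: "Wvec l r N W = restrict (\<lambda>i. c * real (counts W i)) {1..r}" for W
          by (simp add: Wvec_def c_def Im.scale_def counts_def)
        have "indicator {U. Wvec l r N U \<in> K} = (\<lambda>W. ?g (counts W))"
          by (rule ext) (simp only: f_def restricted_indicator_def indicator_def mem_Collect_eq Wvec_eq)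
        moreover have "measure_pmf.prob (urn l s m N) {U. Wvec l r N U \<in> K} = EU N (indicator {U. Wvec l r N U \<in> K})"
          by simp
        ultimately show ?thesis by metis
      qed
      also have "\<dots> = EU N (\<lambda>W. resample_down ?g r' (counts W))"
      proof (rule expectation_resample_down)
        show "dep_from 1 ?g"
          unfolding dep_from_def
        proof (intro allI impI)
          fix v v' :: "nat \<Rightarrow> nat" assume "\<forall>i\<ge>1. v i = v' i"
          then have "restrict (\<lambda>i. c * real (v i)) {1..r} = restrict (\<lambda>i. c * real (v' i)) {1..r}" by auto
          then show "?g v = ?g v'" by (simp add: f_def restricted_indicator_def)
        qed
        have "start r' \<le> start r" by (rule start_mono) (simp add: r')
        then show "start r' \<le> N" by (simp add: n n1_def)
      qed
      finally have prob_eq: "measure_pmf.prob (urn l s m N) {U. Wvec l r N U \<in> K} = EU N (\<lambda>W. resample_down ?g r' (counts W))" .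
      \<comment> \<open>Cost of replacing all Polya steps below level \<open>r\<close>: an expected
        inverse of the top count, hence of order \<open>c\<close>.\<close>
      have step1: "\<bar>EU N (\<lambda>W. resample_down ?g r' (counts W)) - Im.Ex (n + l) (\<lambda>i. h (c * real i))\<bar> \<le> C1 * (C2 * c)"
      proof -
        have int: "integrable (measure_pmf (urn l s m N)) (q :: nat multiset \<Rightarrow> real)" for q
          by (rule integrable_measure_pmf_finite) simp
        have "EU N (\<lambda>W. resample_down ?g r' (counts W)) - Im.Ex (n + l) (\<lambda>i. h (c * real i))
          = EU N (\<lambda>W. resample_down ?g r' (counts W) - h (c * real (counts W r)))"
          unfolding top[symmetric] by (rule Bochner_Integration.integral_diff[symmetric]) (rule int)+
        also have "\<bar>\<dots>\<bar> \<le> EU N (\<lambda>W. C1 * (1 / (real (counts W r) - 1)))"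
        proof (rule order_trans[OF integral_abs_bound], rule expectation_mono_on_support)
          fix W assume W: "W \<in> set_pmf (urn l s m N)"
          have "start r' \<le> start r" by (rule start_mono) (simp add: r')
          then have "a r' + b r' \<le> counts W (r' + 1)"
            using counts_ge_start[OF r'(2) _ W] by (simp add: n n1_def)
          then have "\<bar>resample_down ?g r' (counts W) - F (\<lambda>i. c * real (counts W i))\<bar> \<le> C1 / (real (counts W (r' + 1)) - 1)"
            unfolding F_def by (intro C1(2) f)
          then have "\<bar>resample_down ?g r' (counts W) - F (\<lambda>i. c * real (counts W i))\<bar> \<le> C1 / (real (counts W r) - 1)"
            by (simp add: r')
          then show "\<bar>resample_down ?g r' (counts W) - h (c * real (counts W r))\<bar> \<le> C1 * (1 / (real (counts W r) - 1))"
            unfolding F_h by simp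
        qed simp
        also have "\<dots> = Im.Ex (n + l) (\<lambda>i. C1 * (1 / (real i - 1)))" by (rule top)
        also have "\<dots> = C1 * Im.Ex (n + l) (\<lambda>i. 1 / (real i - 1))" by (rule integral_mult_right_zero)
        also have "\<dots> \<le> C1 * (C2 * c)" using C1_nonneg C2(2)[OF ok, of l] by (rule mult_left_mono[rotated])
        finally show ?thesis .
      qed
      \<comment> \<open>Cost of replacing the top count by the generalised gamma variable, with the
        factor 5 for a test function of variation 2.\<close>
      have step2: "\<bar>Im.Ex (n + l) (\<lambda>i. h (c * real i)) - measure (completion (Z_law l s m r)) K\<bar> \<le> 5 * (C3 * c)"
      proof -
        let ?M = "distr (measure_pmf (Im.X (n + l))) borel (\<lambda>i. c * real i)"
        interpret KC: kolmogorov_close ?M "L r" "C3 * c"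
        proof (intro kolmogorov_close.intro kolmogorov_close_axioms.intro)
          show "prob_space ?M" by (rule measure_pmf.prob_space_distr) simp
          show "prob_space (L r)" by (rule Law.prob_L)
          fix t
          have "measure ?M {..t} = measure_pmf.prob (Im.X (n + l)) {i. c * real i \<le> t}"
            by (subst measure_distr) (auto simp: vimage_def)
          then show "\<bar>measure ?M {..t} - measure (L r) {..t}\<bar> \<le> C3 * c"
            using C3(2)[OF ok, of t] by (simp add: L_gga)
        qed simp_all
        have "\<bar>(\<integral>x. h x \<partial>?M) - (\<integral>x. h x \<partial>L r)\<bar> \<le> (2 * 2 + 1) * (C3 * c)"
          by (rule KC.integral_variation_close) (use h in auto)
        moreover have "(\<integral>x. h x \<partial>?M) = Im.Ex (n + l) (\<lambda>i. h (c * real i))"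
          using variation_le_borel_measurable[OF h(1)] by (subst integral_distr) auto
        moreover have "measure (completion (Z_law l s m r)) K = (\<integral>x. h x \<partial>L r)"
        proof -
          \<comment> \<open>Entry \<open>Suc r\<close> of the padded vector is 1, so the outermost
            integral inserts the top variable itself.\<close>
          have "integrate_down L f r (Law.pad r (\<lambda>_. 0)) = (\<integral>x. F ((Law.pad r (\<lambda>_. 0))(r := x * Law.pad r (\<lambda>_. 0) (Suc r))) \<partial>L r)"
            unfolding F_def by (simp add: r')
          also have "\<dots> = (\<integral>x. h x \<partial>L r)"
            unfolding F_h by (simp add: Law.pad_def)
          finally show ?thesis unfolding Z .
        qed
        ultimately show ?thesis by simp
      qed
      have "\<bar>measure_pmf.prob (urn l s m N) {U. Wvec l r N U \<in> K} - measure (completion (Z_law l s m r)) K\<bar>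
        \<le> (C1 * C2 + 5 * C3) * c"
        using step1 step2 unfolding prob_eq by (simp add: algebra_simps abs_le_iff)
      also have "\<dots> = (C1 * C2 + 5 * C3) * D / real N powr \<alpha>" by (simp add: c_eq)
      also have "\<dots> \<le> C / real N powr \<alpha>" by (rule divide_right_mono) (auto simp: C_def)
      finally show ?thesis .
    qed
  qed
  then show ?thesis using C_pos unfolding \<alpha>_def by blast
qed

end
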